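(* Let $d=1$ and $1<\nu<\infty$. Then: (a) For any law $Q$ on $\mathbb{R}$ satisfying $\max_tQ(\{t\})<\nu/(\nu+1)$, the M-functional $(\mu,\sigma)=(\mu_\nu,\sigma_\nu)(Q)$ exists with $\sigma_\nu(Q)>0$ and is the unique critical point with $\partial Qh_\nu/\partial\mu=\partial Qh_\nu/\partial\sigma=0$. On the set of laws satisfying this condition, $(\mu_\nu,\sigma_\nu)$ is analytic with respect to the dual-bounded-Lipschitz norm and thus weakly continuous. (b) For any law $Q$ on $\mathbb{R}$, the extended M-functional $\theta_0(Q):=(\mu_\nu,\sigma_\nu)(Q)\in\mathbb{R}\times[0,\infty)$ exists for $h_\nu$. (c) If $Q(\{s\})\ge\nu/(\nu+1)$ for some (unique) $s$, then $\mu_\nu(Q)=s$ and $\sigma_\nu(Q)=0$. (d) The map $Q\mapsto\theta_0(Q)$ is weakly continuous at every law $Q$. For $X_1,X_2,\dots$ i.i.d. with law $Q$ and empirical measures $Q_n:=n^{-1}\sum_{j=1}^n\delta_{X_j}$, we thus have maximum likelihood estimates $\hat\theta_n=\theta_0(Q_n)$ existing for all $n$ and converging to $\theta_0(Q)$ almost surely.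
   Context: A law is a Borel probability measure. For $x\in\mathbb{R}$, $\theta=(\mu,\sigma)\in\Theta:=\mathbb{R}\times(0,\infty)$, $$h_\nu(x,\theta)=\log\sigma+\frac{\nu+1}{2}\log\left(\frac{1+(x-\mu)^2/(\nu\sigma^2)}{1+x^2/\nu}\right),\qquad Qh_\nu(\theta)=\int h_\nu(x,\theta)\,dQ(x),$$ which is finite for every law $Q$. Let $\overline\Theta=\mathbb{R}\times[0,\infty)$. The M-functional of $Q$ is the unique minimizer of $Qh_\nu$ over $\Theta$, if it exists. A point $\theta_0\in\overline\Theta$ is the extended M-functional of $Q$ for $h_\nu$ iff for every neighborhood $U$ of $\theta_0$, $$-\infty\le\liminf_{\phi\to\theta_0,\ \phi\in\Theta}Qh_\nu(\phi)<\inf_{\phi\in\Theta,\ \phi\notin U}Qh_\nu(\phi)$$ (such a point is necessarily unique if it exists). Dual-bounded-Lipschitz norm: $\|\phi\|^*_{BL}=\sup\{|\phi(f)|:\|f\|_{BL}\le1\}$ on the dual $BL^*(\mathbb{R})$ of the space of bounded Lipschitz functions with $\|f\|_{BL}=\sup|f|+\sup_{x\ne y}|f(x)-f(y)|/|x-y|$; laws $Q$ are identified with $f\mapsto\int f\,dQ$. A functional on a set $\mathcal{D}$ of laws is analytic for this norm if each point of $\mathcal{D}$ has an open neighborhood in $BL^*(\mathbb{R})$ on which there is an analytic function (i.e. $C^\infty$ and locally the sum of a convergent series of homogeneous polynomials) agreeing with the functional at all laws of $\mathcal{D}$ in the neighborhood. Weak continuity is with respect to the topology of weak convergence of laws on $\mathbb{R}$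 and the usual topology of $\mathbb{R}\times[0,\infty)$. *)

theory Defs
  imports "HOL-Probability.Probability"
begin

section \<open>The criterion function and its minimizers\<close>

definition h_crit :: "real \<Rightarrow> real \<Rightarrow> real \<times> real \<Rightarrow> real" where
  "h_crit \<nu> x = (\<lambda>(\<mu>, \<sigma>). ln \<sigma> +
     (\<nu> + 1) / 2 * ln ((1 + (x - \<mu>)\<^sup>2 / (\<nu> * \<sigma>\<^sup>2)) / (1 + x\<^sup>2 / \<nu>)))"

definition Qh :: "real \<Rightarrow> real measure \<Rightarrow> real \<times> real \<Rightarrow> real" where
  "Qh \<nu> Q \<theta> = (\<integral>x. h_crit \<nu> x \<theta> \<partial>Q)"

definition param_space :: "(real \<times> real) set" where
  "param_space = UNIV \<times> {0<..}"

definition ext_param_space :: "(real \<times> real) set" where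
  "ext_param_space = UNIV \<times> {0..}"

definition is_M_functional :: "real \<Rightarrow> real measure \<Rightarrow> real \<times> real \<Rightarrow> bool" where
  "is_M_functional \<nu> Q \<theta> \<longleftrightarrow> \<theta> \<in> param_space \<and>
     (\<forall>\<phi>\<in>param_space. \<phi> \<noteq> \<theta> \<longrightarrow> Qh \<nu> Q \<theta> < Qh \<nu> Q \<phi>)"

definition M_functional :: "real \<Rightarrow> real measure \<Rightarrow> real \<times> real" where
  "M_functional \<nu> Q = (THE \<theta>. is_M_functional \<nu> Q \<theta>)"

definition critical_point :: "real \<Rightarrow> real measure \<Rightarrow> real \<times> real \<Rightarrow> bool" where
  "critical_point \<nu> Q = (\<lambda>(\<mu>, \<sigma>).
     ((\<lambda>m. Qh \<nu> Q (m, \<sigma>)) has_real_derivative 0) (at \<mu>) \<and>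
     ((\<lambda>s. Qh \<nu> Q (\<mu>, s)) has_real_derivative 0) (at \<sigma>))"

text \<open>The comparison takes place in the extended reals: the lower limit may be \<open>-\<infinity>\<close>, and the
  infimum is \<open>\<infinity>\<close> if \<open>U\<close> covers the parameter space.\<close>

definition is_ext_M_functional :: "real \<Rightarrow> real measure \<Rightarrow> real \<times> real \<Rightarrow> bool" where
  "is_ext_M_functional \<nu> Q \<theta>\<^sub>0 \<longleftrightarrow> \<theta>\<^sub>0 \<in> ext_param_space \<and>
     (\<forall>U. open U \<and> \<theta>\<^sub>0 \<in> U \<longrightarrow>
        Liminf (at \<theta>\<^sub>0 within param_space) (\<lambda>\<phi>. ereal (Qh \<nu> Q \<phi>))
          < (INF \<phi>\<in>param_space - U. ereal (Qh \<nu> Q \<phi>)))"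

definition ext_M_functional :: "real \<Rightarrow> real measure \<Rightarrow> real \<times> real" where
  "ext_M_functional \<nu> Q = (THE \<theta>. is_ext_M_functional \<nu> Q \<theta>)"

lemma integrable_h_crit:
  assumes "real_distribution Q" and "1 < \<nu>" and "\<theta> \<in> param_space"
  shows "integrable Q (\<lambda>x. h_crit \<nu> x \<theta>)"
proof -
  interpret real_distribution Q by fact
  obtain \<mu> \<sigma> where th: "\<theta> = (\<mu>, \<sigma>)" and s: "0 < \<sigma>"
    using assms(3) by (auto simp: param_space_def)
  have nu: "0 < \<nu>" using assms(2) by simp
  define r where "r x = (1 + (x - \<mu>)\<^sup>2 / (\<nu> * \<sigma>\<^sup>2)) / (1 + x\<^sup>2 / \<nu>)" for x
  define A where "A = 1 + 2 / \<sigma>\<^sup>2 + 2 * \<mu>\<^sup>2 / (\<nu> * \<sigma>\<^sup>2)"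
  define B where "B = 1 + 2 * \<sigma>\<^sup>2 + 2 * \<mu>\<^sup>2 / \<nu>"
  have AB: "A \<ge> 1" "B \<ge> 1" using nu s by (auto simp: A_def B_def)
  have sq: "(a + b)\<^sup>2 \<le> 2 * a\<^sup>2 + 2 * b\<^sup>2" for a b :: real
    using sum_squares_bound[of a b] by (simp add: power2_sum)
  have num: "1 + (x - \<mu>)\<^sup>2 / (\<nu> * \<sigma>\<^sup>2) \<le> A * (1 + x\<^sup>2 / \<nu>)" for x
  proof -
    have "(x - \<mu>)\<^sup>2 / (\<nu> * \<sigma>\<^sup>2) \<le> (2 * x\<^sup>2 + 2 * \<mu>\<^sup>2) / (\<nu> * \<sigma>\<^sup>2)"
      using sq[of x "- \<mu>"] nu s by (intro divide_right_mono) auto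
    also have "\<dots> = (2 / \<sigma>\<^sup>2) * (x\<^sup>2 / \<nu>) + 2 * \<mu>\<^sup>2 / (\<nu> * \<sigma>\<^sup>2)"
      using nu s by (simp add: field_simps)
    finally have 1: "(x - \<mu>)\<^sup>2 / (\<nu> * \<sigma>\<^sup>2) \<le> (2 / \<sigma>\<^sup>2) * (x\<^sup>2 / \<nu>) + 2 * \<mu>\<^sup>2 / (\<nu> * \<sigma>\<^sup>2)" .
    have "2 / \<sigma>\<^sup>2 * (x\<^sup>2 / \<nu>) \<le> A * (x\<^sup>2 / \<nu>)"
      using nu s by (intro mult_right_mono) (auto simp: A_def)
    moreover have "1 + 2 * \<mu>\<^sup>2 / (\<nu> * \<sigma>\<^sup>2) \<le> A" using s by (simp add: A_def)
    ultimately show ?thesis using 1 by (simp add: distrib_left)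
  qed
  have den: "1 + x\<^sup>2 / \<nu> \<le> B * (1 + (x - \<mu>)\<^sup>2 / (\<nu> * \<sigma>\<^sup>2))" for x
  proof -
    have "x\<^sup>2 / \<nu> \<le> (2 * (x - \<mu>)\<^sup>2 + 2 * \<mu>\<^sup>2) / \<nu>"
      using sq[of "x - \<mu>" \<mu>] nu by (intro divide_right_mono) auto
    also have "\<dots> = (2 * \<sigma>\<^sup>2) * ((x - \<mu>)\<^sup>2 / (\<nu> * \<sigma>\<^sup>2)) + 2 * \<mu>\<^sup>2 / \<nu>"
      using nu s by (simp add: field_simps)
    finally have 1: "x\<^sup>2 / \<nu> \<le> (2 * \<sigma>\<^sup>2) * ((x - \<mu>)\<^sup>2 / (\<nu> * \<sigma>\<^sup>2)) + 2 * \<mu>\<^sup>2 / \<nu>" .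
    have "2 * \<sigma>\<^sup>2 * ((x - \<mu>)\<^sup>2 / (\<nu> * \<sigma>\<^sup>2)) \<le> B * ((x - \<mu>)\<^sup>2 / (\<nu> * \<sigma>\<^sup>2))"
      using nu s by (intro mult_right_mono) (auto simp: B_def)
    moreover have "1 + 2 * \<mu>\<^sup>2 / \<nu> \<le> B" using s by (simp add: B_def)
    ultimately show ?thesis using 1 by (simp add: distrib_left)
  qed
  have pos: "0 < 1 + x\<^sup>2 / \<nu>" "0 < 1 + (x - \<mu>)\<^sup>2 / (\<nu> * \<sigma>\<^sup>2)" for x
    using nu s by (auto intro!: add_pos_nonneg)
  have bnd: "\<bar>ln (r x)\<bar> \<le> ln A + ln B" for x
  proof -
    have r0: "0 < r x" using pos by (simp add: r_def)
    have "r x \<le> A" using num[of x] pos by (simp add: r_def divide_le_eq)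
    hence 1: "ln (r x) \<le> ln A" using r0 AB by simp
    have "1 / B \<le> r x" using den[of x] pos AB by (simp add: r_def field_simps)
    hence "ln (1 / B) \<le> ln (r x)" using r0 AB by (subst ln_le_cancel_iff) auto
    hence "- ln B \<le> ln (r x)" using AB by (simp add: ln_div)
    thus ?thesis using 1 AB by (smt (verit) ln_ge_zero)
  qed
  have "integrable Q (\<lambda>x. ln (r x))"
    by (rule integrable_const_bound[where B = "ln A + ln B"]) (use bnd in \<open>auto simp: r_def\<close>)
  thus ?thesis unfolding th h_crit_def r_def by simp
qed

section \<open>Bounded Lipschitz functions and their dual space\<close>

typedef blfun = "{f :: real \<Rightarrow> real. bounded (range f) \<and> (\<exists>C. C-lipschitz_on UNIV f)}"
  morphisms apply_blfun Abs_blfun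
  by (rule exI[of _ "\<lambda>_. 0"]) (auto intro!: exI[of _ 0] simp: lipschitz_on_def)

setup_lifting type_definition_blfun

definition sup_seminorm :: "(real \<Rightarrow> real) \<Rightarrow> real" where
  "sup_seminorm f = (SUP x. \<bar>f x\<bar>)"

definition lip_seminorm :: "(real \<Rightarrow> real) \<Rightarrow> real" where
  "lip_seminorm f = (SUP (x, y)\<in>{(x, y). x \<noteq> y}. \<bar>f x - f y\<bar> / \<bar>x - y\<bar>)"

lemma offdiag_nonempty: "{(x, y). x \<noteq> (y :: real)} \<noteq> {}"
proof -
  have "(0, 1) \<in> {(x, y). x \<noteq> (y :: real)}" by simp
  thus ?thesis by blast
qed

lemma sup_seminorm_upper:
  assumes "bounded (range f)" shows "\<bar>f x\<bar> \<le> sup_seminorm f"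
proof -
  obtain b where "\<And>x. \<bar>f x\<bar> \<le> b" using assms by (auto simp: bounded_iff)
  thus ?thesis unfolding sup_seminorm_def by (intro cSUP_upper bdd_aboveI2) auto
qed

lemma sup_seminorm_least: "(\<And>x. \<bar>f x\<bar> \<le> b) \<Longrightarrow> sup_seminorm f \<le> b"
  unfolding sup_seminorm_def by (intro cSUP_least) auto

lemma lip_seminorm_upper:
  assumes "\<exists>C. C-lipschitz_on UNIV f" shows "\<bar>f x - f y\<bar> \<le> lip_seminorm f * \<bar>x - y\<bar>"
proof (cases "x = y")
  case False
  obtain C where C: "\<And>x y. \<bar>f x - f y\<bar> \<le> C * \<bar>x - y\<bar>"
    using assms by (auto simp: lipschitz_on_def dist_real_def)
  have "\<bar>f x - f y\<bar> / \<bar>x - y\<bar> \<le> lip_seminorm f"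
    unfolding lip_seminorm_def
    by (rule cSUP_upper2[where x = "(x, y)"])
       (use False C in \<open>auto intro!: bdd_aboveI2[of _ _ C] simp: divide_le_eq\<close>)
  thus ?thesis using False by (simp add: divide_le_eq)
qed simp

lemma lip_seminorm_least:
  assumes "\<And>x y. \<bar>f x - f y\<bar> \<le> b * \<bar>x - y\<bar>" shows "lip_seminorm f \<le> b"
  unfolding lip_seminorm_def using assms
  by (intro cSUP_least offdiag_nonempty) (auto simp: divide_le_eq)

lemma seminorm_nonneg:
  assumes "bounded (range f)" "\<exists>C. C-lipschitz_on UNIV f"
  shows "0 \<le> sup_seminorm f" "0 \<le> lip_seminorm f"
  using sup_seminorm_upper[OF assms(1), of 0] lip_seminorm_upper[OF assms(2), of 0 1] by auto

lemma lin_comb_closed: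
  fixes f g :: "real \<Rightarrow> real"
  assumes f: "bounded (range f) \<and> (\<exists>C. C-lipschitz_on UNIV f)"
    and g: "bounded (range g) \<and> (\<exists>C. C-lipschitz_on UNIV g)"
  shows "bounded (range (\<lambda>x. a * f x + b * g x)) \<and>
    (\<exists>C. C-lipschitz_on UNIV (\<lambda>x. a * f x + b * g x))"
proof (rule conjI)
  obtain A B where AB: "\<And>x. \<bar>f x\<bar> \<le> A" "\<And>x. \<bar>g x\<bar> \<le> B"
    using f g by (auto simp: bounded_iff)
  have "norm (a * f x + b * g x) \<le> \<bar>a\<bar> * A + \<bar>b\<bar> * B" for x
  proof -
    have "norm (a * f x + b * g x) \<le> \<bar>a\<bar> * \<bar>f x\<bar> + \<bar>b\<bar> * \<bar>g x\<bar>"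
      using abs_triangle_ineq[of "a * f x" "b * g x"] by (simp add: abs_mult)
    also have "\<dots> \<le> \<bar>a\<bar> * A + \<bar>b\<bar> * B" by (intro add_mono mult_left_mono AB) auto
    finally show ?thesis .
  qed
  thus "bounded (range (\<lambda>x. a * f x + b * g x))" by (intro boundedI) blast
  obtain C D where "C-lipschitz_on UNIV f" "D-lipschitz_on UNIV g" using f g by blast
  hence "(\<bar>a\<bar> * C + \<bar>b\<bar> * D)-lipschitz_on UNIV (\<lambda>x. a * f x + b * g x)"
    by (intro lipschitz_on_add lipschitz_on_cmult_real)
  thus "\<exists>C. C-lipschitz_on UNIV (\<lambda>x. a * f x + b * g x)" by blast
qed

instantiation blfun :: real_vector
begin

lift_definition zero_blfun :: blfun is "\<lambda>_. 0"
  by (auto intro!: exI[of _ 0] simp: lipschitz_on_def)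

lift_definition plus_blfun :: "blfun \<Rightarrow> blfun \<Rightarrow> blfun" is "\<lambda>f g x. f x + g x"
  subgoal for f g using lin_comb_closed[of f g 1 1] by simp
  done

lift_definition scaleR_blfun :: "real \<Rightarrow> blfun \<Rightarrow> blfun" is "\<lambda>c f x. c * f x"
  subgoal for c f using lin_comb_closed[of f f c 0] by simp
  done

lift_definition uminus_blfun :: "blfun \<Rightarrow> blfun" is "\<lambda>f x. - f x"
  subgoal for f using lin_comb_closed[of f f "-1" 0] by simp
  done

lift_definition minus_blfun :: "blfun \<Rightarrow> blfun \<Rightarrow> blfun" is "\<lambda>f g x. f x - g x"
  subgoal for f g using lin_comb_closed[of f g 1 "-1"] by simp
  done

instance
  by standard (transfer; simp add: fun_eq_iff algebra_simps)+

end

instantiation blfun :: real_normed_vector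
begin

lift_definition norm_blfun :: "blfun \<Rightarrow> real" is "\<lambda>f. sup_seminorm f + lip_seminorm f" .

definition "dist f g = norm (f - g)" for f g :: blfun
definition "sgn f = inverse (norm f) *\<^sub>R f" for f :: blfun
definition "(uniformity :: (blfun \<times> blfun) filter) = (INF e\<in>{0<..}. principal {(x, y). dist x y < e})"
definition "open U = (\<forall>x\<in>U. \<forall>\<^sub>F (x', y) in uniformity. x' = x \<longrightarrow> y \<in> U)" for U :: "blfun set"

instance
proof
  fix f g :: blfun and c :: real
  show "(norm f = 0) = (f = 0)"
  proof
    assume "norm f = 0"
    thus "f = 0"
    proof transfer
      fix f :: "real \<Rightarrow> real"
      assume f: "bounded (range f) \<and> (\<exists>C. C-lipschitz_on UNIV f)"
        and "sup_seminorm f + lip_seminorm f = 0"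
      hence "sup_seminorm f = 0" using seminorm_nonneg[of f] by auto
      thus "f = (\<lambda>_. 0)" using sup_seminorm_upper[of f] f by fastforce
    qed
  next
    assume "f = 0"
    moreover have "norm (0 :: blfun) = 0"
    proof transfer
      have "{(x, y). x \<noteq> (y :: real)} \<noteq> {}" by (rule offdiag_nonempty)
      thus "sup_seminorm (\<lambda>_. 0) + lip_seminorm (\<lambda>_. 0) = 0"
        by (simp add: sup_seminorm_def lip_seminorm_def case_prod_unfold)
    qed
    ultimately show "norm f = 0" by simp
  qed
  show "norm (f + g) \<le> norm f + norm g"
  proof transfer
    fix f g :: "real \<Rightarrow> real"
    assume f: "bounded (range f) \<and> (\<exists>C. C-lipschitz_on UNIV f)"
      and g: "bounded (range g) \<and> (\<exists>C. C-lipschitz_on UNIV g)"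
    have "sup_seminorm (\<lambda>x. f x + g x) \<le> sup_seminorm f + sup_seminorm g"
    proof (rule sup_seminorm_least)
      fix x
      show "\<bar>f x + g x\<bar> \<le> sup_seminorm f + sup_seminorm g"
        using sup_seminorm_upper[of f x] sup_seminorm_upper[of g x] f g by auto
    qed
    moreover have "lip_seminorm (\<lambda>x. f x + g x) \<le> lip_seminorm f + lip_seminorm g"
    proof (rule lip_seminorm_least)
      fix x y
      show "\<bar>f x + g x - (f y + g y)\<bar> \<le> (lip_seminorm f + lip_seminorm g) * \<bar>x - y\<bar>"
        using lip_seminorm_upper[of f x y] lip_seminorm_upper[of g x y] f g
        by (auto simp: distrib_right)
    qed
    ultimately show "sup_seminorm (\<lambda>x. f x + g x) + lip_seminorm (\<lambda>x. f x + g x)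
        \<le> sup_seminorm f + lip_seminorm f + (sup_seminorm g + lip_seminorm g)" by simp
  qed
  have le: "norm (c *\<^sub>R f) \<le> \<bar>c\<bar> * norm f" for c and f :: blfun
  proof transfer
    fix c :: real and f :: "real \<Rightarrow> real"
    assume f: "bounded (range f) \<and> (\<exists>C. C-lipschitz_on UNIV f)"
    have "sup_seminorm (\<lambda>x. c * f x) \<le> \<bar>c\<bar> * sup_seminorm f"
      using f by (intro sup_seminorm_least) (auto simp: abs_mult intro!: mult_left_mono sup_seminorm_upper)
    moreover have "lip_seminorm (\<lambda>x. c * f x) \<le> \<bar>c\<bar> * lip_seminorm f"
    proof (rule lip_seminorm_least)
      fix x y
      have "\<bar>c * f x - c * f y\<bar> = \<bar>c\<bar> * \<bar>f x - f y\<bar>"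
        by (simp add: abs_mult flip: right_diff_distrib)
      also have "\<dots> \<le> \<bar>c\<bar> * (lip_seminorm f * \<bar>x - y\<bar>)"
        using f by (intro mult_left_mono lip_seminorm_upper) auto
      finally show "\<bar>c * f x - c * f y\<bar> \<le> \<bar>c\<bar> * lip_seminorm f * \<bar>x - y\<bar>" by (simp add: mult.assoc)
    qed
    ultimately show "sup_seminorm (\<lambda>x. c * f x) + lip_seminorm (\<lambda>x. c * f x)
        \<le> \<bar>c\<bar> * (sup_seminorm f + lip_seminorm f)" by (simp add: distrib_left)
  qed
  have nn: "0 \<le> norm g" for g :: blfun
    using seminorm_nonneg[of "apply_blfun g"] apply_blfun[of g] by (simp add: norm_blfun.rep_eq)
  show "norm (c *\<^sub>R f) = \<bar>c\<bar> * norm f"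
  proof (cases "c = 0")
    case True
    thus ?thesis using le[of c f] nn[of "c *\<^sub>R f"] by simp
  next
    case False
    have "norm f = norm (inverse c *\<^sub>R (c *\<^sub>R f))" using False by simp
    also have "\<dots> \<le> \<bar>inverse c\<bar> * norm (c *\<^sub>R f)" by (rule le)
    finally have "\<bar>c\<bar> * norm f \<le> norm (c *\<^sub>R f)" using False by (simp add: field_simps)
    thus ?thesis using le[of c f] by simp
  qed
qed (rule dist_blfun_def sgn_blfun_def uniformity_blfun_def open_blfun_def)+

end

lemma abs_apply_blfun_le: "\<bar>apply_blfun f x\<bar> \<le> norm f"
  using seminorm_nonneg[of "apply_blfun f"] sup_seminorm_upper[of "apply_blfun f" x] apply_blfun[of f]
  by (simp add: norm_blfun.rep_eq)

lemma apply_blfun_measurable [measurable]: "apply_blfun f \<in> borel_measurable borel"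
proof -
  obtain C where "C-lipschitz_on UNIV (apply_blfun f)" using apply_blfun[of f] by auto
  thus ?thesis by (intro borel_measurable_continuous_onI lipschitz_on_continuous_on)
qed

text \<open>The library norm on the dual space is the dual-bounded-Lipschitz norm.\<close>

lemma norm_blfun_dual:
  "norm (\<phi> :: blfun \<Rightarrow>\<^sub>L real) = (SUP f\<in>{f. norm f \<le> 1}. \<bar>blinfun_apply \<phi> f\<bar>)"
proof (rule antisym)
  let ?S = "SUP f\<in>{f. norm f \<le> 1}. \<bar>blinfun_apply \<phi> f\<bar>"
  have b: "\<bar>blinfun_apply \<phi> f\<bar> \<le> norm \<phi>" if "norm f \<le> 1" for f
  proof -
    have "\<bar>blinfun_apply \<phi> f\<bar> \<le> norm \<phi> * norm f" using norm_blinfun[of \<phi> f] by simp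
    also have "\<dots> \<le> norm \<phi> * 1" using that by (intro mult_left_mono) auto
    finally show ?thesis by simp
  qed
  hence bdd: "bdd_above ((\<lambda>f. \<bar>blinfun_apply \<phi> f\<bar>) ` {f. norm f \<le> 1})"
    by (intro bdd_aboveI2) auto
  show "?S \<le> norm \<phi>" by (rule cSUP_least) (auto intro: b exI[of _ 0])
  have S0: "0 \<le> ?S" by (rule cSUP_upper2[OF bdd, of 0]) auto
  show "norm \<phi> \<le> ?S"
  proof (rule norm_blinfun_bound[OF S0])
    fix f :: blfun
    show "norm (blinfun_apply \<phi> f) \<le> ?S * norm f"
    proof (cases "f = 0")
      case False
      have "\<bar>blinfun_apply \<phi> (inverse (norm f) *\<^sub>R f)\<bar> \<le> ?S"
        by (rule cSUP_upper[OF _ bdd]) (use False in simp)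
      thus ?thesis using False by (simp add: blinfun.scaleR_right abs_mult field_simps)
    qed (simp add: blinfun.zero_right)
  qed
qed

definition law_dual :: "real measure \<Rightarrow> blfun \<Rightarrow>\<^sub>L real" where
  "law_dual Q = Blinfun (\<lambda>f. \<integral>x. apply_blfun f x \<partial>Q)"

lemma law_dual_apply:
  assumes "real_distribution Q"
  shows "blinfun_apply (law_dual Q) f = (\<integral>x. apply_blfun f x \<partial>Q)"
proof -
  interpret real_distribution Q by fact
  have int: "integrable Q (apply_blfun g)" for g
    by (rule integrable_const_bound[where B = "norm g"]) (auto simp: abs_apply_blfun_le)
  have "bounded_linear (\<lambda>f. \<integral>x. apply_blfun f x \<partial>Q)"
  proof (rule bounded_linear_intro[where K = 1])
    fix f g :: blfun and r :: real
    show "(\<integral>x. apply_blfun (f + g) x \<partial>Q) = (\<integral>x. apply_blfun f x \<partial>Q) + (\<integral>x. apply_blfun g x \<partial>Q)"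
      using int by (simp add: plus_blfun.rep_eq)
    show "(\<integral>x. apply_blfun (r *\<^sub>R f) x \<partial>Q) = r *\<^sub>R (\<integral>x. apply_blfun f x \<partial>Q)"
      by (simp add: scaleR_blfun.rep_eq)
    have "norm (\<integral>x. apply_blfun f x \<partial>Q) \<le> (\<integral>x. norm f \<partial>Q)"
      by (rule Bochner_Integration.integral_norm_bound_integral[OF int]) (auto simp: abs_apply_blfun_le)
    thus "norm (\<integral>x. apply_blfun f x \<partial>Q) \<le> norm f * 1" using prob_space by simp
  qed
  thus ?thesis by (simp add: law_dual_def bounded_linear_Blinfun_apply)
qed

section \<open>Analytic maps between normed spaces\<close>

text \<open>A \<open>k\<close>-linear map is a function of a sequence that only depends on its first \<open>k\<close> entries.\<close>

definition bounded_multilinear ::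
  "nat \<Rightarrow> ((nat \<Rightarrow> 'a::real_normed_vector) \<Rightarrow> 'b::real_normed_vector) \<Rightarrow> bool" where
  "bounded_multilinear k A \<longleftrightarrow>
     (\<forall>v w. (\<forall>i<k. v i = w i) \<longrightarrow> A v = A w) \<and>
     (\<forall>i<k. \<forall>v. linear (\<lambda>u. A (v(i := u)))) \<and>
     (\<exists>C. \<forall>v. norm (A v) \<le> C * (\<Prod>i<k. norm (v i)))"

definition homogeneous_polynomial ::
  "nat \<Rightarrow> ('a::real_normed_vector \<Rightarrow> 'b::real_normed_vector) \<Rightarrow> bool" where
  "homogeneous_polynomial k P \<longleftrightarrow> (\<exists>A. bounded_multilinear k A \<and> (\<forall>x. P x = A (\<lambda>_. x)))"

text \<open>\<open>C\<^sup>\<infinity>\<close> on an open set: \<open>D k x\<close> is the \<open>k\<close>-th Frechet derivative of \<open>G\<close> at \<open>x\<close>, viewed as a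
  \<open>k\<close>-linear map. The last clause says that \<open>D k\<close> is Frechet differentiable at \<open>x\<close>, for the
  operator norm on \<open>k\<close>-linear maps, with derivative \<open>h \<mapsto> D (Suc k) x (h, \<cdot>)\<close>; here
  \<open>case_nat h v\<close> is the sequence \<open>h, v 0, v 1, \<dots>\<close>.\<close>

definition smooth_map_on ::
  "'a::real_normed_vector set \<Rightarrow> ('a \<Rightarrow> 'b::real_normed_vector) \<Rightarrow> bool" where
  "smooth_map_on W G \<longleftrightarrow> (\<exists>D :: nat \<Rightarrow> 'a \<Rightarrow> (nat \<Rightarrow> 'a) \<Rightarrow> 'b.
     (\<forall>x\<in>W. \<forall>v. D 0 x v = G x) \<and>
     (\<forall>k. \<forall>x\<in>W. bounded_multilinear k (D k x)) \<and>
     (\<forall>k. \<forall>x\<in>W. \<forall>\<epsilon>>0. \<exists>\<delta>>0. \<forall>y\<in>W. norm (y - x) < \<delta> \<longrightarrow>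
        (\<forall>v. norm (D k y v - D k x v - D (Suc k) x (case_nat (y - x) v))
               \<le> \<epsilon> * norm (y - x) * (\<Prod>i<k. norm (v i)))))"

definition analytic_map_on ::
  "'a::real_normed_vector set \<Rightarrow> ('a \<Rightarrow> 'b::real_normed_vector) \<Rightarrow> bool" where
  "analytic_map_on W G \<longleftrightarrow> open W \<and> smooth_map_on W G \<and>
     (\<forall>x\<in>W. \<exists>r>0. \<exists>P. ball x r \<subseteq> W \<and> (\<forall>k. homogeneous_polynomial k (P k)) \<and>
        (\<forall>y\<in>ball x r. (\<lambda>k. P k (y - x)) sums G y))"

definition BL_analytic_on ::
  "real measure set \<Rightarrow> (real measure \<Rightarrow> 'b::real_normed_vector) \<Rightarrow> bool" where
  "BL_analytic_on \<D> T \<longleftrightarrow> (\<forall>Q\<in>\<D>. \<exists>W G. law_dual Q \<in> W \<and> analytic_map_on W G \<and>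
     (\<forall>R\<in>\<D>. law_dual R \<in> W \<longrightarrow> G (law_dual R) = T R))"

section \<open>Laws\<close>

definition weak_law_topology :: "real measure topology" where
  "weak_law_topology = topology_generated_by
     {{Q. real_distribution Q \<and> (\<integral>x. apply_bcontfun f x \<partial>Q) \<in> U} |
        (f :: real \<Rightarrow>\<^sub>C real) U. open U}"

lemma topspace_weak_law_topology: "topspace weak_law_topology = {Q. real_distribution Q}"
proof -
  have "{Q. real_distribution Q} \<in> {{Q. real_distribution Q \<and> (\<integral>x. apply_bcontfun f x \<partial>Q) \<in> U} |
      (f :: real \<Rightarrow>\<^sub>C real) U. open U}"
    by (rule CollectI, rule exI, rule exI[of _ UNIV]) simp
  thus ?thesis unfolding weak_law_topology_def topology_generated_by_topspace by blast
qed

definition spread_laws :: "real \<Rightarrow> real measure set" where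
  "spread_laws \<nu> = {Q. real_distribution Q \<and> (SUP t. measure Q {t}) < \<nu> / (\<nu> + 1)}"

text \<open>The supremum over the atoms is a maximum.\<close>

lemma max_atom:
  assumes "real_distribution Q"
  shows "\<exists>t. measure Q {t} = (SUP t. measure Q {t})"
proof -
  interpret real_distribution Q by fact
  let ?s = "SUP t. measure Q {t}"
  have bdd: "bdd_above (range (\<lambda>t. measure Q {t}))" by (rule bdd_aboveI2[of _ _ 1]) simp
  have up: "measure Q {t} \<le> ?s" for t using bdd by (rule cSUP_upper[rotated]) simp
  show ?thesis
  proof (cases "?s \<le> 0")
    case True
    hence "measure Q {0} = ?s" using up[of 0] measure_nonneg[of Q "{0}"] by linarith
    thus ?thesis ..
  next
    case False
    define T where "T = {t. ?s / 2 < measure Q {t}}"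
    have card: "real (card F) * (?s / 2) \<le> 1" if "finite F" "F \<subseteq> T" for F
    proof -
      have "real (card F) * (?s / 2) = (\<Sum>t\<in>F. ?s / 2)" by simp
      also have "\<dots> \<le> (\<Sum>t\<in>F. measure Q {t})"
        using that by (intro sum_mono) (auto simp: T_def)
      also have "\<dots> = measure Q F"
        using that by (subst finite_measure_eq_sum_singleton[of F]) auto
      finally show ?thesis using prob_le_1[of F] by linarith
    qed
    have fin: "finite T"
    proof (rule ccontr)
      assume "infinite T"
      then obtain F where "F \<subseteq> T" "finite F" "card F = Suc (nat \<lceil>2 / ?s\<rceil>)"
        using infinite_arbitrarily_large by blast
      moreover have "2 / ?s < real (Suc (nat \<lceil>2 / ?s\<rceil>))" by linarith
      ultimately show False using card[of F] False by (auto simp: field_simps)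
    qed
    have "?s / 2 < ?s" using False by simp
    then obtain t0 where t0: "t0 \<in> T"
      using less_cSUP_iff[OF _ bdd, of "?s / 2"] by (auto simp: T_def)
    define m where "m = Max ((\<lambda>t. measure Q {t}) ` T)"
    have "m \<in> (\<lambda>t. measure Q {t}) ` T" unfolding m_def using fin t0 by (intro Max_in) auto
    then obtain t1 where t1: "t1 \<in> T" "m = measure Q {t1}" by auto
    have "measure Q {t} \<le> m" for t
    proof (cases "t \<in> T")
      case True thus ?thesis unfolding m_def using fin by (intro Max_ge) auto
    next
      case False thus ?thesis using t1 by (auto simp: T_def)
    qed
    hence "?s \<le> m" by (intro cSUP_least) auto
    thus ?thesis using t1 up[of t1] by (auto intro!: exI[of _ t1])
  qed
qed

text \<open>The pushforward of the uniform law on \<open>{1..n}\<close> along \<open>j \<mapsto> x j\<close>.\<close>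

definition empirical_measure :: "nat \<Rightarrow> (nat \<Rightarrow> real) \<Rightarrow> real measure" where
  "empirical_measure n x = distr (uniform_count_measure {1..n}) borel x"

lemma measure_empirical_measure:
  assumes "1 \<le> n" and "A \<in> sets borel"
  shows "measure (empirical_measure n x) A = (\<Sum>j=1..n. measure (return borel (x j)) A) / real n"
proof -
  have "measure (empirical_measure n x) A
      = measure (uniform_count_measure {1..n}) (x -` A \<inter> {1..n})"
    unfolding empirical_measure_def using assms
    by (subst measure_distr) (auto simp: space_uniform_count_measure sets_uniform_count_measure measurable_def)
  also have "\<dots> = real (card {j\<in>{1..n}. x j \<in> A}) / real n"
    by (subst measure_uniform_count_measure) (auto intro!: arg_cong[of _ _ card])
  also have "real (card {j\<in>{1..n}. x j \<in> A}) = (\<Sum>j=1..n. measure (return borel (x j)) A)"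
    using assms by (simp add: measure_return indicator_def sum.If_cases Int_def)
  finally show ?thesis .
qed

end

theory Submission
  imports Defs "HOL-Complex_Analysis.Complex_Analysis"
begin

text \<open>Write \<open>\<zeta> = \<mu> + \<i> \<surd>\<nu> \<sigma>\<close>. Up to a term that depends only
  on \<open>x\<close>, the criterion is \<open>(\<nu> + 1) / 2\<close> times \<open>ln (\<bar>x - \<zeta>\<bar>\<^sup>2 /
  Im \<zeta>)\<close> plus \<open>(\<nu> - 1) / 2\<close> times \<open>- ln (Im \<zeta>)\<close>. These logarithms are the
  Busemann functions of the hyperbolic upper half plane for the boundary points \<open>x\<close> and
  \<open>\<infinity>\<close>. So \<open>Qh\<close> averages Busemann functions over a measure on the boundary circle:
  \<open>Q\<close> with weight \<open>(\<nu> + 1) / 2\<close> and an atom at \<open>\<infinity>\<close> of weight \<open>(\<nu> - 1) /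
  2\<close>, of total weight \<open>\<nu>\<close>. Its critical points are the conformal barycentres of this
  measure. A barycentre exists unless some boundary point carries at least half of the weight.
  The point at infinity never does, and a real point \<open>t\<close> does exactly if \<open>Q({t}) \<ge> \<nu>
  / (\<nu> + 1)\<close>; then the minimizing sequences run to \<open>(t, 0)\<close>. This explains the threshold.

  Uniqueness (\<open>score_eq_imp_strict_min\<close>): seen from a critical point, the difference of two
  Busemann functions is the logarithm of an affine function on the unit circle, and the score
  equations say that the linear parts average out, so that concavity of the logarithm yields a
  strict global minimum. Existence (\<open>attains_minimum\<close>): \<open>Qh\<close> tends to infinity at infinity
  and at every boundary point that is not a big atom. If there is a big atom at \<open>t\<close>, the score
  equations have no solution (\<open>no_score_eq_of_atom\<close>), hence no minimizer exists, and
  coercivity everywhere else makes \<open>(t, 0)\<close> the extended M-functional (\<open>is_ext_of_atom\<close>).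

  Weak continuity (\<open>tendsto_ext_M_functional\<close>) is a compactness argument: the extended
  M-functional is the only \<open>solution\<close>, solutions for laws near \<open>Q\<close> stay bounded, and near a
  point that is no solution for \<open>Q\<close> there is none for laws close to \<open>Q\<close>. Consistency
  follows, since almost surely the empirical measures converge to \<open>Q\<close> along every bounded
  Lipschitz test function.

  For analyticity, the score equations are written as \<open>S(\<zeta>) = \<i> \<kappa> / Im
  \<zeta>\<close> with the Stieltjes transform \<open>S\<close> of \<open>Q\<close> and \<open>\<kappa> = \<nu> / (\<nu> + 1)\<close>.
  They contain the conjugate of \<open>\<zeta>\<close>, but they imply that this conjugate is \<open>\<zeta> + 2
  \<kappa> / S(\<zeta>)\<close>. Inserting this into \<open>S(cnj \<zeta>) = - S(\<zeta>)\<close> gives one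
  equation that is holomorphic in \<open>\<zeta>\<close> and in the functional on bounded Lipschitz
  functions by which \<open>S\<close> is formed. Its derivative in \<open>\<zeta>\<close> does not vanish at the
  solution (\<open>mate_eq_nondegenerate\<close>; this is where \<open>\<kappa> > 1/2\<close> enters), so a
  contraction gives a root that is holomorphic along complex lines (\<open>analytic_root\<close>). Such a
  function, if locally bounded, restricts to an analytic map (\<open>analytic_real_slice\<close>).\<close>

section \<open>Analyticity from holomorphy along complex lines\<close>

text \<open>The product \<open>E \<times> E\<close> plays the complexification of \<open>E\<close>, with \<open>(a, b)\<close> for
  \<open>a + \<i> b\<close>; then \<open>cline p v t\<close> is \<open>p + t v\<close> for a real direction \<open>v\<close>. Real
  directions suffice because derivatives are only taken along them, while \<open>p\<close> ranges over the
  whole complexification.\<close>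

definition cline :: "'a::real_vector \<times> 'a \<Rightarrow> 'a \<Rightarrow> complex \<Rightarrow> 'a \<times> 'a" where
  "cline p v t = p + (Re t *\<^sub>R v, Im t *\<^sub>R v)"

lemma cline_0 [simp]: "cline p v 0 = p"
  by (simp add: cline_def flip: zero_prod_def)

lemma cline_0_right [simp]: "cline p 0 t = p"
  by (simp add: cline_def flip: zero_prod_def)

lemma cline_shift: "cline p v (s + t) = cline (cline p v s) v t"
  by (simp add: cline_def algebra_simps)

lemma cline_commute: "cline (cline p u s) v t = cline (cline p v t) u s"
  by (simp add: cline_def algebra_simps)

lemma cline_add: "cline p (u + v) t = cline (cline p v t) u t"
  by (simp add: cline_def algebra_simps)

lemma cline_scaleR: "cline p (c *\<^sub>R v) t = cline p v (of_real c * t)"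
  by (simp add: cline_def algebra_simps)

lemma dist_cline:
  fixes v :: "'a::real_normed_vector"
  shows "dist (cline p v s) (cline p v t) = cmod (s - t) * norm v"
proof -
  have "cline p v s - cline p v t = (Re (s - t) *\<^sub>R v, Im (s - t) *\<^sub>R v)"
    by (simp add: cline_def algebra_simps)
  then have "dist (cline p v s) (cline p v t)
      = sqrt ((Re (s - t) * norm v)\<^sup>2 + (Im (s - t) * norm v)\<^sup>2)"
    by (simp only: dist_norm norm_Pair norm_scaleR power_mult_distrib power2_abs)
  also have "\<dots> = sqrt (((Re (s - t))\<^sup>2 + (Im (s - t))\<^sup>2) * (norm v)\<^sup>2)"
    by (simp only: power_mult_distrib distrib_right)
  also have "\<dots> = cmod (s - t) * norm v"
    by (simp add: real_sqrt_mult cmod_def)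
  finally show ?thesis .
qed

lemma dist_cline_0:
  fixes v :: "'a::real_normed_vector"
  shows "dist p (cline p v t) = cmod t * norm v"
  using dist_cline[of p v 0 t] by simp

lemma continuous_on_cline [continuous_intros]:
  fixes v :: "'a::real_normed_vector"
  assumes "continuous_on S p" "continuous_on S t"
  shows "continuous_on S (\<lambda>x. cline (p x) v (t x))"
  unfolding cline_def by (intro continuous_intros assms)

lemma open_cline_vimage:
  fixes v :: "'a::real_normed_vector"
  assumes "open \<Omega>"
  shows "open {t. cline p v t \<in> \<Omega>}"
proof -
  have "continuous_on UNIV (cline p v)" by (intro continuous_intros)
  then show ?thesis using open_vimage[OF assms, of "cline p v"] by (simp add: vimage_def)
qed

text \<open>Holomorphy of maps on a complexified normed space enters only through one complex
  variable at a time. Together with local boundedness this recovers all derivatives by Cauchy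
  estimates.\<close>

definition line_holomorphic ::
    "('a::real_normed_vector \<times> 'a) set \<Rightarrow> ('a \<times> 'a \<Rightarrow> complex) \<Rightarrow> bool" where
  "line_holomorphic \<Omega> f \<longleftrightarrow> (\<forall>p v. (\<lambda>t. f (cline p v t)) holomorphic_on {t. cline p v t \<in> \<Omega>})"

definition dir_deriv :: "'a::real_normed_vector \<Rightarrow> ('a \<times> 'a \<Rightarrow> complex) \<Rightarrow> 'a \<times> 'a \<Rightarrow> complex" where
  "dir_deriv v f p = deriv (\<lambda>t. f (cline p v t)) 0"

lemma cauchy_estimates:
  assumes hol: "g holomorphic_on ball 0 r" and r: "0 < r"
    and M: "\<And>z. z \<in> ball 0 r \<Longrightarrow> cmod (g z) \<le> M"
  shows "cmod (deriv g 0) \<le> 2 * M / r"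
    and "cmod t \<le> r / 4 \<Longrightarrow> cmod (g t - g 0 - t * deriv g 0) \<le> 32 * M * (cmod t)\<^sup>2 / r\<^sup>2"
proof -
  have bnd: "cmod ((deriv ^^ n) g z) \<le> fact n * M / (r / 2) ^ n" if z: "cmod z \<le> r / 4" for n z
  proof (rule Cauchy_inequality[of g z "r / 2"])
    have sub: "cball z (r / 2) \<subseteq> ball 0 r"
    proof
      fix x assume "x \<in> cball z (r / 2)"
      then have "cmod (x - z) \<le> r / 2" by (simp add: dist_norm norm_minus_commute)
      then show "x \<in> ball 0 r" using z r norm_triangle_sub[of x z] by simp
    qed
    show "g holomorphic_on ball z (r / 2)"
      using sub ball_subset_cball by (intro holomorphic_on_subset[OF hol]) blast
    show "continuous_on (cball z (r / 2)) g"
      using sub by (intro holomorphic_on_imp_continuous_on holomorphic_on_subset[OF hol])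
    fix x assume "norm (z - x) = r / 2"
    then have "x \<in> cball z (r / 2)" by (simp add: dist_norm)
    then show "cmod (g x) \<le> M" using sub by (intro M) blast
  qed (use r in auto)
  show "cmod (deriv g 0) \<le> 2 * M / r"
    using bnd[of 0 1] r by (simp add: field_simps)
  assume t: "cmod t \<le> r / 4"
  have "cmod ((deriv ^^ 0) g t - (\<Sum>i\<le>1. (deriv ^^ i) g 0 * (t - 0) ^ i / fact i))
      \<le> (8 * M / r\<^sup>2) * cmod (t - 0) ^ Suc 1 / fact 1"
  proof (rule complex_Taylor[where S = "cball 0 (r / 4)" and f = "\<lambda>i. (deriv ^^ i) g"])
    fix i x assume "x \<in> cball (0::complex) (r / 4)"
    then have "x \<in> ball 0 r" using r by simp
    then have "((deriv ^^ i) g has_field_derivative deriv ((deriv ^^ i) g) x) (at x)"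
      using holomorphic_higher_deriv[OF hol] by (intro holomorphic_derivI[OF _ open_ball]) auto
    then show "((deriv ^^ i) g has_field_derivative (deriv ^^ Suc i) g x) (at x within cball 0 (r / 4))"
      by (auto intro: DERIV_subset)
  next
    fix x assume "x \<in> cball (0::complex) (r / 4)"
    then show "cmod ((deriv ^^ Suc 1) g x) \<le> 8 * M / r\<^sup>2"
      using bnd[of x 2] r by (simp add: numeral_2_eq_2 power2_eq_square field_simps)
  qed (use t r in auto)
  moreover have "8 * M / r\<^sup>2 * (cmod t)\<^sup>2 \<le> 32 * M * (cmod t)\<^sup>2 / r\<^sup>2"
  proof -
    have "0 \<le> M" using M[of 0] r by (simp add: order_trans[OF norm_ge_zero])
    then show ?thesis by (simp add: divide_right_mono mult_right_mono)
  qed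
  ultimately show "cmod (g t - g 0 - t * deriv g 0) \<le> 32 * M * (cmod t)\<^sup>2 / r\<^sup>2"
    by (simp add: numeral_2_eq_2 algebra_simps)
qed

lemma line_holomorphicD:
  "line_holomorphic \<Omega> f \<Longrightarrow> (\<lambda>t. f (cline p v t)) holomorphic_on {t. cline p v t \<in> \<Omega>}"
  unfolding line_holomorphic_def by blast

lemma line_holomorphic_ball:
  fixes f :: "'a::real_normed_vector \<times> 'a \<Rightarrow> complex"
  assumes "line_holomorphic \<Omega> f" "ball p r \<subseteq> \<Omega>" "v \<noteq> 0"
  shows "(\<lambda>t. f (cline p v t)) holomorphic_on ball 0 (r / norm v)"
proof (rule holomorphic_on_subset)
  show "(\<lambda>t. f (cline p v t)) holomorphic_on {t. cline p v t \<in> \<Omega>}"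
    by (rule line_holomorphicD[OF assms(1)])
  show "ball 0 (r / norm v) \<subseteq> {t. cline p v t \<in> \<Omega>}"
    using assms by (auto simp: dist_cline_0 field_simps intro!: subsetD[OF assms(2)])
qed

lemma dir_deriv_zero [simp]: "dir_deriv 0 f p = 0"
  by (simp add: dir_deriv_def)

text \<open>The bounds of \<open>cauchy_estimates\<close> depend on a line only through the length of its
  direction, so they hold uniformly in the direction. This turns differentiability along lines
  into Frechet differentiability.\<close>

lemma dir_deriv_estimates:
  fixes f :: "'a::real_normed_vector \<times> 'a \<Rightarrow> complex"
  assumes hol: "line_holomorphic \<Omega> f" and sub: "ball p r \<subseteq> \<Omega>" and r: "0 < r"
    and M: "\<And>q. q \<in> ball p r \<Longrightarrow> cmod (f q) \<le> M"
  shows "cmod (dir_deriv v f p) \<le> 2 * M * norm v / r"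
    and "cmod t * norm v \<le> r / 4 \<Longrightarrow>
      cmod (f (cline p v t) - f p - t * dir_deriv v f p) \<le> 32 * M * (cmod t * norm v)\<^sup>2 / r\<^sup>2"
proof -
  have M0: "0 \<le> M" using M[of p] r by (simp add: order_trans[OF norm_ge_zero])
  have *: "cmod (dir_deriv v f p) \<le> 2 * M * norm v / r \<and>
    (cmod t * norm v \<le> r / 4 \<longrightarrow>
      cmod (f (cline p v t) - f p - t * dir_deriv v f p) \<le> 32 * M * (cmod t * norm v)\<^sup>2 / r\<^sup>2)" for t
  proof (cases "v = 0")
    case True
    then show ?thesis using M0 by simp
  next
    case False
    let ?g = "\<lambda>t. f (cline p v t)"
    note hb = line_holomorphic_ball[OF hol sub False]
    have pos: "0 < r / norm v" using r False by simp
    have bd: "cmod (?g z) \<le> M" if "z \<in> ball 0 (r / norm v)" for z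
      using that False by (intro M) (simp add: dist_cline_0 field_simps)
    note ce = cauchy_estimates[OF hb pos bd]
    show ?thesis using ce(1) ce(2)[of t] False
      by (simp add: dir_deriv_def field_simps power2_eq_square)
  qed
  show "cmod (dir_deriv v f p) \<le> 2 * M * norm v / r" using * by blast
  show "cmod t * norm v \<le> r / 4 \<Longrightarrow>
      cmod (f (cline p v t) - f p - t * dir_deriv v f p) \<le> 32 * M * (cmod t * norm v)\<^sup>2 / r\<^sup>2"
    using * by blast
qed

definition locally_bounded :: "('a::metric_space) set \<Rightarrow> ('a \<Rightarrow> complex) \<Rightarrow> bool" where
  "locally_bounded \<Omega> f \<longleftrightarrow> (\<forall>p\<in>\<Omega>. \<exists>r>0. \<exists>M. ball p r \<subseteq> \<Omega> \<and> (\<forall>q\<in>ball p r. cmod (f q) \<le> M))"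

lemma ball_half_subset: "q \<in> ball p (r / 2) \<Longrightarrow> ball q (r / 2) \<subseteq> ball (p::'a::metric_space) r"
  by (metis add.commute dist_commute mem_ball subsetI dist_triangle_half_l)

lemma has_field_derivative_cline:
  fixes f :: "'a::real_normed_vector \<times> 'a \<Rightarrow> complex"
  assumes "line_holomorphic \<Omega> f" "open \<Omega>" "cline p v t \<in> \<Omega>"
  shows "((\<lambda>t. f (cline p v t)) has_field_derivative dir_deriv v f (cline p v t)) (at t)"
proof -
  let ?g = "\<lambda>s. f (cline (cline p v t) v s)"
  have "?g holomorphic_on {s. cline (cline p v t) v s \<in> \<Omega>}"
    by (rule line_holomorphicD[OF assms(1)])
  then have "(?g has_field_derivative deriv ?g 0) (at 0)"
    using assms by (intro holomorphic_derivI[OF _ open_cline_vimage]) auto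
  then have "((\<lambda>s. f (cline p v (s + t))) has_field_derivative dir_deriv v f (cline p v t)) (at 0)"
    by (simp add: dir_deriv_def flip: cline_shift add.commute)
  then show ?thesis by (simp add: field_has_derivative_at DERIV_shift[of _ _ 0 t, simplified])
qed

text \<open>On each line the derivative in direction \<open>v\<close> is a locally uniform limit of difference
  quotients with fixed step in direction \<open>v\<close>, and these are holomorphic along the line; the
  Cauchy estimates give the uniformity.\<close>

lemma line_holomorphic_dir_deriv:
  fixes f :: "'a::real_normed_vector \<times> 'a \<Rightarrow> complex"
  assumes hol: "line_holomorphic \<Omega> f" and op: "open \<Omega>" and lb: "locally_bounded \<Omega> f"
  shows "line_holomorphic \<Omega> (dir_deriv v f)"
  unfolding line_holomorphic_def
proof (intro allI)
  fix p u
  let ?S = "{t. cline p u t \<in> \<Omega>}"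
  have opS: "open ?S" by (rule open_cline_vimage[OF op])
  have "(\<lambda>t. dir_deriv v f (cline p u t)) analytic_on ?S"
    unfolding analytic_on_def
  proof
    fix t0 assume "t0 \<in> ?S"
    then have "cline p u t0 \<in> \<Omega>" by simp
    then obtain r M where r: "0 < r" "ball (cline p u t0) r \<subseteq> \<Omega>"
      and M: "\<And>q. q \<in> ball (cline p u t0) r \<Longrightarrow> cmod (f q) \<le> M"
      using lb unfolding locally_bounded_def by blast
    define d where "d = r / 2 / (norm u + 1)"
    have d: "0 < d" using r by (auto simp: d_def intro!: divide_pos_pos add_nonneg_pos)
    have near: "cline p u t \<in> ball (cline p u t0) (r / 2)" if "t \<in> ball t0 d" for t
    proof -
      have "cmod (t0 - t) * norm u \<le> cmod (t0 - t) * (norm u + 1)" by (simp add: mult_left_mono)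
      also have "\<dots> < d * (norm u + 1)"
        using that by (intro mult_strict_right_mono) (auto simp: dist_norm add_nonneg_pos)
      also have "\<dots> = r / 2"
      proof -
        have "norm u + 1 \<noteq> 0" using norm_ge_zero[of u] by linarith
        then show ?thesis using nonzero_eq_divide_eq[of "norm u + 1" d "r / 2"] by (simp add: d_def)
      qed
      finally show ?thesis by (simp add: dist_cline)
    qed
    \<comment> \<open>Starting the step sizes at \<open>1 / (N + 1)\<close> keeps all difference
      quotients inside the ball on which \<open>f\<close> is bounded.\<close>
    obtain N :: nat where N: "norm v / (r / 8) < real N" using reals_Archimedean2 by blast
    define h where "h n = (1 / of_nat (n + N + 1) :: complex)" for n :: nat
    have h: "cmod (h n) * norm v \<le> r / 8" for n
    proof -
      have "norm v \<le> r / 8 * real (n + N + 1)" using N r by (simp add: field_simps add_nonneg_nonneg)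
          (smt (verit) mult_nonneg_nonneg of_nat_0_le_iff)
      then show ?thesis by (simp add: h_def norm_divide field_simps flip: of_nat_Suc of_nat_add)
    qed
    have h0: "h n \<noteq> 0" for n by (simp add: h_def flip: of_nat_Suc of_nat_add)
    define g where "g n t = (f (cline (cline p u t) v (h n)) - f (cline p u t)) / h n" for n t
    have gh: "g n holomorphic_on ball t0 d" for n
    proof -
      have "(\<lambda>t. f (cline (cline p v (h n)) u t)) holomorphic_on ball t0 d"
      proof (rule holomorphic_on_subset)
        show "(\<lambda>t. f (cline (cline p v (h n)) u t)) holomorphic_on {t. cline (cline p v (h n)) u t \<in> \<Omega>}"
          by (rule line_holomorphicD[OF hol])
        show "ball t0 d \<subseteq> {t. cline (cline p v (h n)) u t \<in> \<Omega>}"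
        proof
          fix t assume "t \<in> ball t0 d"
          then have "ball (cline p u t) (r / 2) \<subseteq> \<Omega>" using near[of t] ball_half_subset r by blast
          moreover have "cline (cline p u t) v (h n) \<in> ball (cline p u t) (r / 2)"
            using h[of n] r by (simp add: dist_cline_0)
          ultimately show "t \<in> {t. cline (cline p v (h n)) u t \<in> \<Omega>}"
            by (auto simp: cline_commute[of p v])
        qed
      qed
      moreover have "(\<lambda>t. f (cline p u t)) holomorphic_on ball t0 d"
      proof (rule holomorphic_on_subset)
        show "(\<lambda>t. f (cline p u t)) holomorphic_on ?S"
          by (rule line_holomorphicD[OF hol])
        show "ball t0 d \<subseteq> ?S" proof
          fix t assume "t \<in> ball t0 d"
          then have "cline p u t \<in> ball (cline p u t0) r" using near[of t] r(1) by simp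
          then show "t \<in> ?S" using r(2) by blast
        qed
      qed
      ultimately show ?thesis
        unfolding g_def cline_commute[of p u _ v] using h0 by (intro holomorphic_intros) auto
    qed
    have est: "cmod (g n t - dir_deriv v f (cline p u t)) \<le> cmod (h n) * (128 * M * (norm v)\<^sup>2 / r\<^sup>2)"
      if "t \<in> ball t0 d" for n t
    proof -
      have sub: "ball (cline p u t) (r / 2) \<subseteq> ball (cline p u t0) r"
        using near[OF that] by (rule ball_half_subset)
      have "cmod (f (cline (cline p u t) v (h n)) - f (cline p u t) - h n * dir_deriv v f (cline p u t))
        \<le> 32 * M * (cmod (h n) * norm v)\<^sup>2 / (r / 2)\<^sup>2"
        by (rule dir_deriv_estimates(2)[OF hol]) (use sub r M h[of n] in \<open>auto simp: subset_iff\<close>)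
      moreover have "f (cline (cline p u t) v (h n)) - f (cline p u t) - h n * dir_deriv v f (cline p u t)
        = h n * (g n t - dir_deriv v f (cline p u t))"
        using h0[of n] by (simp add: g_def field_simps)
      ultimately have "cmod (h n) * cmod (g n t - dir_deriv v f (cline p u t))
        \<le> cmod (h n) * (cmod (h n) * (128 * M * (norm v)\<^sup>2 / r\<^sup>2))"
        by (simp only: norm_mult) (simp add: power2_eq_square field_simps)
      then show ?thesis using h0[of n] by (simp only: mult_le_cancel_left) auto
    qed
    have h_lim: "(\<lambda>n. cmod (h n) * C) \<longlonglongrightarrow> 0" for C
    proof -
      have "(\<lambda>n. C * inverse (real (Suc (n + N)))) \<longlonglongrightarrow> C * 0"
        by (intro tendsto_intros LIMSEQ_ignore_initial_segment[OF LIMSEQ_inverse_real_of_nat])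
      then show ?thesis by (simp add: h_def norm_divide field_simps flip: of_nat_Suc of_nat_add)
    qed
    have "(\<lambda>t. dir_deriv v f (cline p u t)) holomorphic_on ball t0 d"
    proof (rule holomorphic_uniform_sequence[OF open_ball gh])
      fix x assume "x \<in> ball t0 d"
      then obtain e where e: "0 < e" "cball x e \<subseteq> ball t0 d"
        using open_contains_cball[of "ball t0 d"] open_ball by blast
      have "uniform_limit (cball x e) g (\<lambda>t. dir_deriv v f (cline p u t)) sequentially"
      proof (rule uniform_limitI)
        fix \<epsilon> :: real assume "0 < \<epsilon>"
        from order_tendstoD(2)[OF h_lim[of "128 * M * (norm v)\<^sup>2 / r\<^sup>2"] this]
        show "\<forall>\<^sub>F n in sequentially. \<forall>x\<in>cball x e. dist (g n x) (dir_deriv v f (cline p u x)) < \<epsilon>"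
        proof eventually_elim
          case (elim n)
          show ?case
          proof
            fix y assume "y \<in> cball x e"
            then show "dist (g n y) (dir_deriv v f (cline p u y)) < \<epsilon>"
              using est[OF subsetD[OF e(2)], of y n] elim by (simp add: dist_norm)
          qed
        qed
      qed
      then show "\<exists>e>0. cball x e \<subseteq> ball t0 d \<and>
          uniform_limit (cball x e) g (\<lambda>t. dir_deriv v f (cline p u t)) sequentially"
        using e by blast
    qed
    then show "\<exists>e>0. (\<lambda>t. dir_deriv v f (cline p u t)) holomorphic_on ball t0 e" using d by blast
  qed
  then show "(\<lambda>t. dir_deriv v f (cline p u t)) holomorphic_on ?S"
    using opS by (simp add: analytic_on_open)
qed

text \<open>A step along \<open>u + v\<close> is a step along \<open>v\<close> followed by a step along \<open>u\<close> from a moved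
  base point. The quotient of the second step is close to the derivative there, uniformly by the
  Cauchy estimates, and that derivative depends continuously on the base point along \<open>v\<close>.\<close>

lemma dir_deriv_add:
  fixes f :: "'a::real_normed_vector \<times> 'a \<Rightarrow> complex"
  assumes hol: "line_holomorphic \<Omega> f" and op: "open \<Omega>" and lb: "locally_bounded \<Omega> f" and p: "p \<in> \<Omega>"
  shows "dir_deriv (u + v) f p = dir_deriv u f p + dir_deriv v f p"
proof -
  obtain r M where r: "0 < r" "ball p r \<subseteq> \<Omega>" and M: "\<And>q. q \<in> ball p r \<Longrightarrow> cmod (f q) \<le> M"
    using lb p unfolding locally_bounded_def by blast
  let ?quot = "\<lambda>w q t. (f (cline q w t) - f q) / t"
  have lim: "((\<lambda>t. ?quot w p t) \<longlongrightarrow> dir_deriv w f p) (at 0)" for w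
    using has_field_derivative_cline[OF hol op, of p w 0] p
    by (simp add: has_field_derivative_iff)
  have "isCont (\<lambda>t. dir_deriv u f (cline p v t)) 0"
    using has_field_derivative_cline[OF line_holomorphic_dir_deriv[OF hol op lb] op, of p v 0 u] p
    by (auto intro: DERIV_isCont)
  then have c: "((\<lambda>t. dir_deriv u f (cline p v t)) \<longlongrightarrow> dir_deriv u f p) (at 0)"
    by (simp add: isCont_def)
  have "((\<lambda>t. ?quot u (cline p v t) t - dir_deriv u f (cline p v t)) \<longlongrightarrow> 0) (at 0)"
  proof (rule Lim_null_comparison)
    have ev: "\<forall>\<^sub>F t in at 0. cmod t * norm w < e" if "0 < e" for w :: 'a and e
    proof (rule order_tendstoD(2)[OF _ that])
      have "((\<lambda>t. cmod t * norm w) \<longlongrightarrow> cmod 0 * norm w) (at 0)" by (intro tendsto_intros)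
      then show "((\<lambda>t. cmod t * norm w) \<longlongrightarrow> 0) (at 0)" by simp
    qed
    have ne: "\<forall>\<^sub>F t in at (0::complex). t \<noteq> 0" by (simp add: eventually_at_filter)
    show "\<forall>\<^sub>F t in at 0. norm (?quot u (cline p v t) t - dir_deriv u f (cline p v t))
        \<le> cmod t * (128 * M * (norm u)\<^sup>2 / r\<^sup>2)"
      using ev[OF half_gt_zero[OF r(1)], of v] ev[of "r / 8" u, OF divide_pos_pos[OF r(1)], simplified] ne
    proof eventually_elim
      case (elim t)
      then have "cline p v t \<in> ball p (r / 2)" using r by (simp add: dist_cline_0)
      then have sub: "ball (cline p v t) (r / 2) \<subseteq> ball p r" by (rule ball_half_subset)
      have "cmod (f (cline (cline p v t) u t) - f (cline p v t) - t * dir_deriv u f (cline p v t))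
        \<le> 32 * M * (cmod t * norm u)\<^sup>2 / (r / 2)\<^sup>2"
        by (rule dir_deriv_estimates(2)[OF hol]) (use sub r M elim in \<open>auto simp: subset_iff\<close>)
      moreover have "f (cline (cline p v t) u t) - f (cline p v t) - t * dir_deriv u f (cline p v t)
          = t * (?quot u (cline p v t) t - dir_deriv u f (cline p v t))"
        using elim by (simp add: field_simps)
      ultimately have "cmod t * cmod (?quot u (cline p v t) t - dir_deriv u f (cline p v t))
          \<le> cmod t * (cmod t * (128 * M * (norm u)\<^sup>2 / r\<^sup>2))"
        by (simp only: norm_mult) (simp add: power2_eq_square field_simps)
      then show ?case using elim by (simp only: mult_le_cancel_left) auto
    qed
    have "((\<lambda>t. cmod t * (128 * M * (norm u)\<^sup>2 / r\<^sup>2)) \<longlongrightarrow> cmod 0 * (128 * M * (norm u)\<^sup>2 / r\<^sup>2)) (at 0)"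
      by (intro tendsto_intros)
    then show "((\<lambda>t. cmod t * (128 * M * (norm u)\<^sup>2 / r\<^sup>2)) \<longlongrightarrow> 0) (at 0)" by simp
  qed
  from tendsto_add[OF tendsto_add[OF this c] lim[of v]]
  have "((\<lambda>t. ?quot u (cline p v t) t + ?quot v p t) \<longlongrightarrow> dir_deriv u f p + dir_deriv v f p) (at 0)"
    by simp
  moreover have "(\<lambda>t. ?quot u (cline p v t) t + ?quot v p t) = (\<lambda>t. ?quot (u + v) p t)"
    by (simp add: cline_add flip: add_divide_distrib)
  ultimately show ?thesis
    using lim[of "u + v"] by (metis (no_types, lifting) LIM_unique)
qed

lemma dir_deriv_scaleR:
  fixes f :: "'a::real_normed_vector \<times> 'a \<Rightarrow> complex"
  assumes hol: "line_holomorphic \<Omega> f" and op: "open \<Omega>" and p: "p \<in> \<Omega>"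
  shows "dir_deriv (c *\<^sub>R v) f p = c *\<^sub>R dir_deriv v f p"
proof -
  have "((\<lambda>t. f (cline p v t)) has_field_derivative dir_deriv v f p) (at (of_real c * 0))"
    using has_field_derivative_cline[OF hol op, of p v 0] p by simp
  moreover have "((*) (of_real c) has_field_derivative of_real c) (at (0::complex))"
    by (auto intro!: derivative_eq_intros)
  ultimately have "((\<lambda>t. f (cline p v (of_real c * t))) has_field_derivative dir_deriv v f p * of_real c) (at 0)"
    by (rule DERIV_chain2)
  then show ?thesis
    by (simp add: dir_deriv_def[of "c *\<^sub>R v"] cline_scaleR DERIV_imp_deriv scaleR_conv_of_real mult.commute)
qed

text \<open>The candidate for the \<open>k\<close>-th derivative, as a function of the sequence of directions:
  the outermost derivative is in direction \<open>v 0\<close>, which matches prepending a direction by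
  \<open>case_nat\<close>.\<close>

primrec iter_deriv :: "('a::real_normed_vector \<times> 'a \<Rightarrow> complex) \<Rightarrow> nat \<Rightarrow> (nat \<Rightarrow> 'a) \<Rightarrow> 'a \<times> 'a \<Rightarrow> complex"
where
  "iter_deriv f 0 v = f"
| "iter_deriv f (Suc k) v = dir_deriv (v 0) (iter_deriv f k (v \<circ> Suc))"

lemma iter_deriv_cong: "(\<And>i. i < k \<Longrightarrow> v i = w i) \<Longrightarrow> iter_deriv f k v = iter_deriv f k w"
proof (induction k arbitrary: v w)
  case (Suc k)
  have "iter_deriv f k (v \<circ> Suc) = iter_deriv f k (w \<circ> Suc)" by (rule Suc.IH) (simp add: Suc.prems)
  then show ?case using Suc.prems[of 0] by simp
qed simp

context
  fixes f :: "'a::real_normed_vector \<times> 'a \<Rightarrow> complex" and \<Omega>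
  assumes hol: "line_holomorphic \<Omega> f" and op: "open \<Omega>" and lb: "locally_bounded \<Omega> f"
begin

text \<open>Both halves are proved together, because the Cauchy estimate that bounds the next
  derivative needs holomorphy of the present one, and holomorphy of the next one needs the
  present bound.\<close>

lemma iter_deriv_bound:
  "(\<forall>v. line_holomorphic \<Omega> (iter_deriv f k v)) \<and>
    (\<forall>p\<in>\<Omega>. \<exists>r>0. \<exists>C. ball p r \<subseteq> \<Omega> \<and> (\<forall>q\<in>ball p r. \<forall>v. cmod (iter_deriv f k v q) \<le> C * (\<Prod>i<k. norm (v i))))"
proof (induction k)
  case 0
  then show ?case using hol lb by (simp add: locally_bounded_def)
next
  case (Suc k)
  have lbk: "locally_bounded \<Omega> (iter_deriv f k v)" for v
    using Suc unfolding locally_bounded_def by blast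
  have "line_holomorphic \<Omega> (iter_deriv f (Suc k) v)" for v
    using line_holomorphic_dir_deriv[OF _ op lbk] Suc by simp
  moreover have "\<exists>r>0. \<exists>C. ball p r \<subseteq> \<Omega> \<and>
      (\<forall>q\<in>ball p r. \<forall>v. cmod (iter_deriv f (Suc k) v q) \<le> C * (\<Prod>i<Suc k. norm (v i)))" if pO: "p \<in> \<Omega>" for p
  proof -
    obtain r C where r: "0 < r" "ball p r \<subseteq> \<Omega>"
      and C: "\<And>q v. q \<in> ball p r \<Longrightarrow> cmod (iter_deriv f k v q) \<le> C * (\<Prod>i<k. norm (v i))"
      using bspec[OF conjunct2[OF Suc] pO] by (elim exE conjE) blast
    have "cmod (iter_deriv f (Suc k) v q) \<le> (4 * C / r) * (\<Prod>i<Suc k. norm (v i))"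
      if q: "q \<in> ball p (r / 2)" for q v
    proof -
      have sub: "ball q (r / 2) \<subseteq> ball p r" using q by (rule ball_half_subset)
      have "cmod (dir_deriv (v 0) (iter_deriv f k (v \<circ> Suc)) q)
          \<le> 2 * (C * (\<Prod>i<k. norm ((v \<circ> Suc) i))) * norm (v 0) / (r / 2)"
      proof (rule dir_deriv_estimates(1))
        show "line_holomorphic \<Omega> (iter_deriv f k (v \<circ> Suc))" using conjunct1[OF Suc] by blast
        show "ball q (r / 2) \<subseteq> \<Omega>" using sub r by blast
      qed (use r sub C in \<open>blast | simp\<close>)+
      also have "\<dots> = (4 * C / r) * (\<Prod>i<Suc k. norm (v i))"
        by (simp add: prod.lessThan_Suc_shift field_simps del: prod.lessThan_Suc)
      finally show ?thesis by simp
    qed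
    moreover have "ball p (r / 2) \<subseteq> \<Omega>" using r(1) order_trans[OF subset_ball r(2), of "r / 2"] by simp
    moreover have "0 < r / 2" using r(1) by simp
    ultimately show ?thesis by blast
  qed
  ultimately show ?case by blast
qed

lemma line_holomorphic_iter_deriv: "line_holomorphic \<Omega> (iter_deriv f k v)"
  using iter_deriv_bound by blast

lemma iter_deriv_uniform_bound:
  assumes "p \<in> \<Omega>"
  obtains r C where "0 < r" "ball p r \<subseteq> \<Omega>"
    "\<forall>q\<in>ball p r. \<forall>v. cmod (iter_deriv f k v q) \<le> C * (\<Prod>i<k. norm (v i))"
  using bspec[OF conjunct2[OF iter_deriv_bound[of k]] assms] by (elim exE conjE) blast

lemma locally_bounded_iter_deriv: "locally_bounded \<Omega> (iter_deriv f k v)"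
  unfolding locally_bounded_def using iter_deriv_bound[of k] by (elim conjE, intro ballI) (drule (1) bspec, blast)

text \<open>Linearity in the outermost direction is linearity of \<open>dir_deriv\<close>; in an inner
  direction it is inherited, since differentiating along a line preserves identities that hold
  on an open set.\<close>

lemma linear_iter_deriv:
  assumes "p \<in> \<Omega>" "i < k"
  shows "linear (\<lambda>u. iter_deriv f k (v(i := u)) p)"
  using assms
proof (induction k arbitrary: i v p)
  case (Suc k)
  note lh = line_holomorphic_iter_deriv and lo = locally_bounded_iter_deriv
  show ?case
  proof (cases i)
    case 0
    have "v(0 := u) \<circ> Suc = v \<circ> Suc" for u by auto
    then have "iter_deriv f (Suc k) (v(0 := u)) p = dir_deriv u (iter_deriv f k (v \<circ> Suc)) p" for u
      by (simp only: iter_deriv.simps fun_upd_same)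
    then show ?thesis using Suc.prems unfolding 0
      by (intro linearI) (simp_all only: dir_deriv_add[OF lh op lo] dir_deriv_scaleR[OF lh op])
  next
    case (Suc j)
    have eq: "v(Suc j := u) \<circ> Suc = (v \<circ> Suc)(j := u)" for u by auto
    let ?g = "\<lambda>u. iter_deriv f k ((v \<circ> Suc)(j := u))"
    have lin: "linear (\<lambda>u. ?g u q)" if "q \<in> \<Omega>" for q
      by (rule Suc.IH[OF that]) (use Suc.prems Suc in simp)
    have der: "((\<lambda>t. ?g u (cline p (v 0) t)) has_field_derivative dir_deriv (v 0) (?g u) p) (at 0)" for u
      using has_field_derivative_cline[OF lh op, of p "v 0" 0] Suc.prems by simp
    have ev: "\<forall>\<^sub>F t in nhds 0. cline p (v 0) t \<in> \<Omega>"
      using eventually_nhds_in_open[OF open_cline_vimage[OF op], of 0 p "v 0"] Suc.prems by simp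
    have "dir_deriv (v 0) (?g (a + b)) p = dir_deriv (v 0) (?g a) p + dir_deriv (v 0) (?g b) p" for a b
    proof -
      have "deriv (\<lambda>t. ?g (a + b) (cline p (v 0) t)) 0
          = deriv (\<lambda>t. ?g a (cline p (v 0) t) + ?g b (cline p (v 0) t)) 0"
        by (rule deriv_cong_ev) (use ev in \<open>auto elim!: eventually_mono simp: linear_add[OF lin]\<close>)
      also have "\<dots> = dir_deriv (v 0) (?g a) p + dir_deriv (v 0) (?g b) p"
        by (intro DERIV_imp_deriv DERIV_add der)
      finally show ?thesis by (simp add: dir_deriv_def)
    qed
    moreover have "dir_deriv (v 0) (?g (c *\<^sub>R a)) p = c *\<^sub>R dir_deriv (v 0) (?g a) p" for c a
    proof -
      have "deriv (\<lambda>t. ?g (c *\<^sub>R a) (cline p (v 0) t)) 0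
          = deriv (\<lambda>t. of_real c * ?g a (cline p (v 0) t)) 0"
        by (rule deriv_cong_ev)
          (use ev in \<open>auto elim!: eventually_mono simp: linear_scale[OF lin] scaleR_conv_of_real\<close>)
      also have "\<dots> = of_real c * dir_deriv (v 0) (?g a) p"
        by (intro DERIV_imp_deriv DERIV_cmult der)
      finally show ?thesis by (simp add: dir_deriv_def scaleR_conv_of_real)
    qed
    moreover have "iter_deriv f (Suc k) (v(Suc j := u)) p = dir_deriv (v 0) (?g u) p" for u
      by (simp only: iter_deriv.simps eq) simp
    ultimately show ?thesis unfolding Suc by (intro linearI) (simp_all only:)
  qed
qed simp

lemma higher_deriv_cline:
  "cline p h t \<in> \<Omega> \<Longrightarrow> (deriv ^^ k) (\<lambda>t. f (cline p h t)) t = iter_deriv f k (\<lambda>_. h) (cline p h t)"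
proof (induction k arbitrary: t)
  case (Suc k)
  have ev: "\<forall>\<^sub>F s in nhds t. cline p h s \<in> \<Omega>"
    using eventually_nhds_in_open[OF open_cline_vimage[OF op], of t p h] Suc.prems by simp
  have "(deriv ^^ Suc k) (\<lambda>t. f (cline p h t)) t = deriv (\<lambda>s. iter_deriv f k (\<lambda>_. h) (cline p h s)) t"
    by (simp, rule deriv_cong_ev) (use ev in \<open>auto elim!: eventually_mono simp: Suc.IH\<close>)
  also have "\<dots> = dir_deriv h (iter_deriv f k (\<lambda>_. h)) (cline p h t)"
    by (rule DERIV_imp_deriv has_field_derivative_cline line_holomorphic_iter_deriv op Suc.prems)+
  finally show ?case by (simp add: comp_def)
qed simp

lemma bounded_multilinear_iter_deriv:
  assumes p: "p \<in> \<Omega>" and L: "bounded_linear (L :: complex \<Rightarrow> 'b::real_normed_vector)"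
  shows "bounded_multilinear k (\<lambda>v. L (iter_deriv f k v p))"
  unfolding bounded_multilinear_def
proof (intro conjI allI impI)
  fix v w :: "nat \<Rightarrow> 'a" assume "\<forall>i<k. v i = w i"
  then show "L (iter_deriv f k v p) = L (iter_deriv f k w p)" using iter_deriv_cong[of k v w f] by simp
next
  fix i v assume "i < k"
  then show "linear (\<lambda>u. L (iter_deriv f k (v(i := u)) p))"
    using linear_compose[OF linear_iter_deriv[OF p] bounded_linear.linear[OF L], of i k v]
    by (simp only: comp_def)
next
  obtain r C where "0 < r" "ball p r \<subseteq> \<Omega>" and C: "\<forall>q\<in>ball p r. \<forall>v. cmod (iter_deriv f k v q) \<le> C * (\<Prod>i<k. norm (v i))"
    by (rule iter_deriv_uniform_bound[OF p, of k])
  then have C: "cmod (iter_deriv f k v p) \<le> C * (\<Prod>i<k. norm (v i))" for v by (auto intro!: bspec)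
  obtain K where K: "0 < K" "\<And>z. norm (L z) \<le> norm z * K" using bounded_linear.pos_bounded[OF L] by blast
  have "norm (L (iter_deriv f k v p)) \<le> (C * K) * (\<Prod>i<k. norm (v i))" for v
    using order_trans[OF K(2) mult_right_mono[OF C less_imp_le[OF K(1)]]] by (simp only: mult_ac)
  then show "\<exists>C. \<forall>v. norm (L (iter_deriv f k v p)) \<le> C * (\<Prod>i<k. norm (v i))" by blast
qed

text \<open>The second-order remainder of \<open>dir_deriv_estimates\<close>, applied to the \<open>k\<close>-th
  derivative with bound \<open>C \<parallel>v 0\<parallel> \<cdots> \<parallel>v (k -
  1)\<parallel>\<close>, is the differentiability of that derivative in operator norm.\<close>

lemma smooth_real_slice:
  assumes L: "bounded_linear (L :: complex \<Rightarrow> 'b::real_normed_vector)"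
  shows "smooth_map_on {x. (x, 0) \<in> \<Omega>} (\<lambda>x. L (f (x, 0)))"
  unfolding smooth_map_on_def
proof (intro exI[of _ "\<lambda>k x v. L (iter_deriv f k v (x, 0))"] conjI ballI allI impI)
  fix k x assume "x \<in> {x. (x, 0) \<in> \<Omega>}"
  then show "bounded_multilinear k (\<lambda>v. L (iter_deriv f k v (x, 0)))"
    by (intro bounded_multilinear_iter_deriv L) simp
next
  fix k x and \<epsilon> :: real assume "x \<in> {x. (x, 0) \<in> \<Omega>}" and \<epsilon>: "0 < \<epsilon>"
  then have p: "(x, 0) \<in> \<Omega>" by simp
  obtain r C where r: "0 < r" "ball (x, 0) r \<subseteq> \<Omega>"
    and C: "\<forall>q\<in>ball (x, 0) r. \<forall>v. cmod (iter_deriv f k v q) \<le> C * (\<Prod>i<k. norm (v i))"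
    by (rule iter_deriv_uniform_bound[OF p, of k])
  obtain K where K: "0 < K" "\<And>z. norm (L z) \<le> norm z * K" using bounded_linear.pos_bounded[OF L] by blast
  define B where "B = 32 * \<bar>C\<bar> * K / r\<^sup>2"
  have B: "0 \<le> B" using K by (simp add: B_def)
  show "\<exists>\<delta>>0. \<forall>y\<in>{x. (x, 0) \<in> \<Omega>}. norm (y - x) < \<delta> \<longrightarrow>
     (\<forall>v. norm (L (iter_deriv f k v (y, 0)) - L (iter_deriv f k v (x, 0)) -
                L (iter_deriv f (Suc k) (case_nat (y - x) v) (x, 0)))
          \<le> \<epsilon> * norm (y - x) * (\<Prod>i<k. norm (v i)))"
  proof (intro exI[of _ "min (r / 4) (\<epsilon> / (B + 1))"] conjI ballI impI allI)
    show "0 < min (r / 4) (\<epsilon> / (B + 1))" using r \<epsilon> B by simp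
    fix y and v :: "nat \<Rightarrow> 'a" assume near: "norm (y - x) < min (r / 4) (\<epsilon> / (B + 1))"
    let ?h = "y - x" and ?P = "\<Prod>i<k. norm (v i)"
    have P: "0 \<le> ?P" by (simp add: prod_nonneg)
    have y: "(y, 0) = cline (x, 0) ?h 1" by (simp add: cline_def)
    have s: "iter_deriv f (Suc k) (case_nat ?h v) (x, 0) = dir_deriv ?h (iter_deriv f k v) (x, 0)"
      by (simp add: comp_def)
    have "cmod (iter_deriv f k v (cline (x, 0) ?h 1) - iter_deriv f k v (x, 0)
         - 1 * dir_deriv ?h (iter_deriv f k v) (x, 0)) \<le> 32 * (C * ?P) * (cmod 1 * norm ?h)\<^sup>2 / r\<^sup>2"
      by (rule dir_deriv_estimates(2)[OF line_holomorphic_iter_deriv]) (use r C near in auto)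
    then have "cmod (iter_deriv f k v (y, 0) - iter_deriv f k v (x, 0) - iter_deriv f (Suc k) (case_nat ?h v) (x, 0))
        \<le> 32 * (C * ?P) * (norm ?h)\<^sup>2 / r\<^sup>2" unfolding y s by simp
    also have "\<dots> \<le> 32 * (\<bar>C\<bar> * ?P) * (norm ?h)\<^sup>2 / r\<^sup>2"
      using P by (intro divide_right_mono mult_right_mono mult_left_mono) auto
    finally have "norm (L (iter_deriv f k v (y, 0) - iter_deriv f k v (x, 0) - iter_deriv f (Suc k) (case_nat ?h v) (x, 0)))
        \<le> 32 * (\<bar>C\<bar> * ?P) * (norm ?h)\<^sup>2 / r\<^sup>2 * K"
      using K by (meson order_trans mult_right_mono less_imp_le)
    also have "\<dots> = (B * norm ?h) * (norm ?h * ?P)" by (simp add: B_def power2_eq_square)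
    also have "\<dots> \<le> \<epsilon> * (norm ?h * ?P)"
    proof (rule mult_right_mono)
      have "B * norm ?h \<le> (B + 1) * norm ?h" by (simp add: mult_right_mono)
      also have "\<dots> \<le> \<epsilon>" using near B by (simp add: pos_less_divide_eq mult.commute)
      finally show "B * norm ?h \<le> \<epsilon>" .
    qed (use P in simp)
    finally show "norm (L (iter_deriv f k v (y, 0)) - L (iter_deriv f k v (x, 0)) -
        L (iter_deriv f (Suc k) (case_nat ?h v) (x, 0))) \<le> \<epsilon> * norm ?h * ?P"
      by (simp add: linear_diff[OF bounded_linear.linear[OF L]] mult.assoc)
  qed
qed simp

text \<open>On the line from \<open>x\<close> towards \<open>y\<close> the function is holomorphic on a disc that contains
  \<open>1\<close>, so its one-variable Taylor series converges at \<open>1\<close>. The \<open>k\<close>-th coefficient is the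
  \<open>k\<close>-th derivative in the repeated direction \<open>y - x\<close>, a homogeneous polynomial.\<close>

theorem analytic_real_slice:
  assumes L: "bounded_linear (L :: complex \<Rightarrow> 'b::real_normed_vector)"
  shows "analytic_map_on {x. (x, 0) \<in> \<Omega>} (\<lambda>x. L (f (x, 0)))"
  unfolding analytic_map_on_def
proof (intro conjI ballI smooth_real_slice L)
  have "continuous_on UNIV (\<lambda>x. (x, 0::'a))" by (intro continuous_intros)
  then show op': "open {x. (x, 0) \<in> \<Omega>}" using open_vimage[OF op] by (simp add: vimage_def)
  fix x assume "x \<in> {x. (x, 0) \<in> \<Omega>}"
  then have p: "(x, 0) \<in> \<Omega>" by simp
  then obtain R where R: "0 < R" "ball (x, 0) R \<subseteq> \<Omega>" using op open_contains_ball by blast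
  note R(1) [simp]
  let ?P = "\<lambda>k h. L (iter_deriv f k (\<lambda>_. h) (x, 0) / fact k)"
  show "\<exists>r>0. \<exists>P. ball x r \<subseteq> {x. (x, 0) \<in> \<Omega>} \<and> (\<forall>k. homogeneous_polynomial k (P k)) \<and>
      (\<forall>y\<in>ball x r. (\<lambda>k. P k (y - x)) sums L (f (y, 0)))"
  proof (intro exI[of _ R] exI[of _ ?P] conjI allI ballI R(1))
    show "ball x R \<subseteq> {x. (x, 0) \<in> \<Omega>}" using R by (auto simp: dist_Pair_Pair)
    fix k
    have "bounded_linear (\<lambda>z. L (z / fact k))"
      by (rule bounded_linear_compose[OF L bounded_linear_divide])
    then show "homogeneous_polynomial k (?P k)"
      unfolding homogeneous_polynomial_def
      by (intro exI[of _ "\<lambda>v. L (iter_deriv f k v (x, 0) / fact k)"] conjI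
          bounded_multilinear_iter_deriv[OF p]) simp_all
  next
    fix y assume y: "y \<in> ball x R"
    let ?h = "y - x" and ?g = "\<lambda>t. f (cline (x, 0) (y - x) t)"
    have "(\<lambda>k. (deriv ^^ k) ?g 0 / fact k * (1 - 0) ^ k) sums ?g 1"
    proof (cases "?h = 0")
      case True
      have "(\<lambda>t::complex. f (x, 0)) holomorphic_on ball 0 2" by (rule holomorphic_on_const)
      from holomorphic_power_series[OF this, of 1] show ?thesis using True by simp
    next
      case False
      show ?thesis
      proof (rule holomorphic_power_series)
        show "?g holomorphic_on ball 0 (R / norm ?h)" by (rule line_holomorphic_ball[OF hol R(2) False])
        show "1 \<in> ball (0::complex) (R / norm ?h)"
          using y False by (simp add: dist_norm norm_minus_commute)
      qed
    qed
    then have "(\<lambda>k. iter_deriv f k (\<lambda>_. ?h) (x, 0) / fact k) sums f (y, 0)"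
      using higher_deriv_cline[of "(x, 0)" ?h 0] p by (simp add: cline_def)
    then show "(\<lambda>k. ?P k ?h) sums L (f (y, 0))" by (rule bounded_linear.sums[OF L])
  qed
qed

end

section \<open>The criterion and the score equations\<close>

text \<open>The squared distance from \<open>x\<close> to the point \<open>\<zeta> = m + \<i> \<surd>\<nu> s\<close> of
  the upper half plane.\<close>

definition q :: "real \<Rightarrow> real \<Rightarrow> real \<Rightarrow> real \<Rightarrow> real" where
  "q \<nu> m s x = \<nu> * s\<^sup>2 + (x - m)\<^sup>2"

lemma q_pos: "0 < \<nu> \<Longrightarrow> 0 < s \<Longrightarrow> 0 < q \<nu> m s x"
  by (simp add: q_def add_pos_nonneg)

lemma q_measurable [measurable]: "q \<nu> m s \<in> borel_measurable borel"
  unfolding q_def by measurable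

lemma h_crit_eq:
  assumes "0 < \<nu>" "0 < s"
  shows "h_crit \<nu> x (m, s) = (\<nu> + 1) / 2 * ln (q \<nu> m s x / (\<nu> + x\<^sup>2)) - \<nu> * ln s"
proof -
  have "(1 + (x - m)\<^sup>2 / (\<nu> * s\<^sup>2)) / (1 + x\<^sup>2 / \<nu>) = q \<nu> m s x / (\<nu> + x\<^sup>2) / s\<^sup>2"
    using assms by (simp add: q_def divide_simps add_nonneg_eq_0_iff)
  moreover have "ln (R / s\<^sup>2) = ln R - 2 * ln s" if "0 < R" for R
    using assms that by (simp add: ln_div ln_realpow)
  moreover have "0 < q \<nu> m s x / (\<nu> + x\<^sup>2)" using assms q_pos[of \<nu> s m x] by (simp add: add_pos_nonneg)
  ultimately show ?thesis
    by (simp only: h_crit_def case_prod_conv) (simp add: field_simps)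
qed

text \<open>For the map \<open>e(x) = (x - cnj \<zeta>) / (x - \<zeta>)\<close> of the real line to the unit
  circle, which sends \<open>\<infinity>\<close> to \<open>1\<close>, the two integrands are \<open>Im (e x) / (2
  \<surd>\<nu> s)\<close> and \<open>(1 - Re (e x)) / 2\<close>. So the equations say that \<open>(\<nu> + 1)\<close> times
  the mean of \<open>e\<close> plus \<open>\<nu> - 1\<close> vanishes: the image of \<open>Q\<close> with the atom at infinity
  has barycentre \<open>0\<close>.\<close>

definition score_eq :: "real \<Rightarrow> real measure \<Rightarrow> real \<Rightarrow> real \<Rightarrow> bool" where
  "score_eq \<nu> Q m s \<longleftrightarrow>
    (\<integral>x. (x - m) / q \<nu> m s x \<partial>Q) = 0 \<and> (\<integral>x. \<nu> * s\<^sup>2 / q \<nu> m s x \<partial>Q) = \<nu> / (\<nu> + 1)"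

locale t_law = real_distribution Q for Q :: "real measure" +
  fixes \<nu> :: real
  assumes nu: "1 < \<nu>"
begin

lemmas law = real_distribution_axioms

lemma integrable_bounded:
  fixes f :: "real \<Rightarrow> real"
  assumes "f \<in> borel_measurable borel" "\<And>x. \<bar>f x\<bar> \<le> B"
  shows "integrable Q f"
  by (rule integrable_const_bound[where B = B]) (use assms in auto)

lemma integrable_ln_q:
  assumes "0 < s"
  shows "integrable Q (\<lambda>x. ln (q \<nu> m s x / (\<nu> + x\<^sup>2)))"
proof -
  have "integrable Q (\<lambda>x. (h_crit \<nu> x (m, s) + \<nu> * ln s) / ((\<nu> + 1) / 2))"
    using integrable_h_crit[OF law nu, of "(m, s)"] assms by (simp add: param_space_def)
  also have "(\<lambda>x. (h_crit \<nu> x (m, s) + \<nu> * ln s) / ((\<nu> + 1) / 2)) = (\<lambda>x. ln (q \<nu> m s x / (\<nu> + x\<^sup>2)))"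
    using nu assms by (simp add: h_crit_eq)
  finally show ?thesis .
qed

lemma Qh_eq:
  assumes "0 < s"
  shows "Qh \<nu> Q (m, s) = (\<nu> + 1) / 2 * (\<integral>x. ln (q \<nu> m s x / (\<nu> + x\<^sup>2)) \<partial>Q) - \<nu> * ln s"
  using integrable_ln_q[OF assms, of m] nu assms prob_space
  by (simp add: Qh_def h_crit_eq)

text \<open>A ratio of two squared distances is an affine function of the two score integrands at
  the reference point. Comparisons of \<open>Qh\<close> at two parameter points rest on this.\<close>

lemma q_ratio:
  assumes "0 < s0"
  shows "q \<nu> m s x / q \<nu> m0 s0 x = 1 + 2 * (m0 - m) * ((x - m0) / q \<nu> m0 s0 x)
    + ((m0 - m)\<^sup>2 + \<nu> * s\<^sup>2 - \<nu> * s0\<^sup>2) / (\<nu> * s0\<^sup>2) * (\<nu> * s0\<^sup>2 / q \<nu> m0 s0 x)"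
proof -
  have "q \<nu> m0 s0 x \<noteq> 0" "\<nu> * s0\<^sup>2 \<noteq> 0" using q_pos[of \<nu> s0 m0 x] nu assms by auto
  then have "1 + 2 * (m0 - m) * ((x - m0) / q \<nu> m0 s0 x)
    + ((m0 - m)\<^sup>2 + \<nu> * s\<^sup>2 - \<nu> * s0\<^sup>2) / (\<nu> * s0\<^sup>2) * (\<nu> * s0\<^sup>2 / q \<nu> m0 s0 x)
    = (q \<nu> m0 s0 x + 2 * (m0 - m) * (x - m0) + ((m0 - m)\<^sup>2 + \<nu> * s\<^sup>2 - \<nu> * s0\<^sup>2)) / q \<nu> m0 s0 x"
    by (simp add: add_divide_distrib)
  also have "q \<nu> m0 s0 x + 2 * (m0 - m) * (x - m0) + ((m0 - m)\<^sup>2 + \<nu> * s\<^sup>2 - \<nu> * s0\<^sup>2) = q \<nu> m s x"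
    by (simp add: q_def power2_eq_square algebra_simps)
  finally show ?thesis by simp
qed

lemma odd_score_bound:
  assumes "0 < s"
  shows "\<bar>(x - m) / q \<nu> m s x\<bar> \<le> 1 / (2 * (sqrt \<nu> * s))"
proof -
  let ?t = "sqrt \<nu> * s"
  have t: "0 < ?t" "q \<nu> m s x = ?t\<^sup>2 + (x - m)\<^sup>2" using nu assms by (auto simp: q_def power_mult_distrib)
  have "2 * ?t * \<bar>x - m\<bar> \<le> q \<nu> m s x"
    using sum_squares_bound[of ?t "\<bar>x - m\<bar>"] t by simp
  then show ?thesis using t q_pos[of \<nu> s m x] nu assms by (simp add: divide_simps abs_mult mult_ac)
qed

lemma even_score_bound:
  assumes "0 < s"
  shows "0 < \<nu> * s\<^sup>2 / q \<nu> m s x" "\<nu> * s\<^sup>2 / q \<nu> m s x \<le> 1"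
  using q_pos[of \<nu> s m x] nu assms by (auto simp: q_def divide_le_eq)

lemma integrable_scores:
  assumes "0 < s"
  shows "integrable Q (\<lambda>x. (x - m) / q \<nu> m s x)" "integrable Q (\<lambda>x. \<nu> * s\<^sup>2 / q \<nu> m s x)"
proof -
  show "integrable Q (\<lambda>x. (x - m) / q \<nu> m s x)"
    by (rule integrable_bounded[where B = "1 / (2 * (sqrt \<nu> * s))"], measurable) (rule odd_score_bound[OF assms])
  show "integrable Q (\<lambda>x. \<nu> * s\<^sup>2 / q \<nu> m s x)"
    by (rule integrable_bounded[where B = 1], measurable)
      (use even_score_bound[OF assms] in \<open>simp only: abs_of_pos\<close>)
qed

text \<open>By the mean value theorem, a Lipschitz bound on the derivative that is uniform in \<open>x\<close>
  makes the remainder of the first-order expansion quadratic, and this survives integration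
  against a probability measure.\<close>

lemma deriv_under_integral:
  fixes F f :: "real \<Rightarrow> real \<Rightarrow> real"
  assumes r: "0 < r"
    and der: "\<And>x t. \<bar>t - t0\<bar> < r \<Longrightarrow> (F x has_real_derivative f x t) (at t)"
    and lip: "\<And>x t. \<bar>t - t0\<bar> < r \<Longrightarrow> \<bar>f x t - f x t0\<bar> \<le> L * \<bar>t - t0\<bar>"
    and intF: "\<And>t. \<bar>t - t0\<bar> < r \<Longrightarrow> integrable Q (\<lambda>x. F x t)"
    and intf: "integrable Q (\<lambda>x. f x t0)"
  shows "((\<lambda>t. \<integral>x. F x t \<partial>Q) has_real_derivative (\<integral>x. f x t0 \<partial>Q)) (at t0)"
proof -
  have est: "\<bar>F x t - F x t0 - (t - t0) * f x t0\<bar> \<le> L * (t - t0)\<^sup>2" if t: "\<bar>t - t0\<bar> < r" for x t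
  proof (cases "t = t0")
    case False
    have L: "0 \<le> L"
      using lip[OF t, of x] False by (meson abs_ge_zero mult_less_cancel_right2 order_trans zero_le_mult_iff
          zero_less_abs_iff right_minus_eq mult_nonneg_nonpos not_less linorder_le_cases mult_le_0_iff)
    have "\<exists>z. \<bar>z - t0\<bar> < \<bar>t - t0\<bar> \<and> F x t - F x t0 = (t - t0) * f x z"
    proof (cases "t0 < t")
      case True
      obtain z where "t0 < z" "z < t" "F x t - F x t0 = (t - t0) * f x z"
        using MVT2[OF True, of "F x" "f x"] der t True by (force simp: abs_if)
      then show ?thesis by (intro exI[of _ z]) auto
    next
      case F: False
      then have lt: "t < t0" using False by simp
      obtain z where "t < z" "z < t0" "F x t0 - F x t = (t0 - t) * f x z"
        using MVT2[OF lt, of "F x" "f x"] der t lt by (force simp: abs_if)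
      then show ?thesis by (intro exI[of _ z]) (auto simp: algebra_simps)
    qed
    then obtain z where z: "\<bar>z - t0\<bar> < \<bar>t - t0\<bar>" "F x t - F x t0 = (t - t0) * f x z" by blast
    have "F x t - F x t0 - (t - t0) * f x t0 = (t - t0) * (f x z - f x t0)"
      using z by (simp add: algebra_simps)
    then have "\<bar>F x t - F x t0 - (t - t0) * f x t0\<bar> = \<bar>t - t0\<bar> * \<bar>f x z - f x t0\<bar>" by (simp add: abs_mult)
    also have "\<dots> \<le> \<bar>t - t0\<bar> * (L * \<bar>t - t0\<bar>)"
      using lip[of z x] z t L by (intro mult_left_mono) (auto intro: order_trans[OF _ mult_left_mono])
    also have "\<dots> = L * (t - t0)\<^sup>2" by (simp add: power2_eq_square abs_mult_self_eq mult.left_commute)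
    finally show ?thesis .
  qed simp
  let ?I = "\<lambda>t. \<integral>x. F x t \<partial>Q" and ?D = "\<integral>x. f x t0 \<partial>Q"
  have quad: "\<bar>?I t - ?I t0 - (t - t0) * ?D\<bar> \<le> L * (t - t0)\<^sup>2" if t: "\<bar>t - t0\<bar> < r" for t
  proof -
    have i: "integrable Q (\<lambda>x. F x t)" "integrable Q (\<lambda>x. F x t0)" using intF t r by auto
    then have "?I t - ?I t0 - (t - t0) * ?D = (\<integral>x. F x t - F x t0 - (t - t0) * f x t0 \<partial>Q)"
      using intf by simp
    moreover have "norm (\<integral>x. F x t - F x t0 - (t - t0) * f x t0 \<partial>Q) \<le> (\<integral>x. L * (t - t0)\<^sup>2 \<partial>Q)"
      using i intf est[OF t] by (intro Bochner_Integration.integral_norm_bound_integral) auto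
    ultimately show ?thesis using prob_space by simp
  qed
  have "((\<lambda>t. (?I t - ?I t0) / (t - t0) - ?D) \<longlongrightarrow> 0) (at t0)"
  proof (rule Lim_null_comparison)
    have "\<forall>\<^sub>F t in at t0. \<bar>t - t0\<bar> < r \<and> t \<noteq> t0"
      using r by (auto simp: eventually_at dist_real_def)
    then show "\<forall>\<^sub>F t in at t0. norm ((?I t - ?I t0) / (t - t0) - ?D) \<le> L * \<bar>t - t0\<bar>"
    proof eventually_elim
      case (elim t)
      have "\<bar>t - t0\<bar> * \<bar>(?I t - ?I t0) / (t - t0) - ?D\<bar> = \<bar>?I t - ?I t0 - (t - t0) * ?D\<bar>"
        using elim by (simp add: field_simps flip: abs_mult)
      also have "\<dots> \<le> \<bar>t - t0\<bar> * (L * \<bar>t - t0\<bar>)"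
        using quad elim by (simp add: power2_eq_square abs_mult_self_eq mult.left_commute)
      finally show ?case using elim by (simp only: mult_le_cancel_left) auto
    qed
    have "((\<lambda>t. L * \<bar>t - t0\<bar>) \<longlongrightarrow> L * \<bar>t0 - t0\<bar>) (at t0)" by (intro tendsto_intros)
    then show "((\<lambda>t. L * \<bar>t - t0\<bar>) \<longlongrightarrow> 0) (at t0)" by simp
  qed
  then show ?thesis unfolding has_field_derivative_iff by (simp add: LIM_zero_iff)
qed

lemma Qh_deriv_m:
  assumes s: "0 < s"
  shows "((\<lambda>m. Qh \<nu> Q (m, s)) has_real_derivative
    - (\<nu> + 1) * (\<integral>x. (x - m) / q \<nu> m s x \<partial>Q)) (at m)"
proof -
  have "((\<lambda>m. \<integral>x. h_crit \<nu> x (m, s) \<partial>Q) has_real_derivative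
      (\<integral>x. - (\<nu> + 1) * ((x - m) / q \<nu> m s x) \<partial>Q)) (at m)"
  proof (rule deriv_under_integral[where r = 1 and L = "(\<nu> + 1) / (\<nu> * s\<^sup>2)"])
    fix x t :: real
    have "0 < \<nu> + x\<^sup>2" using nu by (simp add: add_pos_nonneg)
    then have "((\<lambda>m. (\<nu> + 1) / 2 * ln (q \<nu> m s x / (\<nu> + x\<^sup>2)) - \<nu> * ln s) has_real_derivative
        (\<nu> + 1) / 2 * (1 / (q \<nu> t s x / (\<nu> + x\<^sup>2)) * (2 * (x - t) * (-1) / (\<nu> + x\<^sup>2)))) (at t)"
    proof -
      have "((\<lambda>m. q \<nu> m s x / (\<nu> + x\<^sup>2)) has_real_derivative 2 * (x - t) * (-1) / (\<nu> + x\<^sup>2)) (at t)"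
        unfolding q_def by (intro DERIV_cdivide) (auto intro!: derivative_eq_intros)
      moreover have "0 < q \<nu> t s x / (\<nu> + x\<^sup>2)" using q_pos[of \<nu> s t x] nu s \<open>0 < \<nu> + x\<^sup>2\<close> by simp
      ultimately have "((\<lambda>m. ln (q \<nu> m s x / (\<nu> + x\<^sup>2))) has_real_derivative
          1 / (q \<nu> t s x / (\<nu> + x\<^sup>2)) * (2 * (x - t) * (-1) / (\<nu> + x\<^sup>2))) (at t)"
        by (intro DERIV_chain2[OF DERIV_ln_divide])
      from DERIV_diff[OF DERIV_cmult[OF this, of "(\<nu> + 1) / 2"] DERIV_const[of "\<nu> * ln s"]]
      show ?thesis by simp
    qed
    also have "(\<nu> + 1) / 2 * (1 / (q \<nu> t s x / (\<nu> + x\<^sup>2)) * (2 * (x - t) * (-1) / (\<nu> + x\<^sup>2)))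
       = - (\<nu> + 1) * ((x - t) / q \<nu> t s x)"
    proof -
      have "a / 2 * (1 / (c / w) * (2 * b * (-1) / w)) = - a * (b / c)" if "0 < w" for a b c w :: real
        using that by simp
      then show ?thesis using \<open>0 < \<nu> + x\<^sup>2\<close> by blast
    qed
    finally show "((\<lambda>m. h_crit \<nu> x (m, s)) has_real_derivative - (\<nu> + 1) * ((x - t) / q \<nu> t s x)) (at t)"
      using nu s by (simp add: h_crit_eq)
    let ?a = "\<nu> * s\<^sup>2" and ?y = "x - t" and ?z = "x - m"
    have a: "0 < ?a" using nu s by simp
    have eq: "?y / q \<nu> t s x - ?z / q \<nu> m s x = (m - t) * ((?a - ?y * ?z) / (q \<nu> t s x * q \<nu> m s x))"
    proof -
      have "?y * q \<nu> m s x - ?z * q \<nu> t s x = (m - t) * (?a - ?y * ?z)"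
        by (simp add: q_def power2_eq_square algebra_simps)
      moreover have "q \<nu> t s x \<noteq> 0" "q \<nu> m s x \<noteq> 0"
        using q_pos[of \<nu> s t x] q_pos[of \<nu> s m x] nu s by auto
      ultimately show ?thesis by (simp add: diff_frac_eq)
    qed
    have "?a * \<bar>?a - ?y * ?z\<bar> \<le> ?a * (?a + \<bar>?y\<bar> * \<bar>?z\<bar>)"
      using a by (intro mult_left_mono) (auto simp: abs_mult[symmetric])
    also have "\<dots> \<le> q \<nu> t s x * q \<nu> m s x"
    proof -
      have "q \<nu> t s x * q \<nu> m s x = ?a * (?a + (\<bar>?y\<bar>\<^sup>2 + \<bar>?z\<bar>\<^sup>2)) + (\<bar>?y\<bar> * \<bar>?z\<bar>)\<^sup>2"
        by (simp add: q_def power_mult_distrib algebra_simps)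
      moreover have "\<bar>?y\<bar> * \<bar>?z\<bar> \<le> \<bar>?y\<bar>\<^sup>2 + \<bar>?z\<bar>\<^sup>2"
        using sum_squares_bound[of "\<bar>?y\<bar>" "\<bar>?z\<bar>"] mult_nonneg_nonneg[of "\<bar>?y\<bar>" "\<bar>?z\<bar>"] by linarith
      then have "?a * (?a + \<bar>?y\<bar> * \<bar>?z\<bar>) \<le> ?a * (?a + (\<bar>?y\<bar>\<^sup>2 + \<bar>?z\<bar>\<^sup>2))"
        using a by (intro mult_left_mono) auto
      ultimately show ?thesis using zero_le_power2[of "\<bar>?y\<bar> * \<bar>?z\<bar>"] by linarith
    qed
    finally have "\<bar>(?a - ?y * ?z) / (q \<nu> t s x * q \<nu> m s x)\<bar> \<le> 1 / ?a"
      using q_pos[of \<nu> s t x] q_pos[of \<nu> s m x] nu s a by (simp add: abs_mult divide_simps mult_ac)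
    then have "\<bar>?y / q \<nu> t s x - ?z / q \<nu> m s x\<bar> \<le> \<bar>t - m\<bar> * (1 / ?a)"
      unfolding eq abs_mult abs_minus_commute[of m t] by (rule mult_left_mono) simp
    then have "(\<nu> + 1) * \<bar>?y / q \<nu> t s x - ?z / q \<nu> m s x\<bar> \<le> (\<nu> + 1) * (\<bar>t - m\<bar> * (1 / ?a))"
      using nu by (intro mult_left_mono) auto
    moreover have "- (\<nu> + 1) * (?y / q \<nu> t s x) - - (\<nu> + 1) * (?z / q \<nu> m s x)
        = - ((\<nu> + 1) * (?y / q \<nu> t s x - ?z / q \<nu> m s x))"
    proof -
      have "- k * a - - k * b = - (k * (a - b))" for k a b :: real by (simp add: algebra_simps)
      then show ?thesis .
    qed
    ultimately show "\<bar>- (\<nu> + 1) * (?y / q \<nu> t s x) - - (\<nu> + 1) * (?z / q \<nu> m s x)\<bar>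
        \<le> (\<nu> + 1) / (\<nu> * s\<^sup>2) * \<bar>t - m\<bar>"
      using nu by (simp only: abs_minus_cancel abs_mult) (simp add: mult_ac)
  next
    fix t show "integrable Q (\<lambda>x. h_crit \<nu> x (t, s))"
      using integrable_h_crit[OF law nu, of "(t, s)"] s by (simp add: param_space_def)
  qed (use integrable_mult_right[OF integrable_scores(1)[OF s, of m], of "- (\<nu> + 1)"] in auto)
  then have "((\<lambda>m. \<integral>x. h_crit \<nu> x (m, s) \<partial>Q) has_real_derivative
      - (\<nu> + 1) * (\<integral>x. (x - m) / q \<nu> m s x \<partial>Q)) (at m)"
    by (simp only: integral_mult_right_zero)
  then show ?thesis by (simp add: Qh_def)
qed

lemma Qh_deriv_s:
  assumes s: "0 < s"
  shows "((\<lambda>s. Qh \<nu> Q (m, s)) has_real_derivative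
    ((\<nu> + 1) * (\<integral>x. \<nu> * s\<^sup>2 / q \<nu> m s x \<partial>Q) - \<nu>) / s) (at s)"
proof -
  have "((\<lambda>s. \<integral>x. h_crit \<nu> x (m, s) \<partial>Q) has_real_derivative
      (\<integral>x. (\<nu> + 1) * (\<nu> * s / q \<nu> m s x) - \<nu> / s \<partial>Q)) (at s)"
  proof (rule deriv_under_integral[where r = "s / 2" and L = "(\<nu> + 1) * 2 / s\<^sup>2 + \<nu> * 2 / s\<^sup>2"])
    fix x t :: real assume "\<bar>t - s\<bar> < s / 2"
    then have t: "s / 2 < t" "0 < t" using s by (auto simp: abs_if split: if_splits)
    have xx: "0 < \<nu> + x\<^sup>2" using nu by (simp add: add_pos_nonneg)
    then have "((\<lambda>s. (\<nu> + 1) / 2 * ln (q \<nu> m s x / (\<nu> + x\<^sup>2)) - \<nu> * ln s) has_real_derivative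
        (\<nu> + 1) / 2 * (1 / (q \<nu> m t x / (\<nu> + x\<^sup>2)) * (\<nu> * (2 * t) / (\<nu> + x\<^sup>2))) - \<nu> * (1 / t)) (at t)"
    proof -
      have "((\<lambda>s. q \<nu> m s x / (\<nu> + x\<^sup>2)) has_real_derivative \<nu> * (2 * t) / (\<nu> + x\<^sup>2)) (at t)"
        unfolding q_def by (intro DERIV_cdivide) (auto intro!: derivative_eq_intros)
      moreover have "0 < q \<nu> m t x / (\<nu> + x\<^sup>2)" using q_pos[of \<nu> t m x] nu t xx by simp
      ultimately have "((\<lambda>s. ln (q \<nu> m s x / (\<nu> + x\<^sup>2))) has_real_derivative
          1 / (q \<nu> m t x / (\<nu> + x\<^sup>2)) * (\<nu> * (2 * t) / (\<nu> + x\<^sup>2))) (at t)"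
        by (intro DERIV_chain2[OF DERIV_ln_divide])
      from DERIV_diff[OF DERIV_cmult[OF this, of "(\<nu> + 1) / 2"] DERIV_cmult[OF DERIV_ln_divide[OF t(2)], of \<nu>]]
      show ?thesis .
    qed
    also have "(\<nu> + 1) / 2 * (1 / (q \<nu> m t x / (\<nu> + x\<^sup>2)) * (\<nu> * (2 * t) / (\<nu> + x\<^sup>2))) - \<nu> * (1 / t)
       = (\<nu> + 1) * (\<nu> * t / q \<nu> m t x) - \<nu> / t"
      using xx by simp
    finally have "((\<lambda>s. (\<nu> + 1) / 2 * ln (q \<nu> m s x / (\<nu> + x\<^sup>2)) - \<nu> * ln s) has_real_derivative
        (\<nu> + 1) * (\<nu> * t / q \<nu> m t x) - \<nu> / t) (at t)" .
    then show "((\<lambda>s. h_crit \<nu> x (m, s)) has_real_derivative (\<nu> + 1) * (\<nu> * t / q \<nu> m t x) - \<nu> / t) (at t)"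
      by (rule has_field_derivative_transform_within[where d = t and S = UNIV])
        (use nu t in \<open>auto simp: h_crit_eq dist_real_def abs_if split: if_splits\<close>)
    let ?y = "(x - m)\<^sup>2"
    have pos: "0 < q \<nu> m t x" "0 < q \<nu> m s x" "0 < \<nu> * (s * t)" using q_pos nu s t by auto
    have eq: "\<nu> * t / q \<nu> m t x - \<nu> * s / q \<nu> m s x = \<nu> * (t - s) * ((?y - \<nu> * (s * t)) / (q \<nu> m t x * q \<nu> m s x))"
    proof -
      have "\<nu> * t * q \<nu> m s x - \<nu> * s * q \<nu> m t x = \<nu> * (t - s) * (?y - \<nu> * (s * t))"
        by (simp add: q_def power2_eq_square algebra_simps)
      then show ?thesis using pos by (simp add: diff_frac_eq)
    qed
    have "\<nu> * (s * t) * \<bar>?y - \<nu> * (s * t)\<bar> \<le> q \<nu> m t x * q \<nu> m s x"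
    proof -
      have "(?y + \<nu> * (s * t))\<^sup>2 + \<nu> * ?y * (s - t)\<^sup>2 = q \<nu> m t x * q \<nu> m s x"
        by (simp add: q_def power2_eq_square algebra_simps)
      moreover have "0 \<le> \<nu> * ?y * (s - t)\<^sup>2" using nu by simp
      moreover have "\<nu> * (s * t) * \<bar>?y - \<nu> * (s * t)\<bar> \<le> (?y + \<nu> * (s * t)) * (?y + \<nu> * (s * t))"
        using pos zero_le_power2[of "x - m"] by (intro mult_mono) linarith+
      ultimately show ?thesis by (simp add: power2_eq_square)
    qed
    then have "\<bar>(?y - \<nu> * (s * t)) / (q \<nu> m t x * q \<nu> m s x)\<bar> \<le> 1 / (\<nu> * (s * t))"
      using pos by (simp add: abs_mult divide_simps mult_ac)
    then have "\<bar>\<nu> * (t - s)\<bar> * \<bar>(?y - \<nu> * (s * t)) / (q \<nu> m t x * q \<nu> m s x)\<bar> \<le> \<bar>\<nu> * (t - s)\<bar> * (1 / (\<nu> * (s * t)))"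
      by (rule mult_left_mono) simp
    then have 1: "\<bar>\<nu> * t / q \<nu> m t x - \<nu> * s / q \<nu> m s x\<bar> \<le> \<bar>t - s\<bar> * (1 / (s * t))"
      unfolding eq abs_mult using nu by simp
    have "1 / (s * t) \<le> 2 / s\<^sup>2" using t s by (simp add: divide_simps power2_eq_square)
    then have st: "\<bar>t - s\<bar> * (1 / (s * t)) \<le> \<bar>t - s\<bar> * (2 / s\<^sup>2)" by (intro mult_left_mono) auto
    have "\<nu> / s - \<nu> / t = \<nu> * ((t - s) * (1 / (s * t)))" using s t by (simp add: field_simps)
    then have "\<bar>\<nu> / s - \<nu> / t\<bar> = \<nu> * (\<bar>t - s\<bar> * (1 / (s * t)))" using nu s t by (simp add: abs_mult)
    also have "\<dots> \<le> \<nu> * (\<bar>t - s\<bar> * (2 / s\<^sup>2))" by (rule mult_left_mono[OF st]) (use nu in simp)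
    finally have 2: "\<bar>\<nu> / s - \<nu> / t\<bar> \<le> \<nu> * (\<bar>t - s\<bar> * (2 / s\<^sup>2))" .
    have 3: "(\<nu> + 1) * \<bar>\<nu> * t / q \<nu> m t x - \<nu> * s / q \<nu> m s x\<bar> \<le> (\<nu> + 1) * (\<bar>t - s\<bar> * (2 / s\<^sup>2))"
      by (rule mult_left_mono[OF order_trans[OF 1 st]]) (use nu in simp)
    have "\<bar>(\<nu> + 1) * (\<nu> * t / q \<nu> m t x) - \<nu> / t - ((\<nu> + 1) * (\<nu> * s / q \<nu> m s x) - \<nu> / s)\<bar>
      = \<bar>(\<nu> + 1) * (\<nu> * t / q \<nu> m t x - \<nu> * s / q \<nu> m s x) + (\<nu> / s - \<nu> / t)\<bar>"
      by (simp add: algebra_simps)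
    also have "\<dots> \<le> \<bar>(\<nu> + 1) * (\<nu> * t / q \<nu> m t x - \<nu> * s / q \<nu> m s x)\<bar> + \<bar>\<nu> / s - \<nu> / t\<bar>"
      by (rule abs_triangle_ineq)
    also have "\<dots> = (\<nu> + 1) * \<bar>\<nu> * t / q \<nu> m t x - \<nu> * s / q \<nu> m s x\<bar> + \<bar>\<nu> / s - \<nu> / t\<bar>"
      using nu by (simp add: abs_mult)
    also have "\<dots> \<le> (\<nu> + 1) * (\<bar>t - s\<bar> * (2 / s\<^sup>2)) + \<nu> * (\<bar>t - s\<bar> * (2 / s\<^sup>2))"
      using 2 3 by linarith
    also have "\<dots> = ((\<nu> + 1) * 2 / s\<^sup>2 + \<nu> * 2 / s\<^sup>2) * \<bar>t - s\<bar>"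
      using s by (simp add: field_simps)
    finally show "\<bar>(\<nu> + 1) * (\<nu> * t / q \<nu> m t x) - \<nu> / t - ((\<nu> + 1) * (\<nu> * s / q \<nu> m s x) - \<nu> / s)\<bar>
       \<le> ((\<nu> + 1) * 2 / s\<^sup>2 + \<nu> * 2 / s\<^sup>2) * \<bar>t - s\<bar>" .
    show "integrable Q (\<lambda>x. h_crit \<nu> x (m, t))"
      using integrable_h_crit[OF law nu, of "(m, t)"] t by (simp add: param_space_def)
  next
    have "integrable Q (\<lambda>x. (\<nu> + 1) / s * (\<nu> * s\<^sup>2 / q \<nu> m s x) - \<nu> / s)"
      by (intro Bochner_Integration.integrable_diff integrable_mult_right integrable_scores s) simp
    moreover have "(\<nu> + 1) / s * (\<nu> * s\<^sup>2 / d) = (\<nu> + 1) * (\<nu> * s / d)" for d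
      using s by (simp add: power2_eq_square)
    ultimately show "integrable Q (\<lambda>x. (\<nu> + 1) * (\<nu> * s / q \<nu> m s x) - \<nu> / s)" by simp
  qed (use s in auto)
  moreover have "(\<integral>x. (\<nu> + 1) * (\<nu> * s / q \<nu> m s x) - \<nu> / s \<partial>Q)
      = ((\<nu> + 1) * (\<integral>x. \<nu> * s\<^sup>2 / q \<nu> m s x \<partial>Q) - \<nu>) / s"
  proof -
    have "(\<integral>x. (\<nu> + 1) * (\<nu> * s / q \<nu> m s x) - \<nu> / s \<partial>Q)
      = (\<integral>x. ((\<nu> + 1) * (\<nu> * s\<^sup>2 / q \<nu> m s x) - \<nu>) / s \<partial>Q)"
      using s by (intro Bochner_Integration.integral_cong) (auto simp: field_simps power2_eq_square)
    then show ?thesis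
      using integrable_scores(2)[OF s, of m] prob_space by (simp del: times_divide_eq_right)
  qed
  ultimately show ?thesis by (simp add: Qh_def)
qed

lemma critical_point_iff:
  assumes "0 < s"
  shows "critical_point \<nu> Q (m, s) \<longleftrightarrow> score_eq \<nu> Q m s"
proof -
  have "((\<lambda>m. Qh \<nu> Q (m, s)) has_real_derivative 0) (at m) \<longleftrightarrow> (\<integral>x. (x - m) / q \<nu> m s x \<partial>Q) = 0"
    using DERIV_unique[OF Qh_deriv_m[OF assms, of m]] Qh_deriv_m[OF assms, of m] nu by fastforce
  moreover have "((\<lambda>s. Qh \<nu> Q (m, s)) has_real_derivative 0) (at s)
      \<longleftrightarrow> (\<integral>x. \<nu> * s\<^sup>2 / q \<nu> m s x \<partial>Q) = \<nu> / (\<nu> + 1)"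
  proof -
    have e: "((\<nu> + 1) * I - \<nu>) / s = 0 \<longleftrightarrow> I = \<nu> / (\<nu> + 1)" for I
      using nu assms by (auto simp: field_simps)
    show ?thesis
      using DERIV_unique[OF Qh_deriv_s[OF assms, of m]] Qh_deriv_s[OF assms, of m] unfolding e[symmetric]
      by fastforce
  qed
  ultimately show ?thesis by (simp add: critical_point_def score_eq_def)
qed

end

section \<open>A solution of the score equations is the strict minimizer\<close>

text \<open>With \<open>C = cosh d\<close> and \<open>S = sinh d\<close> this compares the logarithm with its chord
  between \<open>e\<^sup>-\<^sup>d\<close> and \<open>e\<^sup>d\<close>. The chord takes the values \<open>- d\<close> and \<open>d\<close>
  at the ends, hence it vanishes in the middle \<open>C\<close>.\<close>

lemma ln_concave_chord:
  fixes C S l :: real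
  assumes C: "C\<^sup>2 = 1 + S\<^sup>2" "0 < C" and S: "0 < S" and l: "l\<^sup>2 \<le> S\<^sup>2"
  shows "ln (C + S) / S * l \<le> ln (C + l)"
    and "l\<^sup>2 < S\<^sup>2 \<Longrightarrow> ln (C + S) / S * l < ln (C + l)"
proof -
  have SC: "S < C" proof (rule power2_less_imp_less)
    show "S\<^sup>2 < C\<^sup>2" using C(1) by simp
  qed (use C in simp)
  have "- l \<le> S" by (rule power2_le_imp_le) (use l S in auto)
  moreover have "l \<le> S" by (rule power2_le_imp_le) (use l S in auto)
  ultimately have lS: "- S \<le> l" "l \<le> S" by auto
  have "(C + S) * (C - S) = C\<^sup>2 - S\<^sup>2" by (simp add: power2_eq_square algebra_simps)
  then have inv: "(C + S) * (C - S) = 1" using C(1) by simp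
  define a b M where "a = (S - l) / (2 * S)" and "b = (S + l) / (2 * S)" and "M = C + l"
  have ab: "0 \<le> a" "0 \<le> b" using lS S by (auto simp: a_def b_def)
  have sum_ab: "a + b = 1"
  proof -
    have "a + b = (S - l + (S + l)) / (2 * S)" unfolding a_def b_def by (rule add_divide_distrib[symmetric])
    then show ?thesis using S by simp
  qed
  have diff_ab: "(b - a) * S = l"
  proof -
    have "b - a = (S + l - (S - l)) / (2 * S)" unfolding a_def b_def by (rule diff_divide_distrib[symmetric])
    then show ?thesis using S by simp
  qed
  have "a * (C - S) + b * (C + S) = (a + b) * C + (b - a) * S" by (simp add: algebra_simps)
  then have Mab: "a * (C - S) + b * (C + S) = M" by (simp add: sum_ab diff_ab M_def)
  have M: "0 < M" using lS SC by (simp add: M_def)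
  have pos: "0 < (C - S) / M" "0 < (C + S) / M" using SC S M by auto
  have "ln (C - S) = - ln (C + S)"
    using inv SC S ln_mult_pos[of "C + S" "C - S"] by simp
  then have lns: "ln ((C - S) / M) = - ln (C + S) - ln M" "ln ((C + S) / M) = ln (C + S) - ln M"
    using SC S M by (simp_all add: ln_div)
  have e: "ln (C + S) / S * l - ln M = a * ln ((C - S) / M) + b * ln ((C + S) / M)"
  proof -
    have "ln (C + S) / S * l = (b - a) * ln (C + S)" using S by (simp flip: diff_ab)
    moreover have "a * ln ((C - S) / M) + b * ln ((C + S) / M) = (b - a) * ln (C + S) - (a + b) * ln M"
      unfolding lns by (simp add: algebra_simps)
    ultimately show ?thesis by (simp add: sum_ab)
  qed
  have "a * ((C - S) / M - 1) + b * ((C + S) / M - 1) = (a * (C - S) + b * (C + S)) / M - (a + b)"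
    by (simp add: algebra_simps add_divide_distrib diff_divide_distrib)
  then have z: "a * ((C - S) / M - 1) + b * ((C + S) / M - 1) = 0"
    using Mab M sum_ab by simp
  have 1: "a * ln ((C - S) / M) \<le> a * ((C - S) / M - 1)" "b * ln ((C + S) / M) \<le> b * ((C + S) / M - 1)"
    using ab pos by (auto intro!: mult_left_mono ln_le_minus_one)
  then have "ln (C + S) / S * l - ln M \<le> 0" using e z by linarith
  then show "ln (C + S) / S * l \<le> ln (C + l)" by (simp add: M_def)
  assume "l\<^sup>2 < S\<^sup>2"
  then have "l < S" by (rule power2_less_imp_less) (use S in simp)
  moreover have "- l < S" by (rule power2_less_imp_less) (use S \<open>l\<^sup>2 < S\<^sup>2\<close> in simp_all)
  ultimately have b: "0 < b" "l < S" using S by (auto simp: b_def)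
  have "ln ((C + S) / M) < (C + S) / M - 1"
    using ln_eq_minus_one[OF pos(2)] ln_le_minus_one[OF pos(2)] b M by (force simp: M_def)
  then have "b * ln ((C + S) / M) < b * ((C + S) / M - 1)" using b by simp
  then have "ln (C + S) / S * l - ln M < 0" using 1 e z by linarith
  then show "ln (C + S) / S * l < ln (C + l)" by (simp add: M_def)
qed

context t_law
begin

lemma ln_q_diff:
  assumes "0 < s" "0 < s0"
  shows "ln (q \<nu> m s x / (\<nu> + x\<^sup>2)) - ln (q \<nu> m0 s0 x / (\<nu> + x\<^sup>2)) = ln (q \<nu> m s x / q \<nu> m0 s0 x)"
proof -
  have "0 < \<nu> + x\<^sup>2" using nu by (simp add: add_pos_nonneg)
  then show ?thesis using q_pos[of \<nu> s m x] q_pos[of \<nu> s0 m0 x] nu assms by (simp add: ln_div)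
qed

lemma Qh_diff:
  assumes "0 < s" "0 < s0"
  shows "integrable Q (\<lambda>x. ln (q \<nu> m s x / q \<nu> m0 s0 x))"
    and "Qh \<nu> Q (m, s) - Qh \<nu> Q (m0, s0)
      = (\<nu> + 1) / 2 * (\<integral>x. ln (q \<nu> m s x / q \<nu> m0 s0 x) \<partial>Q) + \<nu> * ln (s0 / s)"
proof -
  note i = integrable_ln_q[OF assms(1), of m] integrable_ln_q[OF assms(2), of m0]
  show "integrable Q (\<lambda>x. ln (q \<nu> m s x / q \<nu> m0 s0 x))"
    using Bochner_Integration.integrable_diff[OF i] by (simp add: ln_q_diff[OF assms])
  have "(\<integral>x. ln (q \<nu> m s x / q \<nu> m0 s0 x) \<partial>Q)
      = (\<integral>x. ln (q \<nu> m s x / (\<nu> + x\<^sup>2)) \<partial>Q) - (\<integral>x. ln (q \<nu> m0 s0 x / (\<nu> + x\<^sup>2)) \<partial>Q)"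
    using i by (simp flip: ln_q_diff[OF assms])
  then show "Qh \<nu> Q (m, s) - Qh \<nu> Q (m0, s0)
      = (\<nu> + 1) / 2 * (\<integral>x. ln (q \<nu> m s x / q \<nu> m0 s0 x) \<partial>Q) + \<nu> * ln (s0 / s)"
    using assms ln_div[of s0 s] unfolding Qh_eq[OF assms(1)] Qh_eq[OF assms(2)]
    by (simp add: right_diff_distrib)
qed

lemma integral_affine:
  assumes "integrable Q f" "integrable Q g"
  shows "(\<integral>x. 1 + a * f x + b * g x \<partial>Q) = 1 + a * (\<integral>x. f x \<partial>Q) + b * (\<integral>x. g x \<partial>Q :: real)"
  using assms prob_space by simp

lemma q_ratio_integral:
  assumes "0 < s0" "score_eq \<nu> Q m0 s0"
  shows "integrable Q (\<lambda>x. q \<nu> m s x / q \<nu> m0 s0 x)"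
    and "(\<integral>x. q \<nu> m s x / q \<nu> m0 s0 x \<partial>Q)
      = 1 + ((m0 - m)\<^sup>2 + \<nu> * s\<^sup>2 - \<nu> * s0\<^sup>2) / ((\<nu> + 1) * s0\<^sup>2)"
proof -
  note i = integrable_scores[OF assms(1), of m0]
  show "integrable Q (\<lambda>x. q \<nu> m s x / q \<nu> m0 s0 x)"
    unfolding q_ratio[OF assms(1)] using i by (intro Bochner_Integration.integrable_add integrable_mult_right) auto
  have "(\<integral>x. q \<nu> m s x / q \<nu> m0 s0 x \<partial>Q) = 1 + 2 * (m0 - m) * (\<integral>x. (x - m0) / q \<nu> m0 s0 x \<partial>Q)
    + ((m0 - m)\<^sup>2 + \<nu> * s\<^sup>2 - \<nu> * s0\<^sup>2) / (\<nu> * s0\<^sup>2) * (\<integral>x. \<nu> * s0\<^sup>2 / q \<nu> m0 s0 x \<partial>Q)"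
    unfolding q_ratio[OF assms(1)] by (rule integral_affine[OF i])
  then show "(\<integral>x. q \<nu> m s x / q \<nu> m0 s0 x \<partial>Q)
      = 1 + ((m0 - m)\<^sup>2 + \<nu> * s\<^sup>2 - \<nu> * s0\<^sup>2) / ((\<nu> + 1) * s0\<^sup>2)"
    using assms nu by (simp add: score_eq_def)
qed

text \<open>The ratio of the weighted distances, \<open>Y x = s\<^sub>0 q / (s q\<^sub>0)\<close>, is the
  exponential of a difference of Busemann functions. With \<open>d\<close> the hyperbolic distance of the
  two parameter points, it lies in the interval from \<open>e\<^sup>-\<^sup>d\<close> to \<open>e\<^sup>d\<close>, and
  it is \<open>C = cosh d\<close> plus a linear function of the circle point \<open>e(x)\<close>; at infinity its
  value is \<open>s\<^sub>0 / s\<close>. Below the logarithm lies its chord, which vanishes at \<open>C\<close>. The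
  score equations at \<open>(m\<^sub>0, s\<^sub>0)\<close> say that the linear parts have weighted mean
  zero, so the chords sum to \<open>0\<close> and the difference of the criteria is nonnegative. Equality
  would confine the weight to the two ends of the geodesic through both points; if infinity is
  one of them, \<open>Q\<close> is a point mass at the other, which the score equations exclude.\<close>

lemma score_eq_imp_strict_min:
  assumes s: "0 < s" "0 < s0" and eq: "score_eq \<nu> Q m0 s0" and ne: "(m, s) \<noteq> (m0, s0)"
  shows "Qh \<nu> Q (m0, s0) < Qh \<nu> Q (m, s)"
proof -
  \<comment> \<open>\<open>C\<close> and \<open>S\<close> are the hyperbolic cosine and sine of the
    distance of the two parameter points.\<close>
  define Y where "Y x = s0 / s * (q \<nu> m s x / q \<nu> m0 s0 x)" for x
  define C where "C = (\<nu> * s0\<^sup>2 + \<nu> * s\<^sup>2 + (m0 - m)\<^sup>2) / (2 * \<nu> * s * s0)"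
  have ps: "0 < 2 * \<nu> * s * s0" using nu s by simp
  have CG: "C * (2 * \<nu> * s * s0) = \<nu> * s0\<^sup>2 + \<nu> * s\<^sup>2 + (m0 - m)\<^sup>2"
    using nu s by (simp add: C_def)
  have C0: "0 < C" using nu s by (auto simp: C_def intro!: divide_pos_pos add_pos_nonneg)
  have C1: "C = 1 + (\<nu> * (s0 - s)\<^sup>2 + (m0 - m)\<^sup>2) / (2 * \<nu> * s * s0)"
    using nu s by (simp add: C_def field_simps power2_eq_square)
  have "0 < \<nu> * (s0 - s)\<^sup>2 + (m0 - m)\<^sup>2"
  proof (cases "s = s0")
    case True
    then show ?thesis using ne by simp
  next
    case False
    then show ?thesis using nu by (intro add_pos_nonneg) auto
  qed
  then have C_gt: "1 < C" using ps by (simp add: C1)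
  define S where "S = sqrt (C\<^sup>2 - 1)"
  have "1 < C\<^sup>2" using C_gt by (simp add: one_less_power)
  then have S: "0 < S" "C\<^sup>2 = 1 + S\<^sup>2" by (auto simp: S_def)
  have Y_pos: "0 < Y x" for x using q_pos[of \<nu> s m x] q_pos[of \<nu> s0 m0 x] nu s by (simp add: Y_def)
  \<comment> \<open>The range of \<open>Y\<close>: its deviation from \<open>C\<close> is at most
    \<open>S\<close>, with equality only at the ends of the geodesic through the two points.\<close>
  have key: "S\<^sup>2 - (Y x - C)\<^sup>2 = ((x - m0) * q \<nu> m s x - (x - m) * q \<nu> m0 s0 x)\<^sup>2 / (\<nu> * s\<^sup>2 * q \<nu> m0 s0 x ^ 2)" for x
  proof -
    let ?a = "q \<nu> m s x" and ?b = "q \<nu> m0 s0 x"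
    have pos: "0 < ?a" "0 < ?b" using q_pos nu s by auto
    have "S\<^sup>2 - (Y x - C)\<^sup>2 = 2 * C * Y x - 1 - (Y x)\<^sup>2" using S by (simp add: power2_eq_square algebra_simps)
    also have "\<dots> = (?a * ?b * (\<nu> * s0\<^sup>2 + \<nu> * s\<^sup>2 + (m0 - m)\<^sup>2) - \<nu> * s\<^sup>2 * ?b\<^sup>2 - \<nu> * s0\<^sup>2 * ?a\<^sup>2) / (\<nu> * s\<^sup>2 * ?b\<^sup>2)"
    proof -
      have Yb: "Y x * (s * ?b) = s0 * ?a" using pos s by (simp add: Y_def)
      have "(2 * C * Y x - 1 - (Y x)\<^sup>2) * (\<nu> * s\<^sup>2 * ?b\<^sup>2)
          = 2 * \<nu> * s * C * (Y x * (s * ?b)) * ?b - \<nu> * s\<^sup>2 * ?b\<^sup>2 - \<nu> * (Y x * (s * ?b))\<^sup>2"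
        by (simp add: power2_eq_square algebra_simps)
      also have "\<dots> = C * (2 * \<nu> * s * s0) * (?a * ?b) - \<nu> * s\<^sup>2 * ?b\<^sup>2 - \<nu> * s0\<^sup>2 * ?a\<^sup>2"
        unfolding Yb by (simp add: power_mult_distrib mult_ac)
      also have "\<dots> = ?a * ?b * (\<nu> * s0\<^sup>2 + \<nu> * s\<^sup>2 + (m0 - m)\<^sup>2) - \<nu> * s\<^sup>2 * ?b\<^sup>2 - \<nu> * s0\<^sup>2 * ?a\<^sup>2"
        unfolding CG by (simp add: mult_ac)
      finally show ?thesis using pos nu s by (simp add: nonzero_eq_divide_eq)
    qed
    also have "?a * ?b * (\<nu> * s0\<^sup>2 + \<nu> * s\<^sup>2 + (m0 - m)\<^sup>2) - \<nu> * s\<^sup>2 * ?b\<^sup>2 - \<nu> * s0\<^sup>2 * ?a\<^sup>2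
       = ((x - m0) * ?a - (x - m) * ?b)\<^sup>2"
    proof -
      have "(a + y\<^sup>2) * (b + z\<^sup>2) * (b + a + (y - z)\<^sup>2) - a * (b + z\<^sup>2)\<^sup>2 - b * (a + y\<^sup>2)\<^sup>2
          = (z * (a + y\<^sup>2) - y * (b + z\<^sup>2))\<^sup>2" for a b y z :: real
        by (simp add: power2_eq_square algebra_simps)
      from this[of "\<nu> * s\<^sup>2" "x - m" "\<nu> * s0\<^sup>2" "x - m0"] show ?thesis by (simp add: q_def)
    qed
    finally show ?thesis .
  qed
  have le: "(Y x - C)\<^sup>2 \<le> S\<^sup>2" for x
  proof -
    have "0 \<le> ((x - m0) * q \<nu> m s x - (x - m) * q \<nu> m0 s0 x)\<^sup>2 / (\<nu> * s\<^sup>2 * q \<nu> m0 s0 x ^ 2)"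
      using nu by simp
    then show ?thesis using key[of x] by linarith
  qed
  have le_inf: "(s0 / s - C)\<^sup>2 \<le> S\<^sup>2" "m \<noteq> m0 \<Longrightarrow> (s0 / s - C)\<^sup>2 < S\<^sup>2"
  proof -
    have "S\<^sup>2 - (s0 / s - C)\<^sup>2 = 2 * C * (s0 / s) - 1 - (s0 / s)\<^sup>2" using S by (simp add: power2_eq_square algebra_simps)
    also have "\<dots> = (m0 - m)\<^sup>2 / (\<nu> * s\<^sup>2)"
    proof -
      have "s0 / s * s = s0" using s by simp
      then have "(2 * C * (s0 / s) - 1 - (s0 / s)\<^sup>2) * (\<nu> * s\<^sup>2) = C * (2 * \<nu> * s * s0) - \<nu> * s\<^sup>2 - \<nu> * s0\<^sup>2"
        using s by (simp add: power2_eq_square algebra_simps)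
      also have "\<dots> = (m0 - m)\<^sup>2" unfolding CG by simp
      finally show ?thesis using nu s by (simp add: nonzero_eq_divide_eq)
    qed
    finally have e: "S\<^sup>2 - (s0 / s - C)\<^sup>2 = (m0 - m)\<^sup>2 / (\<nu> * s\<^sup>2)" .
    have "0 \<le> (m0 - m)\<^sup>2 / (\<nu> * s\<^sup>2)" using nu by simp
    then show "(s0 / s - C)\<^sup>2 \<le> S\<^sup>2" using e by linarith
    assume "m \<noteq> m0"
    then have "0 < (m0 - m)\<^sup>2 / (\<nu> * s\<^sup>2)" using nu s by simp
    then show "(s0 / s - C)\<^sup>2 < S\<^sup>2" using e by linarith
  qed
  define T where "T = ln (C + S) / S"
  have lnY: "T * (Y x - C) \<le> ln (Y x)" for x
    using ln_concave_chord(1)[OF S(2) C0 S(1) le[of x]] by (simp add: T_def)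
  have ln_inf: "T * (s0 / s - C) \<le> ln (s0 / s)"
    using ln_concave_chord(1)[OF S(2) C0 S(1) le_inf(1)] by (simp add: T_def)
  have iY: "integrable Q Y" unfolding Y_def by (rule integrable_mult_right[OF q_ratio_integral(1)[OF s(2) eq]])
  have EY: "(\<integral>x. Y x \<partial>Q) = s0 / s * (1 + ((m0 - m)\<^sup>2 + \<nu> * s\<^sup>2 - \<nu> * s0\<^sup>2) / ((\<nu> + 1) * s0\<^sup>2))"
    unfolding Y_def by (simp only: integral_mult_right_zero q_ratio_integral(2)[OF s(2) eq])
  \<comment> \<open>The barycentre condition: the deviations of \<open>Y\<close> from
    \<open>C\<close> cancel in the weighted mean that includes the point at infinity.\<close>
  have bal: "(\<nu> + 1) / 2 * ((\<integral>x. Y x \<partial>Q) - C) + (\<nu> - 1) / 2 * (s0 / s - C) = 0"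
  proof -
    have aux: "k * (r * (1 + D / (k * w))) = r * (k + D / w)" if "k \<noteq> 0" for k r D w :: real
      using that by (simp add: field_simps)
    have "(\<nu> + 1) * (\<integral>x. Y x \<partial>Q) = s0 / s * ((\<nu> + 1) + ((m0 - m)\<^sup>2 + \<nu> * s\<^sup>2 - \<nu> * s0\<^sup>2) / s0\<^sup>2)"
      unfolding EY using nu by (intro aux) simp
    also have "\<dots> = 2 * \<nu> * C - (\<nu> - 1) * (s0 / s)"
    proof -
      have "(s0 / s * (k + D / s0\<^sup>2)) * (s * s0) = k * s0\<^sup>2 + D" for k D
        using s by (simp add: power2_eq_square field_simps)
      then have "(s0 / s * ((\<nu> + 1) + ((m0 - m)\<^sup>2 + \<nu> * s\<^sup>2 - \<nu> * s0\<^sup>2) / s0\<^sup>2)) * (s * s0)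
         = (\<nu> + 1) * s0\<^sup>2 + ((m0 - m)\<^sup>2 + \<nu> * s\<^sup>2 - \<nu> * s0\<^sup>2)" .
      also have "\<dots> = C * (2 * \<nu> * s * s0) - (\<nu> - 1) * s0\<^sup>2" unfolding CG by (simp add: algebra_simps)
      also have "\<dots> = (2 * \<nu> * C - (\<nu> - 1) * (s0 / s)) * (s * s0)"
      proof -
        have "(2 * \<nu> * C - (\<nu> - 1) * r) * (s * s0) = C * (2 * \<nu> * s * s0) - (\<nu> - 1) * ((r * s) * s0)" for r
          by (simp add: algebra_simps)
        from this[of "s0 / s"] show ?thesis using s by (simp add: power2_eq_square)
      qed
      finally show ?thesis by (rule mult_right_cancel[THEN iffD1, rotated]) (use s in simp)
    qed
    finally have eEY: "(\<nu> + 1) * (\<integral>x. Y x \<partial>Q) = 2 * \<nu> * C - (\<nu> - 1) * (s0 / s)" .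
    have aux2: "(\<nu> + 1) / 2 * (e - C) + (\<nu> - 1) / 2 * (r - C) = ((\<nu> + 1) * e - (2 * \<nu> * C - (\<nu> - 1) * r)) / 2" for e r
      by (simp add: field_simps)
    show ?thesis by (simp only: aux2 eEY) simp
  qed
  have lnYe: "ln (Y x) = ln (q \<nu> m s x / q \<nu> m0 s0 x) + ln (s0 / s)" for x
    unfolding Y_def using q_pos[of \<nu> s m x] q_pos[of \<nu> s0 m0 x] nu s by (subst ln_mult_pos) auto
  have ilnY: "integrable Q (\<lambda>x. ln (Y x))" unfolding lnYe using Qh_diff(1)[OF s] by simp
  have diff: "Qh \<nu> Q (m, s) - Qh \<nu> Q (m0, s0) = (\<nu> + 1) / 2 * (\<integral>x. ln (Y x) \<partial>Q) + (\<nu> - 1) / 2 * ln (s0 / s)"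
  proof -
    have "(\<integral>x. ln (Y x) \<partial>Q) = (\<integral>x. ln (q \<nu> m s x / q \<nu> m0 s0 x) \<partial>Q) + ln (s0 / s)"
      unfolding lnYe using Qh_diff(1)[OF s] prob_space by simp
    then show ?thesis using Qh_diff(2)[OF s, of m m0] by (simp add: field_simps)
  qed
  have int_lin: "integrable Q (\<lambda>x. T * (Y x - C))" using iY by simp
  have E_lin: "(\<integral>x. T * (Y x - C) \<partial>Q) = T * ((\<integral>x. Y x \<partial>Q) - C)" using iY prob_space by simp
  have ge: "T * ((\<integral>x. Y x \<partial>Q) - C) \<le> (\<integral>x. ln (Y x) \<partial>Q)"
    unfolding E_lin[symmetric] by (rule integral_mono[OF int_lin ilnY lnY])
  have strict: "T * ((\<integral>x. Y x \<partial>Q) - C) < (\<integral>x. ln (Y x) \<partial>Q)" if "m = m0"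
  proof (rule ccontr)
    assume "\<not> ?thesis"
    then have "(\<integral>x. ln (Y x) - T * (Y x - C) \<partial>Q) = 0"
      using ge unfolding Bochner_Integration.integral_diff[OF ilnY int_lin] E_lin by linarith
    moreover have "AE x in Q. 0 \<le> ln (Y x) - T * (Y x - C)" using lnY by (intro AE_I2) simp
    ultimately have "AE x in Q. ln (Y x) - T * (Y x - C) = 0"
      using integral_nonneg_eq_0_iff_AE[OF Bochner_Integration.integrable_diff[OF ilnY int_lin]] by simp
    then have "AE x in Q. \<nu> * s0\<^sup>2 / q \<nu> m0 s0 x = 1"
    proof (rule AE_mp, intro AE_I2 impI)
      fix x assume "ln (Y x) - T * (Y x - C) = 0"
      then have "\<not> (Y x - C)\<^sup>2 < S\<^sup>2"
        using ln_concave_chord(2)[OF S(2) C0 S(1) le[of x]] by (auto simp: T_def)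
      then have "((x - m0) * q \<nu> m s x - (x - m) * q \<nu> m0 s0 x)\<^sup>2 / (\<nu> * s\<^sup>2 * q \<nu> m0 s0 x ^ 2) \<le> 0"
        using key[of x] by linarith
      then have "(x - m0) * q \<nu> m s x - (x - m) * q \<nu> m0 s0 x = 0"
        using nu s q_pos[of \<nu> s0 m0 x] by (simp add: divide_le_0_iff mult_le_0_iff)
      then have "(x - m0) * (\<nu> * (s\<^sup>2 - s0\<^sup>2)) = 0" using that by (simp add: q_def algebra_simps)
      moreover have "s\<^sup>2 \<noteq> s0\<^sup>2" using s ne that by (simp add: power2_eq_iff_nonneg)
      ultimately have "x = m0" using nu by simp
      then show "\<nu> * s0\<^sup>2 / q \<nu> m0 s0 x = 1" using nu s by (simp add: q_def)
    qed
    then have "(\<integral>x. \<nu> * s0\<^sup>2 / q \<nu> m0 s0 x \<partial>Q) = (\<integral>x. 1 \<partial>Q)"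
      by (intro integral_cong_AE) auto
    then show False using eq nu prob_space by (simp add: score_eq_def)
  qed
  have strict': "T * (s0 / s - C) < ln (s0 / s)" if "m \<noteq> m0"
    using ln_concave_chord(2)[OF S(2) C0 S(1) le_inf(1) le_inf(2)[OF that]] by (simp add: T_def)
  have dst: "T * (a * u + b * w) = a * (T * u) + b * (T * w)" for a b u w
    by (simp add: algebra_simps)
  have "T * ((\<nu> + 1) / 2 * ((\<integral>x. Y x \<partial>Q) - C) + (\<nu> - 1) / 2 * (s0 / s - C))
      < (\<nu> + 1) / 2 * (\<integral>x. ln (Y x) \<partial>Q) + (\<nu> - 1) / 2 * ln (s0 / s)"
  proof (cases "m = m0")
    case True
    have "(\<nu> + 1) / 2 * (T * ((\<integral>x. Y x \<partial>Q) - C)) < (\<nu> + 1) / 2 * (\<integral>x. ln (Y x) \<partial>Q)"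
      using strict[OF True] nu by (intro mult_strict_left_mono) auto
    moreover have "(\<nu> - 1) / 2 * (T * (s0 / s - C)) \<le> (\<nu> - 1) / 2 * ln (s0 / s)"
      using ln_inf nu by (intro mult_left_mono) auto
    ultimately show ?thesis unfolding dst by (rule add_less_le_mono)
  next
    case False
    have "(\<nu> + 1) / 2 * (T * ((\<integral>x. Y x \<partial>Q) - C)) \<le> (\<nu> + 1) / 2 * (\<integral>x. ln (Y x) \<partial>Q)"
      using ge nu by (intro mult_left_mono) auto
    moreover have "(\<nu> - 1) / 2 * (T * (s0 / s - C)) < (\<nu> - 1) / 2 * ln (s0 / s)"
      using strict'[OF False] nu by (intro mult_strict_left_mono) auto
    ultimately show ?thesis unfolding dst by (rule add_le_less_mono)
  qed
  then show ?thesis using bal diff by simp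
qed

end

section \<open>Continuity and coercivity of the criterion\<close>

context t_law
begin

text \<open>From \<open>ln r \<le> r - 1\<close> and the bounds of the scores. The estimate is explicit, and it
  is used in both directions: exchanging the two points gives the lower bound that continuity
  needs.\<close>

lemma Qh_diff_le:
  assumes "0 < s" "0 < s0"
  shows "Qh \<nu> Q (m, s) \<le> Qh \<nu> Q (m0, s0) + (\<nu> + 1) / 2 *
      (\<bar>m0 - m\<bar> / (sqrt \<nu> * s0) + \<bar>(m0 - m)\<^sup>2 + \<nu> * s\<^sup>2 - \<nu> * s0\<^sup>2\<bar> / (\<nu> * s0\<^sup>2)) + \<nu> * ln (s0 / s)"
proof -
  let ?g = "\<bar>m0 - m\<bar> / (sqrt \<nu> * s0) + \<bar>(m0 - m)\<^sup>2 + \<nu> * s\<^sup>2 - \<nu> * s0\<^sup>2\<bar> / (\<nu> * s0\<^sup>2)"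
  have "ln (q \<nu> m s x / q \<nu> m0 s0 x) \<le> ?g" for x
  proof -
    let ?r = "(x - m0) / q \<nu> m0 s0 x" and ?c = "\<nu> * s0\<^sup>2 / q \<nu> m0 s0 x"
    let ?D = "((m0 - m)\<^sup>2 + \<nu> * s\<^sup>2 - \<nu> * s0\<^sup>2) / (\<nu> * s0\<^sup>2)"
    have "ln (q \<nu> m s x / q \<nu> m0 s0 x) \<le> q \<nu> m s x / q \<nu> m0 s0 x - 1"
      using q_pos[of \<nu> s m x] q_pos[of \<nu> s0 m0 x] nu assms by (intro ln_le_minus_one) simp
    also have "\<dots> = 2 * (m0 - m) * ?r + ?D * ?c" by (simp add: q_ratio[OF assms(2)])
    also have "\<dots> \<le> \<bar>2 * (m0 - m) * ?r\<bar> + \<bar>?D * ?c\<bar>" by linarith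
    also have "\<dots> = \<bar>2 * (m0 - m)\<bar> * \<bar>?r\<bar> + \<bar>?D\<bar> * \<bar>?c\<bar>" by (simp only: abs_mult)
    also have "\<dots> \<le> \<bar>2 * (m0 - m)\<bar> * (1 / (2 * (sqrt \<nu> * s0))) + \<bar>?D\<bar> * 1"
      using odd_score_bound[OF assms(2), of x m0] even_score_bound[OF assms(2), of m0 x]
      by (intro add_mono mult_left_mono) auto
    also have "\<bar>2 * (m0 - m)\<bar> = 2 * \<bar>m0 - m\<bar>" by (simp only: abs_mult abs_numeral)
    also have "2 * \<bar>m0 - m\<bar> * (1 / (2 * (sqrt \<nu> * s0))) + \<bar>?D\<bar> * 1 = ?g" using nu by (simp add: abs_mult)
    finally show ?thesis .
  qed
  then have "(\<integral>x. ln (q \<nu> m s x / q \<nu> m0 s0 x) \<partial>Q) \<le> (\<integral>x. ?g \<partial>Q)"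
    by (intro integral_mono Qh_diff(1)[OF assms]) auto
  then have "(\<integral>x. ln (q \<nu> m s x / q \<nu> m0 s0 x) \<partial>Q) \<le> ?g" using prob_space by simp
  then have "(\<nu> + 1) / 2 * (\<integral>x. ln (q \<nu> m s x / q \<nu> m0 s0 x) \<partial>Q) \<le> (\<nu> + 1) / 2 * ?g"
    by (rule mult_left_mono) (use nu in simp)
  then show ?thesis using Qh_diff(2)[OF assms, of m m0] by linarith
qed

lemma isCont_Qh:
  assumes "0 < snd \<phi>0"
  shows "isCont (Qh \<nu> Q) \<phi>0"
proof -
  obtain m0 s0 where p: "\<phi>0 = (m0, s0)" "0 < s0" using assms by (cases \<phi>0) auto
  define U where "U \<phi> = Qh \<nu> Q (m0, s0) + (\<nu> + 1) / 2 * (\<bar>m0 - fst \<phi>\<bar> / (sqrt \<nu> * s0)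
    + \<bar>(m0 - fst \<phi>)\<^sup>2 + \<nu> * (snd \<phi>)\<^sup>2 - \<nu> * s0\<^sup>2\<bar> / (\<nu> * s0\<^sup>2)) + \<nu> * ln (s0 / snd \<phi>)" for \<phi> :: "real \<times> real"
  define L where "L \<phi> = Qh \<nu> Q (m0, s0) - ((\<nu> + 1) / 2 * (\<bar>fst \<phi> - m0\<bar> / (sqrt \<nu> * snd \<phi>)
    + \<bar>(fst \<phi> - m0)\<^sup>2 + \<nu> * s0\<^sup>2 - \<nu> * (snd \<phi>)\<^sup>2\<bar> / (\<nu> * (snd \<phi>)\<^sup>2)) + \<nu> * ln (snd \<phi> / s0))" for \<phi> :: "real \<times> real"
  have "isCont U \<phi>0" "isCont L \<phi>0"
    using p nu unfolding U_def L_def by (auto intro!: continuous_intros)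
  moreover have "U \<phi>0 = Qh \<nu> Q \<phi>0" "L \<phi>0 = Qh \<nu> Q \<phi>0" using p nu by (simp_all add: U_def L_def)
  ultimately have lim: "(U \<longlongrightarrow> Qh \<nu> Q \<phi>0) (at \<phi>0)" "(L \<longlongrightarrow> Qh \<nu> Q \<phi>0) (at \<phi>0)"
    unfolding isCont_def by auto
  have ev: "\<forall>\<^sub>F \<phi> in at \<phi>0. 0 < snd \<phi>"
    using assms by (intro order_tendstoD(1)[OF tendsto_snd[OF tendsto_ident_at]])
  have "(Qh \<nu> Q \<longlongrightarrow> Qh \<nu> Q \<phi>0) (at \<phi>0)"
  proof (rule tendsto_sandwich[OF _ _ lim(2,1)])
    show "\<forall>\<^sub>F \<phi> in at \<phi>0. Qh \<nu> Q \<phi> \<le> U \<phi>"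
      using ev by eventually_elim (use Qh_diff_le[OF _ p(2), of _ _ m0] in \<open>force simp: U_def\<close>)
    show "\<forall>\<^sub>F \<phi> in at \<phi>0. L \<phi> \<le> Qh \<nu> Q \<phi>"
      using ev
    proof eventually_elim
      case (elim \<phi>)
      then show ?case using Qh_diff_le[OF p(2) elim, of m0 "fst \<phi>"] by (simp add: L_def)
    qed
  qed
  then show ?thesis by (simp add: isCont_def)
qed

text \<open>Both coercivity estimates bound the integrand from below by one constant on a set of
  known mass and by a second constant off it.\<close>

lemma integral_ge_two_levels:
  assumes f: "integrable Q f" and E: "E \<in> sets borel"
    and a: "\<And>x. x \<in> E \<Longrightarrow> a \<le> f x" and b: "\<And>x. x \<notin> E \<Longrightarrow> b \<le> f x"
  shows "prob E * a + (1 - prob E) * b \<le> (\<integral>x. f x \<partial>Q)"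
proof -
  have i: "integrable Q (\<lambda>x. indicator E x :: real)" using E by (intro integrable_bounded[where B = 1]) auto
  then have "(\<integral>x. b + (a - b) * indicator E x \<partial>Q) \<le> (\<integral>x. f x \<partial>Q)"
    using f by (intro integral_mono) (auto simp: a b indicator_def)
  moreover have "(\<integral>x. b + (a - b) * indicator E x \<partial>Q) = b + (a - b) * prob E"
    using i E prob_space by simp
  ultimately show ?thesis by (simp add: algebra_simps)
qed

lemma tight:
  assumes "0 < \<eta>"
  obtains K where "1 \<le> K" "1 - \<eta> < prob {- K..K}"
proof -
  have "(\<lambda>n. prob {- real n..real n}) \<longlonglongrightarrow> prob (\<Union>n. {- real n..real n})"
    by (intro finite_Lim_measure_incseq) (auto simp: incseq_def)
  moreover have "(\<Union>n. {- real n..real n}) = UNIV"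
  proof -
    have "x \<in> (\<Union>n. {- real n..real n})" for x
    proof -
      obtain n :: nat where "\<bar>x\<bar> \<le> real n" using real_arch_simple by blast
      then show ?thesis by (intro UN_I[of n]) auto
    qed
    then show ?thesis by blast
  qed
  ultimately have "(\<lambda>n. prob {- real n..real n}) \<longlonglongrightarrow> 1" using prob_space by simp
  then have "\<forall>\<^sub>F n in sequentially. 1 - \<eta> < prob {- real n..real n}"
    using assms by (intro order_tendstoD(1)) auto
  then obtain N where N: "\<And>n. N \<le> n \<Longrightarrow> 1 - \<eta> < prob {- real n..real n}"
    by (auto simp: eventually_sequentially)
  show thesis by (rule that[of "real (Suc N)"]) (use N[of "Suc N"] in auto)
qed

lemma small_ball:
  assumes "prob {t} < c"
  obtains r where "0 < r" "prob {t - r..t + r} < c"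
proof -
  have "(\<lambda>n. prob {t - 1 / real (Suc n)..t + 1 / real (Suc n)})
      \<longlonglongrightarrow> prob (\<Inter>n. {t - 1 / real (Suc n)..t + 1 / real (Suc n)})"
  proof (intro finite_Lim_measure_decseq)
    show "decseq (\<lambda>n. {t - 1 / real (Suc n)..t + 1 / real (Suc n)})"
    proof (rule decseq_SucI)
      fix n
      have "1 / real (Suc (Suc n)) \<le> 1 / real (Suc n)" by (intro divide_left_mono) auto
      then show "{t - 1 / real (Suc (Suc n))..t + 1 / real (Suc (Suc n))} \<subseteq> {t - 1 / real (Suc n)..t + 1 / real (Suc n)}"
        by auto
    qed
  qed auto
  moreover have "(\<Inter>n. {t - 1 / real (Suc n)..t + 1 / real (Suc n)}) = {t}"
  proof -
    have "x = t" if "\<And>n. x \<in> {t - 1 / real (Suc n)..t + 1 / real (Suc n)}" for x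
    proof (rule ccontr)
      assume "x \<noteq> t"
      then obtain n where "1 / real (Suc n) < \<bar>x - t\<bar>" using nat_approx_posE[of "\<bar>x - t\<bar>"] by auto
      then show False using that[of n] by auto
    qed
    then show ?thesis by auto
  qed
  ultimately have "(\<lambda>n. prob {t - 1 / real (Suc n)..t + 1 / real (Suc n)}) \<longlonglongrightarrow> prob {t}" by simp
  from order_tendstoD(2)[OF this assms] obtain n where "prob {t - 1 / real (Suc n)..t + 1 / real (Suc n)} < c"
    by (auto simp: eventually_sequentially)
  then show thesis by (intro that[of "1 / real (Suc n)"]) auto
qed

text \<open>On an interval that carries almost all mass the integrand is about \<open>ln R\<^sup>2\<close> with
  \<open>R\<^sup>2 = m\<^sup>2 + \<nu> s\<^sup>2\<close>, and elsewhere it is at least \<open>ln (\<nu>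
  s\<^sup>2 / R\<^sup>2)\<close> up to a constant. Because the atom at infinity has less than half of
  the total weight, what remains grows like a positive multiple of \<open>ln R\<close>, however small \<open>s\<close>
  is.\<close>

lemma Qh_coercive_infinity:
  obtains A where "\<And>m s. 0 < s \<Longrightarrow> A < m\<^sup>2 + \<nu> * s\<^sup>2 \<Longrightarrow> B < Qh \<nu> Q (m, s)"
proof -
  \<comment> \<open>With mass at most \<open>\<eta>\<close> outside the interval, the exceptional
    part takes at most half of the growth rate: the factor \<open>(1 - (\<nu> + 1) (1 - p)) /
    2\<close> of \<open>ln R\<^sup>2\<close> below is at least \<open>1/4\<close>.\<close>
  define \<eta> where "\<eta> = 1 / (2 * (\<nu> + 1))"
  have \<eta>: "0 < \<eta>" "(\<nu> + 1) * \<eta> = 1 / 2" using nu by (auto simp: \<eta>_def field_simps)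
  obtain K where K: "1 \<le> K" "1 - \<eta> < prob {- K..K}" using tight[OF \<eta>(1)] by blast
  define p where "p = prob {- K..K}"
  have p: "1 - \<eta> < p" "p \<le> 1" using K by (auto simp: p_def)
  define c1 where "c1 = ln (4 * (\<nu> + K\<^sup>2))"
  define c where "c = (\<nu> + 1) / 2 * (\<bar>c1\<bar> + ln 5)"
  define A where "A = Max {4 * K\<^sup>2, \<nu>, exp (4 * (B + c))}"
  show thesis
  proof (rule that)
    fix m s :: real assume s: "0 < s" and big: "A < m\<^sup>2 + \<nu> * s\<^sup>2"
    define R2 where "R2 = m\<^sup>2 + \<nu> * s\<^sup>2"
    have R2: "4 * K\<^sup>2 < R2" "\<nu> < R2" "exp (4 * (B + c)) < R2" using big by (auto simp: A_def R2_def)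
    define R where "R = sqrt R2"
    have R: "0 < R" "R\<^sup>2 = R2" using R2 nu by (auto simp: R_def)
    have KR: "2 * K < R"
    proof (rule power2_less_imp_less)
      show "(2 * K)\<^sup>2 < R\<^sup>2" using R2 R by (simp add: power_mult_distrib)
    qed (use R in simp)
    have mR: "\<bar>m\<bar> \<le> R"
    proof (rule power2_le_imp_le)
      show "\<bar>m\<bar>\<^sup>2 \<le> R\<^sup>2" using R nu by (simp add: R2_def)
    qed (use R in simp)
    have ns: "0 < \<nu> * s\<^sup>2" "\<nu> * s\<^sup>2 \<le> R2" using nu s by (auto simp: R2_def)
    let ?f = "\<lambda>x. ln (q \<nu> m s x / (\<nu> + x\<^sup>2))"
    have in_E: "ln (R2 / (4 * (\<nu> + K\<^sup>2))) \<le> ?f x" if "x \<in> {- K..K}" for x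
    proof -
      have x: "\<bar>x\<bar> \<le> K" using that by auto
      have "R / 2 \<le> R - \<bar>x\<bar>" using x KR by simp
      then have "(R / 2)\<^sup>2 \<le> (R - \<bar>x\<bar>)\<^sup>2" using R by (intro power_mono) auto
      also have "\<dots> = R2 - 2 * (R * \<bar>x\<bar>) + x\<^sup>2" using R by (simp add: power2_diff)
      also have "\<dots> \<le> R2 - 2 * (\<bar>m\<bar> * \<bar>x\<bar>) + x\<^sup>2" using mult_right_mono[OF mR abs_ge_zero[of x]] by simp
      also have "\<dots> \<le> R2 - 2 * (m * x) + x\<^sup>2" using abs_ge_self[of "m * x"] by (simp add: abs_mult)
      also have "\<dots> = q \<nu> m s x" by (simp add: q_def R2_def power2_diff)
      finally have "R2 / 4 \<le> q \<nu> m s x" using R by (simp add: power_divide)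
      moreover have "x\<^sup>2 \<le> K\<^sup>2" using power_mono[OF x, of 2] by simp
      ultimately have "R2 / 4 / (\<nu> + K\<^sup>2) \<le> q \<nu> m s x / (\<nu> + x\<^sup>2)"
        using nu R2 by (intro frac_le) (auto intro: add_pos_nonneg less_imp_le)
      moreover have "0 < R2 / 4 / (\<nu> + K\<^sup>2)" using R2 nu by (intro divide_pos_pos add_pos_nonneg) auto
      ultimately show ?thesis by (subst ln_le_cancel_iff) (auto simp: mult.commute)
    qed
    have out_E: "ln (\<nu> * s\<^sup>2 / (5 * R2)) \<le> ?f x" for x
    proof -
      have "x\<^sup>2 \<le> 2 * (x - m)\<^sup>2 + 2 * m\<^sup>2"
        using zero_le_power2[of "x - 2 * m"] by (simp add: power2_eq_square algebra_simps)
      moreover have "2 * m\<^sup>2 + \<nu> \<le> 3 * R2" using R2 ns by (simp add: R2_def)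
      moreover have "0 \<le> \<nu> * s\<^sup>2" using ns by simp
      ultimately have "\<nu> + x\<^sup>2 \<le> 2 * q \<nu> m s x + 3 * R2"
        unfolding q_def distrib_left by linarith
      then have "\<nu> * s\<^sup>2 * (\<nu> + x\<^sup>2) \<le> \<nu> * s\<^sup>2 * (2 * q \<nu> m s x + 3 * R2)"
        using ns by (intro mult_left_mono) auto
      also have "\<dots> \<le> 2 * (R2 * q \<nu> m s x) + 3 * (R2 * q \<nu> m s x)"
      proof -
        have "\<nu> * s\<^sup>2 * q \<nu> m s x \<le> R2 * q \<nu> m s x"
          using ns q_pos[of \<nu> s m x] nu s by (intro mult_right_mono) auto
        moreover have "\<nu> * s\<^sup>2 * R2 \<le> q \<nu> m s x * R2" using ns R2 nu by (intro mult_right_mono) (auto simp: q_def)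
        ultimately show ?thesis by (simp add: algebra_simps)
      qed
      finally have five: "\<nu> * s\<^sup>2 * (\<nu> + x\<^sup>2) \<le> 2 * (R2 * q \<nu> m s x) + 3 * (R2 * q \<nu> m s x)" .
      have "\<nu> * s\<^sup>2 / (5 * R2) \<le> q \<nu> m s x / (\<nu> + x\<^sup>2)"
      proof -
        have "0 < \<nu> + x\<^sup>2" "0 < 5 * R2" using R2 nu by (auto simp: add_pos_nonneg)
        then show ?thesis using five
          by (simp add: divide_le_eq le_divide_eq mult_ac)
      qed
      moreover have "0 < \<nu> * s\<^sup>2 / (5 * R2)" using ns R2 nu by (intro divide_pos_pos) auto
      ultimately show ?thesis by (subst ln_le_cancel_iff) auto
    qed
    have int: "p * ln (R2 / (4 * (\<nu> + K\<^sup>2))) + (1 - p) * ln (\<nu> * s\<^sup>2 / (5 * R2)) \<le> (\<integral>x. ?f x \<partial>Q)"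
      unfolding p_def by (rule integral_ge_two_levels[OF integrable_ln_q[OF s]]) (use in_E out_E in auto)
    define L u where "L = ln R2" and "u = ln (\<nu> * s\<^sup>2)"
    have uL: "u \<le> L" using ns by (simp add: L_def u_def)
    have L: "4 * (B + c) < L" using R2(2,3) nu ln_less_cancel_iff[of "exp (4 * (B + c))" R2] by (simp add: L_def)
    have L0: "0 \<le> L" using R2 nu by (auto simp: L_def)
    have lns: "\<nu> * ln s = \<nu> / 2 * u - \<nu> / 2 * ln \<nu>"
      using nu s by (simp add: u_def ln_mult_pos ln_realpow algebra_simps)
    have e1: "ln (R2 / (4 * (\<nu> + K\<^sup>2))) = L - c1"
    proof -
      have "0 < 4 * (\<nu> + K\<^sup>2)" using nu by (simp add: add_pos_nonneg)
      then show ?thesis using R2 nu by (simp add: ln_div L_def c1_def)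
    qed
    have e2: "ln (\<nu> * s\<^sup>2 / (5 * R2)) = u - L - ln 5"
      using ns R2 nu s by (simp add: ln_div ln_mult_pos L_def u_def)
    have "(\<nu> + 1) / 2 * (p * (L - c1) + (1 - p) * (u - L - ln 5)) \<le> (\<nu> + 1) / 2 * (\<integral>x. ?f x \<partial>Q)"
      using int nu unfolding e1 e2 by (intro mult_left_mono) auto
    then have Qge: "(\<nu> + 1) / 2 * (p * (L - c1) + (1 - p) * (u - L - ln 5)) - \<nu> / 2 * u + \<nu> / 2 * ln \<nu> \<le> Qh \<nu> Q (m, s)"
      unfolding Qh_eq[OF s] lns by linarith
    have "p * c1 + (1 - p) * ln 5 \<le> \<bar>c1\<bar> + ln 5"
    proof -
      have p0: "0 \<le> p" by (simp add: p_def)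
      have "p * c1 \<le> p * \<bar>c1\<bar>" using p0 by (intro mult_left_mono) auto
      also have "\<dots> \<le> 1 * \<bar>c1\<bar>" using p by (intro mult_right_mono) auto
      finally have "p * c1 \<le> \<bar>c1\<bar>" by simp
      moreover have "(1 - p) * ln 5 \<le> 1 * (ln 5 :: real)" using p0 by (intro mult_right_mono) auto
      ultimately show ?thesis by (simp only: mult_1 add_mono)
    qed
    then have cc: "(\<nu> + 1) / 2 * (p * c1 + (1 - p) * ln 5) \<le> c"
      unfolding c_def using nu by (intro mult_left_mono) auto
    have np: "(\<nu> + 1) * (1 - p) \<le> 1 / 2"
    proof -
      have "(\<nu> + 1) * (1 - p) \<le> (\<nu> + 1) * \<eta>" using p nu by (intro mult_left_mono) auto
      then show ?thesis unfolding \<eta>(2) .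
    qed
    \<comment> \<open>The factor of \<open>u\<close> is negative, so \<open>u \<le> L\<close> may be
      replaced by \<open>L\<close>.\<close>
    have "((\<nu> + 1) * (1 - p) - \<nu>) / 2 * L \<le> ((\<nu> + 1) * (1 - p) - \<nu>) / 2 * u"
      using uL np nu by (intro mult_left_mono_neg) auto
    moreover have "(\<nu> + 1) / 2 * (2 * p - 1) * L + ((\<nu> + 1) * (1 - p) - \<nu>) / 2 * L = (1 - (\<nu> + 1) * (1 - p)) / 2 * L"
      by (simp add: field_simps)
    moreover have "1 / 4 * L \<le> (1 - (\<nu> + 1) * (1 - p)) / 2 * L" using np L0 by (intro mult_right_mono) auto
    moreover have "(\<nu> + 1) / 2 * (p * (L - c1) + (1 - p) * (u - L - ln 5)) - \<nu> / 2 * u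
       = (\<nu> + 1) / 2 * (2 * p - 1) * L + ((\<nu> + 1) * (1 - p) - \<nu>) / 2 * u - (\<nu> + 1) / 2 * (p * c1 + (1 - p) * ln 5)"
      by (simp add: field_simps)
    moreover have "0 \<le> \<nu> / 2 * ln \<nu>" using nu by simp
    moreover have "B < H" if "x1 \<le> x2" "x3 + x1 = x4" "1 / 4 * L \<le> x4" "y = x3 + x2 - z" "0 \<le> n" "y + n \<le> H" "z \<le> c"
      for H x1 x2 x3 x4 y z n :: real using that L by argo
    ultimately show "B < Qh \<nu> Q (m, s)" using Qge cc by blast
  qed
qed

text \<open>If an interval around \<open>t\<close> has mass \<open>p < \<nu> / (\<nu> + 1)\<close>, the part of the
  integral over it falls at most like \<open>(\<nu> + 1) p ln s\<close>, which the term \<open>- \<nu> ln s\<close>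
  outweighs.\<close>

lemma Qh_coercive_boundary:
  assumes t: "prob {t} < \<nu> / (\<nu> + 1)"
  obtains \<delta> where "0 < \<delta>" "\<And>m s. \<bar>m - t\<bar> < \<delta> \<Longrightarrow> 0 < s \<Longrightarrow> s < \<delta> \<Longrightarrow> B < Qh \<nu> Q (m, s)"
proof -
  obtain r where r: "0 < r" "prob {t - r..t + r} < \<nu> / (\<nu> + 1)" using small_ball[OF t] by blast
  define p where "p = prob {t - r..t + r}"
  \<comment> \<open>\<open>k > 0\<close> is the rate at which \<open>Qh\<close> grows with \<open>-
    ln s\<close>.\<close>
  define k where "k = \<nu> - (\<nu> + 1) * p"
  have k: "0 < k" using r nu by (simp add: k_def p_def field_simps)
  define M1 M2 where "M1 = \<nu> + (\<bar>t\<bar> + r)\<^sup>2" and "M2 = 2 + (\<nu> + 2 * t\<^sup>2) / r\<^sup>2"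
  have M: "0 < M1" "0 < M2" using nu r by (auto simp: M1_def M2_def intro!: add_pos_nonneg)
  define c where "c = (\<nu> + 1) / 2 * (p * (ln \<nu> - ln M1) + (1 - p) * ln (1 / (4 * M2)))"
  show thesis
  proof (rule that)
    show "0 < min (r / 2) (exp ((c - B) / k))" using r by simp
    fix m s :: real
    assume ms: "\<bar>m - t\<bar> < min (r / 2) (exp ((c - B) / k))" and s: "0 < s" "s < min (r / 2) (exp ((c - B) / k))"
    let ?f = "\<lambda>x. ln (q \<nu> m s x / (\<nu> + x\<^sup>2))"
    have in_E: "2 * ln s + ln \<nu> - ln M1 \<le> ?f x" if "x \<in> {t - r..t + r}" for x
    proof -
      have "\<bar>x\<bar> \<le> \<bar>t\<bar> + r" using that by auto
      then have "x\<^sup>2 \<le> (\<bar>t\<bar> + r)\<^sup>2" using power_mono[of "\<bar>x\<bar>" _ 2] by simp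
      then have "\<nu> * s\<^sup>2 / M1 \<le> q \<nu> m s x / (\<nu> + x\<^sup>2)"
        using nu by (intro frac_le) (auto simp: q_def M1_def intro: add_pos_nonneg)
      moreover have "0 < \<nu> * s\<^sup>2 / M1" using nu s M by simp
      ultimately have "ln (\<nu> * s\<^sup>2 / M1) \<le> ?f x" by (subst ln_le_cancel_iff) auto
      then show ?thesis using nu s M by (simp add: ln_div ln_mult_pos ln_realpow)
    qed
    have out_E: "ln (1 / (4 * M2)) \<le> ?f x" if "x \<notin> {t - r..t + r}" for x
    proof -
      have x: "r < \<bar>x - t\<bar>" using that by auto
      have "\<bar>m - t\<bar> < r / 2" using ms by simp
      moreover have "\<bar>x - t\<bar> \<le> \<bar>x - m\<bar> + \<bar>m - t\<bar>" using abs_triangle_ineq[of "x - m" "m - t"] by simp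
      moreover have "a / 2 \<le> b" if "d < r / 2" "a \<le> b + d" "r < a" for a b d :: real using that by simp
      ultimately have "\<bar>x - t\<bar> / 2 \<le> \<bar>x - m\<bar>" using x by blast
      then have "(\<bar>x - t\<bar> / 2)\<^sup>2 \<le> \<bar>x - m\<bar>\<^sup>2" by (intro power_mono) auto
      then have 1: "(x - t)\<^sup>2 / 4 \<le> q \<nu> m s x" using nu by (simp add: q_def power_divide add_increasing)
      have rx: "r\<^sup>2 \<le> (x - t)\<^sup>2" using power_mono[of r "\<bar>x - t\<bar>" 2] x r by simp
      have "x\<^sup>2 \<le> 2 * (x - t)\<^sup>2 + 2 * t\<^sup>2"
        using zero_le_power2[of "x - 2 * t"] by (simp add: power2_eq_square algebra_simps)
      moreover have "\<nu> + 2 * t\<^sup>2 \<le> (\<nu> + 2 * t\<^sup>2) / r\<^sup>2 * (x - t)\<^sup>2"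
      proof -
        have "(\<nu> + 2 * t\<^sup>2) / r\<^sup>2 * r\<^sup>2 \<le> (\<nu> + 2 * t\<^sup>2) / r\<^sup>2 * (x - t)\<^sup>2" using rx nu by (intro mult_left_mono) auto
        then show ?thesis using r by simp
      qed
      ultimately have 2: "\<nu> + x\<^sup>2 \<le> M2 * (x - t)\<^sup>2" by (simp add: M2_def distrib_right)
      have "1 / (4 * M2) \<le> q \<nu> m s x / (\<nu> + x\<^sup>2)"
      proof -
        have "(\<nu> + x\<^sup>2) \<le> (4 * M2) * q \<nu> m s x"
        proof -
          have "M2 * (x - t)\<^sup>2 \<le> M2 * (4 * q \<nu> m s x)" using 1 M by (intro mult_left_mono) auto
          from order_trans[OF 2 this] show ?thesis by (simp add: mult_ac)
        qed
        moreover have "0 < \<nu> + x\<^sup>2" using nu by (simp add: add_pos_nonneg)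
        ultimately show ?thesis using M by (simp add: divide_simps mult_ac)
      qed
      then show ?thesis using M by (subst ln_le_cancel_iff) (auto intro: less_le_trans[of _ "1 / (4 * M2)"])
    qed
    have "p * (2 * ln s + ln \<nu> - ln M1) + (1 - p) * ln (1 / (4 * M2)) \<le> (\<integral>x. ?f x \<partial>Q)"
      unfolding p_def by (rule integral_ge_two_levels[OF integrable_ln_q[OF s(1)]]) (use in_E out_E in auto)
    then have "(\<nu> + 1) / 2 * (p * (2 * ln s + ln \<nu> - ln M1) + (1 - p) * ln (1 / (4 * M2))) \<le> (\<nu> + 1) / 2 * (\<integral>x. ?f x \<partial>Q)"
      by (rule mult_left_mono) (use nu in simp)
    moreover have ec: "(\<nu> + 1) / 2 * (p * (2 * ln s + ln \<nu> - ln M1) + (1 - p) * ln (1 / (4 * M2))) = c + (\<nu> + 1) * p * ln s"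
      by (simp add: c_def field_simps)
    ultimately have "c + (\<nu> + 1) * p * ln s \<le> (\<nu> + 1) / 2 * (\<integral>x. ?f x \<partial>Q)" by (simp only:)
    then have ge: "c - k * ln s \<le> Qh \<nu> Q (m, s)"
      unfolding Qh_eq[OF s(1)] k_def left_diff_distrib by linarith
    have "ln s < (c - B) / k" using s ln_less_cancel_iff[of s "exp ((c - B) / k)"] by simp
    then have "k * ln s < c - B" using k by (simp add: less_divide_eq mult.commute)
    then show "B < Qh \<nu> Q (m, s)" using ge by linarith
  qed
qed

end

section \<open>Existence and the extended M-functional\<close>

lemma mem_param_space [simp]: "(m, s) \<in> param_space \<longleftrightarrow> 0 < s"
  by (simp add: param_space_def)

lemma mem_ext_param_space [simp]: "(m, s) \<in> ext_param_space \<longleftrightarrow> 0 \<le> s"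
  by (simp add: ext_param_space_def)

lemma open_param_space: "open param_space"
  unfolding param_space_def by (intro open_Times) auto

lemma at_within_param_space_neq_bot:
  assumes "\<theta> \<in> ext_param_space"
  shows "at \<theta> within param_space \<noteq> bot"
proof -
  obtain m s where th: "\<theta> = (m, s)" "0 \<le> s" using assms by (cases \<theta>) auto
  have "\<theta> islimpt param_space"
    unfolding islimpt_approachable
  proof (intro allI impI)
    fix e :: real assume "0 < e"
    then show "\<exists>x'\<in>param_space. x' \<noteq> \<theta> \<and> dist x' \<theta> < e"
      using th by (intro bexI[of _ "(m, s + e / 2)"]) (auto simp: dist_Pair_Pair dist_real_def)
  qed
  then show ?thesis by (simp add: trivial_limit_within)
qed

text \<open>The comparison of extended reals, split into real thresholds: values below \<open>c\<close> occur
  arbitrarily close to the point, and values off the neighbourhood stay above some \<open>d > c\<close>.\<close>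

lemma is_ext_M_functionalI:
  assumes "\<theta> \<in> ext_param_space"
    and "\<And>U. open U \<Longrightarrow> \<theta> \<in> U \<Longrightarrow> \<exists>c d. c < d \<and>
      (\<exists>\<^sub>F \<phi> in at \<theta> within param_space. Qh \<nu> Q \<phi> \<le> c) \<and> (\<forall>\<phi>\<in>param_space - U. d \<le> Qh \<nu> Q \<phi>)"
  shows "is_ext_M_functional \<nu> Q \<theta>"
  unfolding is_ext_M_functional_def
proof (intro conjI assms(1) allI impI, elim conjE)
  fix U :: "(real \<times> real) set" assume "open U" "\<theta> \<in> U"
  from assms(2)[OF this] obtain c d where cd: "c < d" "\<exists>\<^sub>F \<phi> in at \<theta> within param_space. Qh \<nu> Q \<phi> \<le> c"
    "\<forall>\<phi>\<in>param_space - U. d \<le> Qh \<nu> Q \<phi>" by blast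
  let ?L = "Liminf (at \<theta> within param_space) (\<lambda>\<phi>. ereal (Qh \<nu> Q \<phi>))"
  have "?L \<le> ereal c"
  proof (rule ccontr)
    assume "\<not> ?thesis"
    then have "\<forall>\<^sub>F \<phi> in at \<theta> within param_space. ereal c < ereal (Qh \<nu> Q \<phi>)"
      by (intro less_LiminfD) simp
    then have "\<forall>\<^sub>F \<phi> in at \<theta> within param_space. \<not> Qh \<nu> Q \<phi> \<le> c" by (simp add: not_le)
    then show False using cd(2) by (simp add: frequently_def)
  qed
  also have "ereal c < ereal d" using cd(1) by simp
  also have "ereal d \<le> (INF \<phi>\<in>param_space - U. ereal (Qh \<nu> Q \<phi>))"
    using cd(3) by (intro INF_greatest) simp
  finally show "?L < (INF \<phi>\<in>param_space - U. ereal (Qh \<nu> Q \<phi>))" .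
qed

text \<open>For disjoint neighbourhoods of two such points, each infimum bounds the lower limit at
  the other point from below, which makes a cycle of strict inequalities.\<close>

lemma is_ext_M_functional_unique:
  assumes 1: "is_ext_M_functional \<nu> Q \<theta>1" and 2: "is_ext_M_functional \<nu> Q \<theta>2"
  shows "\<theta>1 = \<theta>2"
proof (rule ccontr)
  assume "\<theta>1 \<noteq> \<theta>2"
  from hausdorff[OF this] obtain U V
    where UV: "open U" "open V" "\<theta>1 \<in> U" "\<theta>2 \<in> V" "U \<inter> V = {}"
    by (elim exE conjE)
  let ?L = "\<lambda>\<theta>. Liminf (at \<theta> within param_space) (\<lambda>\<phi>. ereal (Qh \<nu> Q \<phi>))"
  let ?I = "\<lambda>U. INF \<phi>\<in>param_space - U. ereal (Qh \<nu> Q \<phi>)"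
  have le: "?I B \<le> ?L \<theta>" if "open A" "\<theta> \<in> A" "A \<inter> B = {}" for \<theta> A B
  proof (rule Liminf_bounded)
    have "\<forall>\<^sub>F \<phi> in at \<theta> within param_space. \<phi> \<in> A \<and> \<phi> \<in> param_space"
      using that by (auto simp: eventually_at_topological)
    then show "\<forall>\<^sub>F \<phi> in at \<theta> within param_space. ?I B \<le> ereal (Qh \<nu> Q \<phi>)"
      by eventually_elim (use that in \<open>auto intro!: INF_lower\<close>)
  qed
  have "?L \<theta>1 < ?I U" using 1 UV(1,3) unfolding is_ext_M_functional_def by simp
  also have "?I U \<le> ?L \<theta>2" by (rule le[of V]) (use UV in auto)
  also have "?L \<theta>2 < ?I V" using 2 UV(2,4) unfolding is_ext_M_functional_def by simp
  also have "?I V \<le> ?L \<theta>1" by (rule le[of U]) (use UV in auto)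
  finally show False by simp
qed

context t_law
begin

text \<open>The sublevel set of a value is bounded by coercivity at infinity, and its limit points
  cannot lie on the boundary, by coercivity there; so it is compact. The assumption on \<open>F\<close> is
  local, which allows a big atom as long as \<open>F\<close> avoids it.\<close>

lemma attains_minimum:
  assumes F: "closed F" and ne: "\<phi>1 \<in> F" "\<phi>1 \<in> param_space"
    and bd: "\<And>t. (t, 0) \<in> F \<Longrightarrow> prob {t} < \<nu> / (\<nu> + 1)"
  obtains \<phi> where "\<phi> \<in> F" "\<phi> \<in> param_space" "\<And>\<psi>. \<psi> \<in> F \<Longrightarrow> \<psi> \<in> param_space \<Longrightarrow> Qh \<nu> Q \<phi> \<le> Qh \<nu> Q \<psi>"
proof -
  define S where "S = {\<phi> \<in> F \<inter> param_space. Qh \<nu> Q \<phi> \<le> Qh \<nu> Q \<phi>1}"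
  obtain A where A: "\<And>m s. 0 < s \<Longrightarrow> A < m\<^sup>2 + \<nu> * s\<^sup>2 \<Longrightarrow> Qh \<nu> Q \<phi>1 < Qh \<nu> Q (m, s)"
    using Qh_coercive_infinity[of "Qh \<nu> Q \<phi>1"] by blast
  have "bounded S"
  proof (rule boundedI)
    fix \<phi> assume "\<phi> \<in> S"
    then obtain m s where p: "\<phi> = (m, s)" "0 < s" "Qh \<nu> Q (m, s) \<le> Qh \<nu> Q \<phi>1"
      by (cases \<phi>) (auto simp: S_def)
    then have "m\<^sup>2 + \<nu> * s\<^sup>2 \<le> A" using A[of s m] by force
    moreover have "s\<^sup>2 \<le> \<nu> * s\<^sup>2" using mult_right_mono[of 1 \<nu> "s\<^sup>2"] nu by simp
    ultimately have "m\<^sup>2 + s\<^sup>2 \<le> A" by linarith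
    then show "norm \<phi> \<le> sqrt A" using p by (simp add: norm_Pair)
  qed
  moreover have "closed S"
    unfolding closed_sequential_limits
  proof (intro allI impI, elim conjE)
    fix x l assume x: "\<forall>n. x n \<in> S" and l: "x \<longlonglongrightarrow> l"
    have lF: "l \<in> F" using F x l unfolding closed_sequential_limits S_def by blast
    obtain m s where ms: "l = (m, s)" by (cases l)
    have pos: "0 < snd (x n)" for n using x by (cases "x n") (force simp: S_def dest: spec[of _ n])
    have lim: "(\<lambda>n. fst (x n)) \<longlonglongrightarrow> m" "(\<lambda>n. snd (x n)) \<longlonglongrightarrow> s"
      using tendsto_fst[OF l] tendsto_snd[OF l] ms by auto
    have "0 \<le> s" by (intro tendsto_lowerbound[OF lim(2)] always_eventually allI less_imp_le[OF pos]) simp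
    moreover have "s \<noteq> 0"
    proof
      assume s: "s = 0"
      have "prob {m} < \<nu> / (\<nu> + 1)" using bd lF ms s by simp
      then obtain \<delta> where \<delta>: "0 < \<delta>"
        "\<And>m' s'. \<bar>m' - m\<bar> < \<delta> \<Longrightarrow> 0 < s' \<Longrightarrow> s' < \<delta> \<Longrightarrow> Qh \<nu> Q \<phi>1 < Qh \<nu> Q (m', s')"
        using Qh_coercive_boundary[of m "Qh \<nu> Q \<phi>1"] by blast
      have "\<forall>\<^sub>F n in sequentially. dist (fst (x n)) m < \<delta> \<and> snd (x n) < \<delta>"
        using tendstoD[OF lim(1) \<delta>(1)] order_tendstoD(2)[OF lim(2), of \<delta>] \<delta>(1) s by (simp add: eventually_conj_iff)
      then obtain n where "dist (fst (x n)) m < \<delta>" "snd (x n) < \<delta>"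
        by (metis (mono_tags, lifting) eventually_happens sequentially_bot)
      then have "Qh \<nu> Q \<phi>1 < Qh \<nu> Q (x n)" using \<delta>(2)[of "fst (x n)" "snd (x n)"] pos by (simp add: dist_real_def)
      then show False using x by (force simp: S_def dest: spec[of _ n])
    qed
    ultimately have s: "0 < s" by simp
    have "(\<lambda>n. Qh \<nu> Q (x n)) \<longlonglongrightarrow> Qh \<nu> Q l"
      using isCont_tendsto_compose[OF isCont_Qh l] ms s by simp
    then have "Qh \<nu> Q l \<le> Qh \<nu> Q \<phi>1"
      by (rule tendsto_upperbound) (use x in \<open>auto simp: S_def\<close>)
    then show "l \<in> S" using lF ms s by (simp add: S_def)
  qed
  ultimately have "compact S" by (simp add: compact_eq_bounded_closed)
  moreover have "\<phi>1 \<in> S" using ne by (simp add: S_def)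
  then have "S \<noteq> {}" by blast
  moreover have "continuous_on S (Qh \<nu> Q)"
    by (intro continuous_at_imp_continuous_on ballI isCont_Qh) (auto simp: S_def param_space_def)
  ultimately obtain \<phi> where \<phi>: "\<phi> \<in> S" "\<And>\<psi>. \<psi> \<in> S \<Longrightarrow> Qh \<nu> Q \<phi> \<le> Qh \<nu> Q \<psi>"
    using continuous_attains_inf[of S "Qh \<nu> Q"] by blast
  show thesis
  proof (rule that[of \<phi>])
    fix \<psi> assume "\<psi> \<in> F" "\<psi> \<in> param_space"
    then show "Qh \<nu> Q \<phi> \<le> Qh \<nu> Q \<psi>"
      using \<phi> by (cases "Qh \<nu> Q \<psi> \<le> Qh \<nu> Q \<phi>1") (auto simp: S_def)
  qed (use \<phi> in \<open>auto simp: S_def\<close>)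
qed

lemma minimizer_imp_score_eq:
  assumes s: "0 < s" and min: "\<And>\<psi>. \<psi> \<in> param_space \<Longrightarrow> Qh \<nu> Q (m, s) \<le> Qh \<nu> Q \<psi>"
  shows "score_eq \<nu> Q m s"
proof -
  have "- (\<nu> + 1) * (\<integral>x. (x - m) / q \<nu> m s x \<partial>Q) = 0"
    by (rule DERIV_local_min[OF Qh_deriv_m[OF s], of 1]) (use min s in auto)
  moreover have "((\<nu> + 1) * (\<integral>x. \<nu> * s\<^sup>2 / q \<nu> m s x \<partial>Q) - \<nu>) / s = 0"
  proof (rule DERIV_local_min[OF Qh_deriv_s[OF s], of s])
    show "\<forall>y. \<bar>s - y\<bar> < s \<longrightarrow> Qh \<nu> Q (m, s) \<le> Qh \<nu> Q (m, y)"
      using min s by (auto simp: abs_if split: if_splits)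
  qed (use s in simp)
  then have "(\<nu> + 1) * (\<integral>x. \<nu> * s\<^sup>2 / q \<nu> m s x \<partial>Q) = \<nu>" using s by simp
  then have "(\<integral>x. \<nu> * s\<^sup>2 / q \<nu> m s x \<partial>Q) * (\<nu> + 1) = \<nu>" by (simp only: mult.commute)
  then have "(\<integral>x. \<nu> * s\<^sup>2 / q \<nu> m s x \<partial>Q) = \<nu> / (\<nu> + 1)"
    by (rule eq_divide_imp[rotated]) (use nu in simp)
  ultimately show ?thesis using nu by (simp add: score_eq_def)
qed

text \<open>The score equations give the circle map \<open>e(x) = (x - cnj \<zeta>) / (x - \<zeta>)\<close> the
  mean \<open>1 - 2 \<kappa>\<close>, where \<open>\<kappa> = \<nu> / (\<nu> + 1)\<close>. Its component in direction
  \<open>e(t)\<close> has modulus at most \<open>2 \<kappa> - 1\<close>, but mass at least \<open>\<kappa>\<close> at \<open>t\<close> makes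
  that component at least \<open>\<kappa> - (1 - \<kappa>)\<close>. Equality forces \<open>e(t) = -1\<close>, that is
  \<open>t = m\<close>; then the even score is \<open>1\<close> at \<open>t\<close>, so its mean \<open>\<kappa>\<close> comes from the atom
  alone; being positive everywhere, it leaves no mass off \<open>t\<close>, against \<open>\<kappa> < 1\<close>.\<close>

lemma no_score_eq_of_atom:
  assumes atom: "\<nu> / (\<nu> + 1) \<le> prob {t}" and s: "0 < s"
  shows "\<not> score_eq \<nu> Q m s"
proof
  assume eq: "score_eq \<nu> Q m s"
  define \<kappa> where "\<kappa> = \<nu> / (\<nu> + 1)"
  have \<kappa>: "1 < 2 * \<kappa>" "\<kappa> < 1" using nu by (auto simp: \<kappa>_def field_simps)
  define a where "a = \<nu> * s\<^sup>2"
  have a: "0 < a" using nu s by (simp add: a_def)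
  define c w where "c x = a / q \<nu> m s x" and "w x = (x - m) / q \<nu> m s x" for x
  have ints: "integrable Q c" "integrable Q w" "(\<integral>x. c x \<partial>Q) = \<kappa>" "(\<integral>x. w x \<partial>Q) = 0"
  proof -
    have "c = (\<lambda>x. \<nu> * s\<^sup>2 / q \<nu> m s x)" "w = (\<lambda>x. (x - m) / q \<nu> m s x)"
      by (auto simp: c_def w_def a_def)
    then show "integrable Q c" "integrable Q w" "(\<integral>x. c x \<partial>Q) = \<kappa>" "(\<integral>x. w x \<partial>Q) = 0"
      using integrable_scores[OF s, of m] eq by (simp_all add: \<kappa>_def score_eq_def)
  qed
  have circle: "(1 - 2 * c x)\<^sup>2 + 4 * a * (w x)\<^sup>2 = 1" for x
  proof -
    have q: "q \<nu> m s x = a + (x - m)\<^sup>2" "q \<nu> m s x \<noteq> 0"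
      using q_pos[of \<nu> s m x] nu s by (auto simp: q_def a_def)
    have "c x * q \<nu> m s x = a" "w x * q \<nu> m s x = x - m" using q by (simp_all add: c_def w_def)
    then have e: "(1 - 2 * c x) * q \<nu> m s x = q \<nu> m s x - 2 * a" "w x * q \<nu> m s x = x - m"
      by (simp_all add: left_diff_distrib)
    have "((1 - 2 * c x)\<^sup>2 + 4 * a * (w x)\<^sup>2) * (q \<nu> m s x)\<^sup>2
        = ((1 - 2 * c x) * q \<nu> m s x)\<^sup>2 + 4 * a * (w x * q \<nu> m s x)\<^sup>2"
      by (simp add: power_mult_distrib distrib_right)
    also have "\<dots> = (q \<nu> m s x - 2 * a)\<^sup>2 + 4 * a * (x - m)\<^sup>2" unfolding e ..
    also have "\<dots> = 1 * (q \<nu> m s x)\<^sup>2" unfolding q(1) by (simp add: power2_eq_square algebra_simps)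
    finally show ?thesis by (rule mult_right_cancel[THEN iffD1, rotated]) (use q(2) in simp)
  qed
  \<comment> \<open>The inner product of the circle points \<open>e(t)\<close> and
    \<open>e(x)\<close>, as an affine function of the scores at \<open>x\<close>.\<close>
  define f where "f x = 1 * (1 - 2 * c t) + (- 2 * (1 - 2 * c t)) * c x + (4 * a * w t) * w x" for x
  have f_eq: "f x = (1 - 2 * c t) * (1 - 2 * c x) + 4 * a * (w t * w x)" for x
    by (simp add: f_def algebra_simps)
  have f_ge: "-1 \<le> f x" for x
  proof -
    have "0 \<le> ((1 - 2 * c t) + (1 - 2 * c x))\<^sup>2 + 4 * a * (w t + w x)\<^sup>2" using a by simp
    also have "\<dots> = ((1 - 2 * c t)\<^sup>2 + 4 * a * (w t)\<^sup>2) + ((1 - 2 * c x)\<^sup>2 + 4 * a * (w x)\<^sup>2) + 2 * f x"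
      unfolding f_eq power2_sum by (simp add: algebra_simps)
    finally show ?thesis unfolding circle by simp
  qed
  have f_t: "f t = 1" using circle[of t] unfolding f_eq by (simp add: power2_eq_square)
  have i_f: "integrable Q f" unfolding f_def using ints by simp
  have "prob {t} * 1 + (1 - prob {t}) * (-1) \<le> (\<integral>x. f x \<partial>Q)"
    by (rule integral_ge_two_levels[OF i_f]) (use f_ge f_t in auto)
  also have "(\<integral>x. f x \<partial>Q) = (1 - 2 * c t) * (1 - 2 * \<kappa>)"
    unfolding f_def using ints prob_space by (simp add: algebra_simps)
  also have "\<dots> = (2 * c t - 1) * (2 * \<kappa> - 1)" by (simp add: algebra_simps)
  finally have le: "prob {t} * 1 + (1 - prob {t}) * (-1) \<le> (2 * c t - 1) * (2 * \<kappa> - 1)" .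
  have "1 * (2 * \<kappa> - 1) \<le> prob {t} * 1 + (1 - prob {t}) * (-1)" using atom[folded \<kappa>_def] by simp
  from order_trans[OF this le] have "1 * (2 * \<kappa> - 1) \<le> (2 * c t - 1) * (2 * \<kappa> - 1)" .
  then have "1 \<le> 2 * c t - 1" by (rule mult_right_le_imp_le) (use \<kappa> in simp)
  then have "q \<nu> m s t \<le> a" using q_pos[of \<nu> s m t] nu s by (simp add: c_def le_divide_eq)
  then have tm: "t = m" by (simp add: q_def a_def)
  then have ct: "c t = 1" using a by (simp add: c_def q_def flip: a_def)
  have c_pos: "0 < c x" for x using q_pos[of \<nu> s m x] nu s a by (simp add: c_def)
  have ii: "integrable Q (\<lambda>x. indicator {t} x :: real)" by (intro integrable_bounded[where B = 1]) auto
  have ge0: "0 \<le> c x - indicator {t} x" for x using c_pos[of x] ct by (auto simp: indicator_def)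
  have ie: "(\<integral>x. c x - indicator {t} x \<partial>Q) = \<kappa> - prob {t}" using ints ii by simp
  moreover have "0 \<le> (\<integral>x. c x - indicator {t} x \<partial>Q)" using ge0 by (intro integral_nonneg_AE AE_I2) auto
  ultimately have pk: "prob {t} = \<kappa>" "(\<integral>x. c x - indicator {t} x \<partial>Q) = 0" using atom by (auto simp: \<kappa>_def)
  have "AE x in Q. c x - indicator {t} x = 0"
    using integral_nonneg_eq_0_iff_AE[OF Bochner_Integration.integrable_diff[OF ints(1) ii]] ge0 pk by simp
  then have "AE x in Q. x \<in> {t}"
  proof (rule AE_mp, intro AE_I2 impI)
    fix x assume "c x - indicator {t} x = 0"
    then show "x \<in> {t}" using c_pos[of x] by (cases "x = t") auto
  qed
  then have "prob {t} = 1" by (subst prob_eq_1) auto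
  then show False using pk \<kappa> by simp
qed

text \<open>Strictness of the minimum improves to a positive gap off every neighbourhood because the
  minimum over the closed complement is attained.\<close>

lemma is_ext_of_score_eq:
  assumes s: "0 < s" and eq: "score_eq \<nu> Q m s"
  shows "is_ext_M_functional \<nu> Q (m, s)"
proof (rule is_ext_M_functionalI)
  have at: "at (m, s) within param_space = at (m, s)"
    using s by (intro at_within_open open_param_space) simp
  have lim: "(Qh \<nu> Q \<longlongrightarrow> Qh \<nu> Q (m, s)) (at (m, s) within param_space)"
    using isCont_Qh[of "(m, s)"] s unfolding at by (simp add: isCont_def)
  have freq: "\<exists>\<^sub>F \<phi> in at (m, s) within param_space. Qh \<nu> Q \<phi> \<le> c" if "Qh \<nu> Q (m, s) < c" for c
    using order_tendstoD(2)[OF lim that] at_within_param_space_neq_bot[of "(m, s)"] s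
    by (intro eventually_frequently) (auto elim: eventually_mono)
  fix U :: "(real \<times> real) set" assume U: "open U" "(m, s) \<in> U"
  show "\<exists>c d. c < d \<and> (\<exists>\<^sub>F \<phi> in at (m, s) within param_space. Qh \<nu> Q \<phi> \<le> c) \<and> (\<forall>\<phi>\<in>param_space - U. d \<le> Qh \<nu> Q \<phi>)"
  proof (cases "param_space - U = {}")
    case True
    then show ?thesis using freq[of "Qh \<nu> Q (m, s) + 1"] by (intro exI[of _ "Qh \<nu> Q (m, s) + 1"] exI[of _ "Qh \<nu> Q (m, s) + 2"]) auto
  next
    case False
    then obtain \<phi>1 where "\<phi>1 \<in> - U" "\<phi>1 \<in> param_space" by blast
    moreover have "closed (- U)" by (rule closed_Compl[OF U(1)])
    moreover have "prob {t} < \<nu> / (\<nu> + 1)" for t using no_score_eq_of_atom[of t s m] s eq by force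
    ultimately obtain \<phi> where \<phi>: "\<phi> \<in> - U" "\<phi> \<in> param_space"
      "\<And>\<psi>. \<psi> \<in> - U \<Longrightarrow> \<psi> \<in> param_space \<Longrightarrow> Qh \<nu> Q \<phi> \<le> Qh \<nu> Q \<psi>"
      using attains_minimum[of "- U" \<phi>1] by blast
    have lt: "Qh \<nu> Q (m, s) < Qh \<nu> Q \<phi>"
      using score_eq_imp_strict_min[OF _ s eq, of "snd \<phi>" "fst \<phi>"] \<phi> U by (cases \<phi>) auto
    show ?thesis
      by (intro exI[of _ "(Qh \<nu> Q (m, s) + Qh \<nu> Q \<phi>) / 2"] exI[of _ "Qh \<nu> Q \<phi>"] conjI freq)
        (use lt \<phi>(3) in \<open>auto simp: field_simps\<close>)
  qed
qed (use s in simp)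

lemma unique_big_atom:
  assumes "\<nu> / (\<nu> + 1) \<le> prob {t}" "\<nu> / (\<nu> + 1) \<le> prob {u}"
  shows "u = t"
proof (rule ccontr)
  assume "u \<noteq> t"
  then have "prob {u, t} = prob {u} + prob {t}"
    using finite_measure_Union[of "{u}" "{t}"] by (simp add: insert_commute Un_commute)
  moreover have "1 < 2 * (\<nu> / (\<nu> + 1))" using nu by (simp add: field_simps)
  ultimately show False using assms prob_le_1[of "{u, t}"] by linarith
qed

text \<open>There is no global minimizer, since it would solve the score equations, but minima over
  the complements of neighbourhoods of \<open>(t, 0)\<close> are attained. So every attained value is
  undercut, and this can only happen arbitrarily close to \<open>(t, 0)\<close>. The lower limit there need
  not be \<open>- \<infinity>\<close>; it only has to lie below each such minimum.\<close>

lemma is_ext_of_atom: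
  assumes atom: "\<nu> / (\<nu> + 1) \<le> prob {t}"
  shows "is_ext_M_functional \<nu> Q (t, 0)"
proof (rule is_ext_M_functionalI)
  have attain: "\<exists>\<phi>. \<phi> \<in> - V \<and> \<phi> \<in> param_space \<and> (\<forall>\<psi>\<in>param_space - V. Qh \<nu> Q \<phi> \<le> Qh \<nu> Q \<psi>)"
    if "open V" "(t, 0) \<in> V" "\<phi>1 \<in> - V" "\<phi>1 \<in> param_space" for V \<phi>1
  proof -
    have "prob {u} < \<nu> / (\<nu> + 1)" if "(u, 0) \<in> - V" for u
      using unique_big_atom[OF atom, of u] that \<open>(t, 0) \<in> V\<close> by force
    note bd = this
    obtain \<phi> where "\<phi> \<in> - V" "\<phi> \<in> param_space"
      "\<And>\<psi>. \<psi> \<in> - V \<Longrightarrow> \<psi> \<in> param_space \<Longrightarrow> Qh \<nu> Q \<phi> \<le> Qh \<nu> Q \<psi>"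
      using attains_minimum[OF closed_Compl[OF \<open>open V\<close>] \<open>\<phi>1 \<in> - V\<close> \<open>\<phi>1 \<in> param_space\<close> bd] by blast
    then show ?thesis by (intro exI[of _ \<phi>]) auto
  qed
  have not_min: "\<exists>\<psi>\<in>param_space. Qh \<nu> Q \<psi> < Qh \<nu> Q \<phi>" if "\<phi> \<in> param_space" for \<phi>
    using minimizer_imp_score_eq[of "snd \<phi>" "fst \<phi>"] no_score_eq_of_atom[OF atom, of "snd \<phi>" "fst \<phi>"] that
    by (cases \<phi>) (auto simp: not_le[symmetric])
  have inside: "\<exists>\<psi>\<in>param_space \<inter> V. Qh \<nu> Q \<psi> \<le> c"
    if V: "open V" "(t, 0) \<in> V" and \<zeta>: "\<zeta> \<in> param_space" "Qh \<nu> Q \<zeta> \<le> c" for V \<zeta> c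
  proof (cases "\<zeta> \<in> V")
    case False
    then obtain \<phi> where \<phi>: "\<phi> \<in> - V" "\<phi> \<in> param_space" "\<forall>\<psi>\<in>param_space - V. Qh \<nu> Q \<phi> \<le> Qh \<nu> Q \<psi>"
      using attain[OF V, of \<zeta>] \<zeta> by blast
    obtain \<psi> where \<psi>: "\<psi> \<in> param_space" "Qh \<nu> Q \<psi> < Qh \<nu> Q \<phi>" using not_min \<phi> by blast
    then have "\<psi> \<in> V" using \<phi> by force
    moreover have "Qh \<nu> Q \<psi> \<le> c" using \<psi> \<phi>(3) \<zeta> False by force
    ultimately show ?thesis using \<psi> by blast
  qed (use \<zeta> in blast)
  have freq: "\<exists>\<^sub>F \<phi> in at (t, 0) within param_space. Qh \<nu> Q \<phi> \<le> c"
    if \<zeta>: "\<zeta> \<in> param_space" "Qh \<nu> Q \<zeta> \<le> c" for \<zeta> c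
    unfolding frequently_def eventually_at_topological
  proof
    assume "\<exists>V. open V \<and> (t, 0) \<in> V \<and> (\<forall>x\<in>V. x \<noteq> (t, 0) \<longrightarrow> x \<in> param_space \<longrightarrow> \<not> Qh \<nu> Q x \<le> c)"
    then obtain V where V: "open V" "(t, 0) \<in> V" "\<And>x. x \<in> V \<Longrightarrow> x \<noteq> (t, 0) \<Longrightarrow> x \<in> param_space \<Longrightarrow> \<not> Qh \<nu> Q x \<le> c"
      by blast
    obtain \<psi> where "\<psi> \<in> param_space" "\<psi> \<in> V" "Qh \<nu> Q \<psi> \<le> c" using inside[OF V(1,2) \<zeta>] by blast
    then show False using V(3)[of \<psi>] by force
  qed
  fix U :: "(real \<times> real) set" assume U: "open U" "(t, 0) \<in> U"
  show "\<exists>c d. c < d \<and> (\<exists>\<^sub>F \<phi> in at (t, 0) within param_space. Qh \<nu> Q \<phi> \<le> c) \<and> (\<forall>\<phi>\<in>param_space - U. d \<le> Qh \<nu> Q \<phi>)"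
  proof (cases "param_space - U = {}")
    case True
    then show ?thesis using freq[of "(0, 1)" "Qh \<nu> Q (0, 1)"]
      by (intro exI[of _ "Qh \<nu> Q (0, 1)"] exI[of _ "Qh \<nu> Q (0, 1) + 1"]) auto
  next
    case False
    then obtain \<phi> where \<phi>: "\<phi> \<in> - U" "\<phi> \<in> param_space" "\<forall>\<psi>\<in>param_space - U. Qh \<nu> Q \<phi> \<le> Qh \<nu> Q \<psi>"
      using attain[OF U] by blast
    obtain \<psi> where \<psi>: "\<psi> \<in> param_space" "Qh \<nu> Q \<psi> < Qh \<nu> Q \<phi>" using not_min \<phi> by blast
    then show ?thesis using freq[of \<psi> "Qh \<nu> Q \<psi>"] \<phi>(3)
      by (intro exI[of _ "Qh \<nu> Q \<psi>"] exI[of _ "Qh \<nu> Q \<phi>"]) auto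
  qed
qed simp

lemma ex_score_eq:
  assumes "\<And>t. prob {t} < \<nu> / (\<nu> + 1)"
  shows "\<exists>m s. 0 < s \<and> score_eq \<nu> Q m s"
proof -
  obtain \<phi> where \<phi>: "\<phi> \<in> param_space" "\<And>\<psi>. \<psi> \<in> param_space \<Longrightarrow> Qh \<nu> Q \<phi> \<le> Qh \<nu> Q \<psi>"
    using attains_minimum[of UNIV "(0, 1)"] assms by auto
  then show ?thesis using minimizer_imp_score_eq[of "snd \<phi>" "fst \<phi>"] by (cases \<phi>) auto
qed

end

text \<open>A description of the extended M-functional by equations and one inequality, with no
  reference to minimization; it passes to limits of laws.\<close>

definition solution :: "real \<Rightarrow> real measure \<Rightarrow> real \<times> real \<Rightarrow> bool" where
  "solution \<nu> Q = (\<lambda>(m, s). 0 < s \<and> score_eq \<nu> Q m s \<or> s = 0 \<and> \<nu> / (\<nu> + 1) \<le> measure Q {m})"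

context t_law
begin

lemma ex_solution: "\<exists>\<theta>. solution \<nu> Q \<theta>"
proof (cases "\<exists>t. \<nu> / (\<nu> + 1) \<le> prob {t}")
  case True
  then obtain t where "\<nu> / (\<nu> + 1) \<le> prob {t}" by blast
  then show ?thesis by (intro exI[of _ "(t, 0)"]) (simp add: solution_def)
next
  case False
  then obtain m s where "0 < s" "score_eq \<nu> Q m s" using ex_score_eq by (auto simp: not_le)
  then show ?thesis by (intro exI[of _ "(m, s)"]) (simp add: solution_def)
qed

lemma solution_imp_is_ext: "solution \<nu> Q \<theta> \<Longrightarrow> is_ext_M_functional \<nu> Q \<theta>"
  by (auto simp: solution_def is_ext_of_score_eq is_ext_of_atom split: prod.splits)

lemma ex1_ext_M_functional: "\<exists>!\<theta>. is_ext_M_functional \<nu> Q \<theta>"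
proof -
  obtain \<theta> where "solution \<nu> Q \<theta>" using ex_solution by blast
  then show ?thesis
    by (intro ex1I[of _ \<theta>] solution_imp_is_ext) (auto intro: is_ext_M_functional_unique solution_imp_is_ext)
qed

lemma solution_iff: "solution \<nu> Q \<theta> \<longleftrightarrow> ext_M_functional \<nu> Q = \<theta>"
proof -
  have e: "ext_M_functional \<nu> Q = \<theta>" if "solution \<nu> Q \<theta>" for \<theta>
    unfolding ext_M_functional_def
    by (rule the_equality[where P = "is_ext_M_functional \<nu> Q", OF solution_imp_is_ext[OF that]])
      (rule is_ext_M_functional_unique[OF _ solution_imp_is_ext[OF that]])
  then show ?thesis using ex_solution by blast
qed

lemma spread_iff: "Q \<in> spread_laws \<nu> \<longleftrightarrow> (\<forall>t. prob {t} < \<nu> / (\<nu> + 1))"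
proof -
  have bdd: "bdd_above (range (\<lambda>t. prob {t}))" by (rule bdd_aboveI2[of _ _ 1]) simp
  obtain t where t: "prob {t} = (SUP t. prob {t})" using max_atom[OF law] by blast
  have "prob {u} \<le> prob {t}" for u unfolding t by (rule cSUP_upper[OF _ bdd]) simp
  then have "prob {u} < \<nu> / (\<nu> + 1)" if "prob {t} < \<nu> / (\<nu> + 1)" for u
    using that by (rule le_less_trans)
  moreover have "Q \<in> spread_laws \<nu> \<longleftrightarrow> prob {t} < \<nu> / (\<nu> + 1)"
    using law by (simp add: spread_laws_def flip: t)
  ultimately show ?thesis by blast
qed

lemma spread_M_functional:
  assumes "Q \<in> spread_laws \<nu>"
  shows "is_M_functional \<nu> Q (M_functional \<nu> Q)" "0 < snd (M_functional \<nu> Q)"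
    "\<theta> \<in> param_space \<Longrightarrow> critical_point \<nu> Q \<theta> \<longleftrightarrow> \<theta> = M_functional \<nu> Q"
    "ext_M_functional \<nu> Q = M_functional \<nu> Q"
    "score_eq \<nu> Q (fst (M_functional \<nu> Q)) (snd (M_functional \<nu> Q))"
proof -
  obtain m s where ms: "0 < s" "score_eq \<nu> Q m s"
    using ex_score_eq assms spread_iff by blast
  have is_M: "is_M_functional \<nu> Q (m', s')" if "0 < s'" "score_eq \<nu> Q m' s'" for m' s'
    unfolding is_M_functional_def
  proof (intro conjI ballI impI)
    fix \<phi> assume "\<phi> \<in> param_space" "\<phi> \<noteq> (m', s')"
    then show "Qh \<nu> Q (m', s') < Qh \<nu> Q \<phi>"
      using score_eq_imp_strict_min[OF _ that, of "snd \<phi>" "fst \<phi>"] by (cases \<phi>) simp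
  qed (use that in simp)
  have uniq: "\<theta>1 = \<theta>2" if "is_M_functional \<nu> Q \<theta>1" "is_M_functional \<nu> Q \<theta>2" for \<theta>1 \<theta>2
  proof (rule ccontr)
    assume "\<theta>1 \<noteq> \<theta>2"
    then have "Qh \<nu> Q \<theta>1 < Qh \<nu> Q \<theta>2 \<and> Qh \<nu> Q \<theta>2 < Qh \<nu> Q \<theta>1"
      using that unfolding is_M_functional_def by auto
    then show False by linarith
  qed
  have M: "M_functional \<nu> Q = (m, s)"
    unfolding M_functional_def
    by (rule the_equality[where P = "is_M_functional \<nu> Q", OF is_M[OF ms]]) (rule uniq[OF _ is_M[OF ms]])
  show "is_M_functional \<nu> Q (M_functional \<nu> Q)" "0 < snd (M_functional \<nu> Q)"
    "score_eq \<nu> Q (fst (M_functional \<nu> Q)) (snd (M_functional \<nu> Q))"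
    unfolding M using is_M[OF ms] ms by simp_all
  show "ext_M_functional \<nu> Q = M_functional \<nu> Q"
    using solution_iff[of "(m, s)"] ms M by (simp add: solution_def)
  assume "\<theta> \<in> param_space"
  then obtain m' s' where th: "\<theta> = (m', s')" "0 < s'" by (cases \<theta>) auto
  show "critical_point \<nu> Q \<theta> \<longleftrightarrow> \<theta> = M_functional \<nu> Q"
    unfolding th M using critical_point_iff[OF th(2), of m'] ms is_M[of s' m'] uniq[OF is_M[OF ms], of "(m', s')"] th(2)
    by auto
qed

end

section \<open>Weak continuity\<close>

text \<open>The neighbourhoods of \<open>Q\<close> that finitely many bounded Lipschitz test functions define.
  They are neighbourhoods both in the weak topology and for the dual-bounded-Lipschitz norm, and
  a sequence of empirical measures enters each of them almost surely, so that convergence along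
  this filter serves all three purposes.\<close>

definition law_filter :: "real measure \<Rightarrow> real measure filter" where
  "law_filter Q = inf (INF f. filtercomap (\<lambda>R. \<integral>x. apply_blfun f x \<partial>R) (nhds (\<integral>x. apply_blfun f x \<partial>Q)))
    (principal {R. real_distribution R})"

lemma eventually_law_filter: "\<forall>\<^sub>F R in law_filter Q. real_distribution R"
  unfolding law_filter_def by (simp add: eventually_inf_principal)

lemma tendsto_law_filter_blfun:
  "((\<lambda>R. \<integral>x. apply_blfun f x \<partial>R) \<longlongrightarrow> (\<integral>x. apply_blfun f x \<partial>Q)) (law_filter Q)"
  unfolding filterlim_iff_le_filtercomap law_filter_def
  by (rule le_infI1, rule INF_lower) simp

lemma tendsto_law_filter:
  fixes f :: "real \<Rightarrow> real"
  assumes "\<And>x. \<bar>f x\<bar> \<le> B" and "\<And>x y. \<bar>f x - f y\<bar> \<le> L * \<bar>x - y\<bar>"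
  shows "((\<lambda>R. \<integral>x. f x \<partial>R) \<longlongrightarrow> (\<integral>x. f x \<partial>Q)) (law_filter Q)"
proof -
  have L: "0 \<le> L" using assms(2)[of 1 0] by simp
  have "bounded (range f)" using assms(1) by (intro boundedI[of _ B]) auto
  moreover have "L-lipschitz_on UNIV f" using assms(2) L by (auto simp: lipschitz_on_def dist_real_def)
  ultimately have "apply_blfun (Abs_blfun f) = f" by (intro Abs_blfun_inverse) blast
  then show ?thesis using tendsto_law_filter_blfun[of "Abs_blfun f" Q] by simp
qed

text \<open>A Lipschitz function between the indicators of the intervals of radius \<open>r\<close> and \<open>2 r\<close>
  around \<open>t\<close>.\<close>

definition bump :: "real \<Rightarrow> real \<Rightarrow> real \<Rightarrow> real" where
  "bump t r x = max 0 (min 1 (2 - \<bar>x - t\<bar> / r))"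

lemma bump_bounds: "0 \<le> bump t r x" "bump t r x \<le> 1"
  by (auto simp: bump_def)

lemma bump_eq_1: "0 < r \<Longrightarrow> \<bar>x - t\<bar> \<le> r \<Longrightarrow> bump t r x = 1"
  by (simp add: bump_def min_def max_def divide_le_eq)

lemma bump_eq_0: "0 < r \<Longrightarrow> 2 * r \<le> \<bar>x - t\<bar> \<Longrightarrow> bump t r x = 0"
  by (simp add: bump_def min_def max_def field_simps)

lemma bump_lipschitz: "0 < r \<Longrightarrow> \<bar>bump t r x - bump t r y\<bar> \<le> 1 / r * \<bar>x - y\<bar>"
proof -
  assume r: "0 < r"
  have "\<bar>max 0 (min 1 (2 - a)) - max 0 (min 1 (2 - b))\<bar> \<le> \<bar>a - b\<bar>" for a b :: real
    by (auto simp: max_def min_def abs_if)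
  then have "\<bar>bump t r x - bump t r y\<bar> \<le> \<bar>\<bar>x - t\<bar> / r - \<bar>y - t\<bar> / r\<bar>"
    unfolding bump_def by blast
  also have "\<dots> = \<bar>\<bar>x - t\<bar> - \<bar>y - t\<bar>\<bar> / r" using r by (simp flip: diff_divide_distrib)
  also have "\<dots> \<le> \<bar>x - y\<bar> / r" using r by (intro divide_right_mono) auto
  finally show ?thesis by simp
qed

lemma bump_measurable [measurable]: "bump t r \<in> borel_measurable borel"
  unfolding bump_def by measurable

lemma tendsto_bump:
  "0 < r \<Longrightarrow> ((\<lambda>R. \<integral>x. bump t r x \<partial>R) \<longlongrightarrow> (\<integral>x. bump t r x \<partial>Q)) (law_filter Q)"
  using bump_bounds[of t r] bump_lipschitz[of r t]
  by (intro tendsto_law_filter[where B = 1 and L = "1 / r"]) (auto simp: abs_le_iff)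

definition cauchy_kernel :: "complex \<Rightarrow> real \<Rightarrow> complex" where
  "cauchy_kernel z x = 1 / (of_real x - z)"

text \<open>Real and imaginary part are integrated separately because the test functions on laws are
  real.\<close>

definition stieltjes :: "real measure \<Rightarrow> complex \<Rightarrow> complex" where
  "stieltjes R z = Complex (\<integral>x. Re (cauchy_kernel z x) \<partial>R) (\<integral>x. Im (cauchy_kernel z x) \<partial>R)"

lemma dist_ge_Im: "\<bar>Im z\<bar> \<le> cmod (of_real x - z)"
  using abs_Im_le_cmod[of "of_real x - z"] by simp

lemma norm_cauchy_kernel_le:
  assumes "Im z \<noteq> 0" shows "cmod (cauchy_kernel z x) \<le> 1 / \<bar>Im z\<bar>"
proof -
  have "0 < cmod (of_real x - z)" using dist_ge_Im[of z x] assms by linarith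
  then have "1 / cmod (of_real x - z) \<le> 1 / \<bar>Im z\<bar>"
    using dist_ge_Im[of z x] assms by (intro divide_left_mono mult_pos_pos) auto
  then show ?thesis by (simp add: cauchy_kernel_def norm_divide)
qed

lemma cauchy_kernel_diff:
  assumes "Im z \<noteq> 0" "Im w \<noteq> 0"
  shows "cmod (cauchy_kernel z x - cauchy_kernel w y) \<le> (cmod (z - w) + \<bar>x - y\<bar>) * (1 / (\<bar>Im z\<bar> * \<bar>Im w\<bar>))"
proof -
  have nz: "of_real x - z \<noteq> 0" "of_real y - w \<noteq> 0" using assms by (auto simp: complex_eq_iff)
  then have "cauchy_kernel z x - cauchy_kernel w y = ((z - w) + of_real (y - x)) * (cauchy_kernel z x * cauchy_kernel w y)"
    by (simp add: cauchy_kernel_def diff_frac_eq algebra_simps)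
  then have "cmod (cauchy_kernel z x - cauchy_kernel w y)
      = cmod ((z - w) + of_real (y - x)) * (cmod (cauchy_kernel z x) * cmod (cauchy_kernel w y))"
    by (simp add: norm_mult)
  also have "\<dots> \<le> (cmod (z - w) + \<bar>x - y\<bar>) * ((1 / \<bar>Im z\<bar>) * (1 / \<bar>Im w\<bar>))"
  proof (rule mult_mono)
    show "cmod ((z - w) + of_real (y - x)) \<le> cmod (z - w) + \<bar>x - y\<bar>"
      using norm_triangle_ineq[of "z - w" "of_real (y - x)"] by (simp only: norm_of_real abs_minus_commute)
    show "cmod (cauchy_kernel z x) * cmod (cauchy_kernel w y) \<le> (1 / \<bar>Im z\<bar>) * (1 / \<bar>Im w\<bar>)"
      by (rule mult_mono) (auto simp: norm_cauchy_kernel_le assms)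
  qed auto
  finally show ?thesis by simp
qed

lemma cauchy_kernel_measurable [measurable]: "cauchy_kernel z \<in> borel_measurable borel"
  unfolding cauchy_kernel_def by measurable

lemma re_im_diff_le: "\<bar>Re u - Re v\<bar> \<le> cmod (u - v)" "\<bar>Im u - Im v\<bar> \<le> cmod (u - v)"
  using abs_Re_le_cmod[of "u - v"] abs_Im_le_cmod[of "u - v"] by simp_all

lemma tendsto_stieltjes:
  assumes "Im z \<noteq> 0"
  shows "((\<lambda>R. stieltjes R z) \<longlongrightarrow> stieltjes Q z) (law_filter Q)"
  unfolding stieltjes_def
proof (rule tendsto_Complex)
  let ?L = "1 / (\<bar>Im z\<bar> * \<bar>Im z\<bar>)"
  have lip: "cmod (cauchy_kernel z x - cauchy_kernel z y) \<le> ?L * \<bar>x - y\<bar>" for x y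
    using cauchy_kernel_diff[OF assms assms, of x y] by simp
  show "((\<lambda>R. \<integral>x. Re (cauchy_kernel z x) \<partial>R) \<longlongrightarrow> (\<integral>x. Re (cauchy_kernel z x) \<partial>Q)) (law_filter Q)"
    by (rule tendsto_law_filter[OF order_trans[OF abs_Re_le_cmod norm_cauchy_kernel_le[OF assms]]])
      (rule order_trans[OF re_im_diff_le(1) lip])
  show "((\<lambda>R. \<integral>x. Im (cauchy_kernel z x) \<partial>R) \<longlongrightarrow> (\<integral>x. Im (cauchy_kernel z x) \<partial>Q)) (law_filter Q)"
    by (rule tendsto_law_filter[OF order_trans[OF abs_Im_le_cmod norm_cauchy_kernel_le[OF assms]]])
      (rule order_trans[OF re_im_diff_le(2) lip])
qed

text \<open>The half plane in which the score equations become conformally natural: \<open>q\<close> is the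
  squared distance to this point.\<close>

definition half_plane_point :: "real \<Rightarrow> real \<times> real \<Rightarrow> complex" where
  "half_plane_point \<nu> = (\<lambda>(m, s). Complex m (sqrt \<nu> * s))"

context t_law
begin

lemma integrable_cauchy_kernel:
  assumes "Im z \<noteq> 0" shows "integrable Q (cauchy_kernel z)"
  by (rule integrable_const_bound[where B = "1 / \<bar>Im z\<bar>"]) (use norm_cauchy_kernel_le[OF assms] in auto)

lemma stieltjes_eq_integral:
  assumes "Im z \<noteq> 0" shows "stieltjes Q z = (\<integral>x. cauchy_kernel z x \<partial>Q)"
  unfolding stieltjes_def integral_bounded_linear[OF bounded_linear_Re integrable_cauchy_kernel[OF assms]]
    integral_bounded_linear[OF bounded_linear_Im integrable_cauchy_kernel[OF assms]]
  by (rule complex_surj)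

text \<open>The modulus of continuity is the same for all laws, so convergence of the transforms at
  one point controls them on a neighbourhood.\<close>

lemma stieltjes_diff_le:
  assumes "Im z \<noteq> 0" "Im w \<noteq> 0"
  shows "cmod (stieltjes Q z - stieltjes Q w) \<le> cmod (z - w) / (\<bar>Im z\<bar> * \<bar>Im w\<bar>)"
proof -
  note i = integrable_cauchy_kernel[OF assms(1)] integrable_cauchy_kernel[OF assms(2)]
  have "stieltjes Q z - stieltjes Q w = (\<integral>x. cauchy_kernel z x - cauchy_kernel w x \<partial>Q)"
    using i by (simp add: stieltjes_eq_integral assms)
  also have "cmod \<dots> \<le> (\<integral>x. cmod (z - w) / (\<bar>Im z\<bar> * \<bar>Im w\<bar>) \<partial>Q)"
  proof (rule Bochner_Integration.integral_norm_bound_integral)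
    show "cmod (cauchy_kernel z x - cauchy_kernel w x) \<le> cmod (z - w) / (\<bar>Im z\<bar> * \<bar>Im w\<bar>)" for x
      using cauchy_kernel_diff[OF assms, of x x] by simp
  qed (use i in auto)
  finally show ?thesis using prob_space by simp
qed

text \<open>The two score equations are the real and the imaginary part of a single complex one.\<close>

lemma score_eq_iff_stieltjes:
  assumes s: "0 < s"
  shows "score_eq \<nu> Q m s \<longleftrightarrow>
    stieltjes Q (half_plane_point \<nu> (m, s)) = \<i> * of_real (\<nu> / (\<nu> + 1) / (sqrt \<nu> * s))"
proof -
  let ?t = "sqrt \<nu> * s"
  have t: "0 < ?t" "?t\<^sup>2 = \<nu> * s\<^sup>2" using nu s by (auto simp: power_mult_distrib)
  have den: "(x - m)\<^sup>2 + ?t\<^sup>2 = q \<nu> m s x" for x using t by (simp add: q_def)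
  have "Re (cauchy_kernel (Complex m ?t) x) = (x - m) / q \<nu> m s x"
    "Im (cauchy_kernel (Complex m ?t) x) = ?t / q \<nu> m s x" for x
    using den[of x] by (simp_all add: cauchy_kernel_def Re_divide Im_divide)
  moreover have "?t / q \<nu> m s x = 1 / ?t * (\<nu> * s\<^sup>2 / q \<nu> m s x)" for x
  proof -
    have "u / d = 1 / u * (u\<^sup>2 / d)" if "0 < u" for u d :: real
      using that by (simp add: power2_eq_square)
    from this[OF t(1)] show ?thesis unfolding t(2) .
  qed
  ultimately have "stieltjes Q (half_plane_point \<nu> (m, s))
      = Complex (\<integral>x. (x - m) / q \<nu> m s x \<partial>Q) (1 / ?t * (\<integral>x. \<nu> * s\<^sup>2 / q \<nu> m s x \<partial>Q))"
    by (simp only: stieltjes_def half_plane_point_def prod.case integral_mult_right_zero)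
  moreover have "1 / u * I = k / u \<longleftrightarrow> I = k" if "0 < u" for u I k :: real using that by simp
  note this[OF t(1)]
  moreover have "\<i> * of_real k = Complex 0 k" for k by (simp add: complex_eq_iff)
  ultimately show ?thesis by (simp only: score_eq_def complex.inject)
qed

end

text \<open>The defect of the Stieltjes form of the score equations is continuous jointly in the law
  and the parameter.\<close>

lemma no_solution_near_interior:
  assumes tlaw: "t_law Q \<nu>" and s0: "0 < s0" and ns: "\<not> solution \<nu> Q (m0, s0)"
  shows "\<exists>V. open V \<and> (m0, s0) \<in> V \<and> (\<forall>\<^sub>F R in law_filter Q. \<forall>\<theta>\<in>V. \<not> solution \<nu> R \<theta>)"
proof -
  interpret t_law Q \<nu> by (rule tlaw)
  define rhs where "rhs \<theta> = \<i> * of_real (\<nu> / (\<nu> + 1) / (sqrt \<nu> * snd \<theta>))" for \<theta> :: "real \<times> real"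
  let ?z = "half_plane_point \<nu>" and ?\<theta>0 = "(m0, s0)"
  have Imz: "Im (?z \<theta>) = sqrt \<nu> * snd \<theta>" for \<theta> by (cases \<theta>) (simp add: half_plane_point_def)
  have cont_z: "isCont ?z ?\<theta>0"
    unfolding half_plane_point_def case_prod_beta Complex_eq by (intro continuous_intros)
  have pos0: "0 < Im (?z ?\<theta>0)" using nu s0 by (simp add: Imz)
  \<comment> \<open>A quarter of the defect at the given point: the change of the law and the two
    changes of the parameter cost less than \<open>g\<close> each.\<close>
  define g where "g = cmod (stieltjes Q (?z ?\<theta>0) - rhs ?\<theta>0) / 4"
  have g: "0 < g" using ns s0 score_eq_iff_stieltjes[OF s0] by (simp add: g_def solution_def rhs_def)
  have "isCont (\<lambda>\<theta>. cmod (?z \<theta> - ?z ?\<theta>0) / (\<bar>Im (?z \<theta>)\<bar> * \<bar>Im (?z ?\<theta>0)\<bar>)) ?\<theta>0"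
    using cont_z pos0 by (intro continuous_intros) auto
  then have l1: "((\<lambda>\<theta>. cmod (?z \<theta> - ?z ?\<theta>0) / (\<bar>Im (?z \<theta>)\<bar> * \<bar>Im (?z ?\<theta>0)\<bar>)) \<longlongrightarrow> 0) (nhds ?\<theta>0)"
    by (simp add: isCont_def tendsto_nhds_iff)
  have "isCont (\<lambda>\<theta>. cmod (rhs \<theta> - rhs ?\<theta>0)) ?\<theta>0"
    unfolding rhs_def using nu s0 by (intro continuous_intros) auto
  then have l2: "((\<lambda>\<theta>. cmod (rhs \<theta> - rhs ?\<theta>0)) \<longlongrightarrow> 0) (nhds ?\<theta>0)"
    by (simp add: isCont_def tendsto_nhds_iff)
  have "((\<lambda>\<theta>. snd \<theta>) \<longlongrightarrow> s0) (nhds ?\<theta>0)"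
    using tendsto_snd[OF filterlim_ident, of ?\<theta>0] by simp
  then have "\<forall>\<^sub>F \<theta> in nhds ?\<theta>0. 0 < snd \<theta> \<and>
      cmod (?z \<theta> - ?z ?\<theta>0) / (\<bar>Im (?z \<theta>)\<bar> * \<bar>Im (?z ?\<theta>0)\<bar>) < g \<and> cmod (rhs \<theta> - rhs ?\<theta>0) < g"
    using s0 g by (intro eventually_conj order_tendstoD(1)[of snd] order_tendstoD(2)[OF l1] order_tendstoD(2)[OF l2])
  then obtain V where V: "open V" "?\<theta>0 \<in> V" and
    near: "\<And>\<theta>. \<theta> \<in> V \<Longrightarrow> 0 < snd \<theta>"
     "\<And>\<theta>. \<theta> \<in> V \<Longrightarrow> cmod (?z \<theta> - ?z ?\<theta>0) / (\<bar>Im (?z \<theta>)\<bar> * \<bar>Im (?z ?\<theta>0)\<bar>) < g"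
     "\<And>\<theta>. \<theta> \<in> V \<Longrightarrow> cmod (rhs \<theta> - rhs ?\<theta>0) < g"
    by (auto simp: eventually_nhds)
  have "\<forall>\<^sub>F R in law_filter Q. dist (stieltjes R (?z ?\<theta>0)) (stieltjes Q (?z ?\<theta>0)) < g"
    using tendstoD[OF tendsto_stieltjes g] pos0 by simp
  then have "\<forall>\<^sub>F R in law_filter Q. \<forall>\<theta>\<in>V. \<not> solution \<nu> R \<theta>"
    using eventually_law_filter[of Q]
  proof eventually_elim
    case (elim R)
    interpret R: t_law R \<nu> using elim(2) nu by (simp add: t_law_def t_law_axioms_def)
    show ?case
    proof
      fix \<theta> assume \<theta>: "\<theta> \<in> V"
      have pos: "0 < Im (?z \<theta>)" using near(1)[OF \<theta>] nu by (simp add: Imz)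
      have 1: "cmod (stieltjes R (?z \<theta>) - stieltjes R (?z ?\<theta>0)) < g"
        using R.stieltjes_diff_le[of "?z \<theta>" "?z ?\<theta>0"] near(2)[OF \<theta>] pos pos0 by (simp add: less_le_trans)
      show "\<not> solution \<nu> R \<theta>"
      proof
        assume "solution \<nu> R \<theta>"
        then have "stieltjes R (?z \<theta>) = rhs \<theta>"
          using near(1)[OF \<theta>] R.score_eq_iff_stieltjes by (cases \<theta>) (auto simp: solution_def rhs_def)
        then have "stieltjes Q (?z ?\<theta>0) - rhs ?\<theta>0 = (rhs \<theta> - rhs ?\<theta>0) - (stieltjes R (?z \<theta>) - stieltjes R (?z ?\<theta>0))
            - (stieltjes R (?z ?\<theta>0) - stieltjes Q (?z ?\<theta>0))" by simp
        also have "cmod \<dots> \<le> cmod (rhs \<theta> - rhs ?\<theta>0) + cmod (stieltjes R (?z \<theta>) - stieltjes R (?z ?\<theta>0))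
            + cmod (stieltjes R (?z ?\<theta>0) - stieltjes Q (?z ?\<theta>0))"
          by (intro order_trans[OF norm_triangle_ineq4] add_mono order_refl)
        also have "\<dots> < 3 * g" using near(3)[OF \<theta>] 1 elim(1) by (simp add: dist_norm)
        finally show False using g by (simp add: g_def)
      qed
    qed
  qed
  then show ?thesis using V(1,2) by (intro exI[of _ V] conjI)
qed

text \<open>For small \<open>s\<close> and \<open>m\<close> near \<open>t\<close> the even score is at most a bump around \<open>t\<close> plus
  a small constant. Its mean would have to be \<open>\<kappa>\<close>, but the mass near \<open>t\<close> stays below
  \<open>\<kappa>\<close>; the same bump excludes a big atom near \<open>t\<close>.\<close>

lemma no_solution_near_boundary:
  assumes tlaw: "t_law Q \<nu>" and ns: "\<not> solution \<nu> Q (t, 0)"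
  shows "\<exists>V. open V \<and> (t, 0) \<in> V \<and> (\<forall>\<^sub>F R in law_filter Q. \<forall>\<theta>\<in>V. \<not> solution \<nu> R \<theta>)"
proof -
  interpret t_law Q \<nu> by (rule tlaw)
  define \<kappa> where "\<kappa> = \<nu> / (\<nu> + 1)"
  have "prob {t} < \<kappa>" using ns by (simp add: solution_def \<kappa>_def)
  then obtain r' where r': "0 < r'" "prob {t - r'..t + r'} < \<kappa>" by (rule small_ball)
  define r where "r = r' / 2"
  have r: "0 < r" using r' by (simp add: r_def)
  have ib: "integrable R (bump t r)" if "t_law R \<nu>" for R
    using t_law.integrable_bounded[OF that, of "bump t r" 1] bump_bounds[of t r] by (simp add: abs_le_iff)
  have "(\<integral>x. bump t r x \<partial>Q) \<le> (\<integral>x. indicator {t - r'..t + r'} x \<partial>Q)"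
  proof (rule integral_mono)
    show "integrable Q (bump t r)" by (rule ib[OF tlaw])
    show "integrable Q (\<lambda>x. indicator {t - r'..t + r'} x :: real)" by (intro integrable_bounded[where B = 1]) auto
    show "bump t r x \<le> indicator {t - r'..t + r'} x" for x
      using bump_bounds[of t r x] bump_eq_0[OF r, of x t] by (auto simp: indicator_def r_def abs_if split: if_splits)
  qed
  then have "(\<integral>x. bump t r x \<partial>Q) < \<kappa>" using r' by simp
  then obtain \<kappa>' where \<kappa>': "(\<integral>x. bump t r x \<partial>Q) < \<kappa>'" "\<kappa>' < \<kappa>" using dense by blast
  have ev: "\<forall>\<^sub>F R in law_filter Q. (\<integral>x. bump t r x \<partial>R) < \<kappa>'"
    by (rule order_tendstoD(2)[OF tendsto_bump[OF r] \<kappa>'(1)])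
  have "isCont (\<lambda>s. \<nu> * s\<^sup>2 / (r / 2)\<^sup>2) 0" using r by (intro continuous_intros) auto
  then have "((\<lambda>s. \<nu> * s\<^sup>2 / (r / 2)\<^sup>2) \<longlongrightarrow> 0) (nhds 0)" by (simp add: isCont_def tendsto_nhds_iff)
  from order_tendstoD(2)[OF this, of "\<kappa> - \<kappa>'"] \<kappa>'
  obtain W where W: "open W" "0 \<in> W" "\<And>s. s \<in> W \<Longrightarrow> \<nu> * s\<^sup>2 / (r / 2)\<^sup>2 < \<kappa> - \<kappa>'"
    by (auto simp: eventually_nhds)
  have "\<forall>\<^sub>F R in law_filter Q. \<forall>\<theta>\<in>ball t (r / 2) \<times> W. \<not> solution \<nu> R \<theta>"
    using ev eventually_law_filter[of Q]
  proof eventually_elim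
    case (elim R)
    interpret R: t_law R \<nu> using elim(2) nu by (simp add: t_law_def t_law_axioms_def)
    show ?case
    proof (clarify)
      fix m s assume m: "m \<in> ball t (r / 2)" and s: "s \<in> W" and sol: "solution \<nu> R (m, s)"
      then have m: "\<bar>m - t\<bar> < r / 2" by (simp add: dist_real_def abs_minus_commute)
      show False
      proof (cases "s = 0")
        case True
        then have "\<kappa> \<le> R.prob {m}" using sol by (simp add: solution_def \<kappa>_def)
        also have "\<dots> = (\<integral>x. indicator {m} x \<partial>R)" by simp
        also have "\<dots> \<le> (\<integral>x. bump t r x \<partial>R)"
        proof (rule integral_mono)
          show "integrable R (\<lambda>x. indicator {m} x :: real)" by (intro R.integrable_bounded[where B = 1]) auto
          show "integrable R (bump t r)" by (rule ib[OF R.t_law_axioms])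
          have "bump t r m = 1" using m r by (intro bump_eq_1) auto
          then show "indicator {m} x \<le> bump t r x" for x
            using bump_bounds[of t r x] by (auto simp: indicator_def)
        qed
        finally show False using elim(1) \<kappa>' by simp
      next
        case False
        then have s0: "0 < s" and eq: "score_eq \<nu> R m s" using sol by (auto simp: solution_def)
        let ?e = "\<nu> * s\<^sup>2 / (r / 2)\<^sup>2"
        have "\<nu> * s\<^sup>2 / q \<nu> m s x \<le> bump t r x + ?e" for x
        proof (cases "\<bar>x - t\<bar> \<le> r")
          case True
          then show ?thesis using bump_eq_1[OF r True] R.even_score_bound(2)[OF s0, of m x] nu
            by (simp add: add_increasing2)
        next
          case False
          then have "r / 2 \<le> \<bar>x - m\<bar>" using m by (simp add: abs_if split: if_splits)
          then have "(r / 2)\<^sup>2 \<le> \<bar>x - m\<bar>\<^sup>2" using r by (intro power_mono) auto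
          then have "(r / 2)\<^sup>2 \<le> q \<nu> m s x" using nu by (simp add: q_def add_increasing)
          then have "\<nu> * s\<^sup>2 / q \<nu> m s x \<le> ?e" using r nu q_pos[of \<nu> s m x] s0 by (intro divide_left_mono) auto
          then show ?thesis using bump_bounds(1)[of t r x] by simp
        qed
        then have "(\<integral>x. \<nu> * s\<^sup>2 / q \<nu> m s x \<partial>R) \<le> (\<integral>x. bump t r x + ?e \<partial>R)"
          using ib[OF R.t_law_axioms] by (intro integral_mono R.integrable_scores[OF s0]) auto
        also have "\<dots> = (\<integral>x. bump t r x \<partial>R) + ?e" using ib[OF R.t_law_axioms] R.prob_space by simp
        also have "\<dots> < \<kappa>" using elim(1) W(3)[OF s] by simp
        finally show False using eq by (simp add: score_eq_def \<kappa>_def)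
      qed
    qed
  qed
  then show ?thesis using W by (intro exI[of _ "ball t (r / 2) \<times> W"]) (auto intro!: open_Times simp: r)
qed

text \<open>A big atom lies in every interval that carries more than the mass \<open>1 - \<kappa>\<close>. For
  a solution \<open>\<zeta>\<close> with imaginary part \<open>\<tau>\<close>, far away from such an interval, the
  kernel is nearly \<open>- 1 / \<zeta>\<close> on it, so \<open>\<i> \<kappa>\<close>, the mean of \<open>\<tau> / (x -
  \<zeta>)\<close>, is nearly \<open>- \<tau> / \<zeta>\<close>. But \<open>\<tau> / \<zeta>\<close> lies on the circle of
  radius \<open>1/2\<close> around \<open>- \<i> / 2\<close>, whose points have distance at least \<open>1 - \<kappa>\<close>
  from \<open>- \<i> \<kappa>\<close>.\<close>

lemma solutions_bounded:
  assumes tlaw: "t_law Q \<nu>"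
  obtains A where "\<forall>\<^sub>F R in law_filter Q. \<forall>\<theta>. solution \<nu> R \<theta> \<longrightarrow> norm \<theta> \<le> A"
proof -
  interpret t_law Q \<nu> by (rule tlaw)
  define \<kappa> where "\<kappa> = \<nu> / (\<nu> + 1)"
  have \<kappa>: "1 / 2 < \<kappa>" "\<kappa> < 1" using nu by (auto simp: \<kappa>_def field_simps)
  \<comment> \<open>Mass \<open>\<eta>\<close> outside the interval costs \<open>2 \<eta>\<close>,
    half of the distance \<open>1 - \<kappa>\<close> from the circle to \<open>- \<i>
    \<kappa>\<close>.\<close>
  define \<eta> where "\<eta> = (1 - \<kappa>) / 4"
  have \<eta>: "0 < \<eta>" "\<eta> < \<kappa>" using \<kappa> by (auto simp: \<eta>_def)
  obtain K where K: "1 \<le> K" "1 - \<eta> < prob {- K..K}" using tight[OF \<eta>(1)] by blast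
  have K0: "0 < K" using K by simp
  define L where "L = 2 * K"
  have ib: "integrable R (bump 0 K)" if "t_law R \<nu>" for R
    using t_law.integrable_bounded[OF that, of "bump 0 K" 1] bump_bounds[of 0 K] by (simp add: abs_le_iff)
  have "prob {- K..K} = (\<integral>x. indicator {- K..K} x \<partial>Q)" by simp
  also have "\<dots> \<le> (\<integral>x. bump 0 K x \<partial>Q)"
  proof (rule integral_mono)
    show "integrable Q (\<lambda>x. indicator {- K..K} x :: real)" by (intro integrable_bounded[where B = 1]) auto
    show "integrable Q (bump 0 K)" by (rule ib[OF tlaw])
    show "indicator {- K..K} x \<le> bump 0 K x" for x
      using bump_bounds[of 0 K x] bump_eq_1[OF K0, of x 0] by (auto simp: indicator_def abs_le_iff)
  qed
  finally have "1 - \<eta> < (\<integral>x. bump 0 K x \<partial>Q)" using K by simp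
  then have ev: "\<forall>\<^sub>F R in law_filter Q. 1 - \<eta> < (\<integral>x. bump 0 K x \<partial>R)"
    by (rule order_tendstoD(1)[OF tendsto_bump[OF K0]])
  define A where "A = max L (2 * L / (1 - \<kappa>))"
  show thesis
  proof (rule that[of A])
    show "\<forall>\<^sub>F R in law_filter Q. \<forall>\<theta>. solution \<nu> R \<theta> \<longrightarrow> norm \<theta> \<le> A"
      using ev eventually_law_filter[of Q]
    proof eventually_elim
      case (elim R)
      interpret R: t_law R \<nu> using elim(2) nu by (simp add: t_law_def t_law_axioms_def)
      have iind: "integrable R (\<lambda>x. indicator {- L..L} x :: real)" by (intro R.integrable_bounded[where B = 1]) auto
      have "(\<integral>x. bump 0 K x \<partial>R) \<le> (\<integral>x. indicator {- L..L} x \<partial>R)"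
        using bump_bounds[of 0 K] bump_eq_0[OF K0, of _ 0] ib[OF R.t_law_axioms] iind
        by (intro integral_mono) (auto simp: indicator_def L_def abs_if not_le split: if_splits)
      then have PR: "1 - \<eta> < R.prob {- L..L}" using elim(1) by simp
      show ?case
      proof (intro allI impI)
        fix \<theta> assume sol: "solution \<nu> R \<theta>"
        obtain m s where \<theta>: "\<theta> = (m, s)" by (cases \<theta>)
        show "norm \<theta> \<le> A"
        proof (cases "s = 0")
          case True
          then have pm: "\<kappa> \<le> R.prob {m}" using sol \<theta> by (simp add: solution_def \<kappa>_def)
          have "m \<in> {- L..L}"
          proof (rule ccontr)
            assume "m \<notin> {- L..L}"
            then have "R.prob ({m} \<union> {- L..L}) = R.prob {m} + R.prob {- L..L}"
              by (intro R.finite_measure_Union) auto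
            then show False using R.prob_le_1[of "{m} \<union> {- L..L}"] pm PR \<eta> by linarith
          qed
          then show ?thesis using True \<theta> by (simp add: norm_Pair A_def abs_le_iff le_max_iff_disj)
        next
          case False
          then have s: "0 < s" and eq: "score_eq \<nu> R m s" using sol \<theta> by (auto simp: solution_def)
          define \<tau> z where "\<tau> = sqrt \<nu> * s" and "z = half_plane_point \<nu> (m, s)"
          have \<tau>: "0 < \<tau>" "Im z = \<tau>" "Re z = m" using nu s by (auto simp: \<tau>_def z_def half_plane_point_def)
          have z0: "z \<noteq> 0" "0 < cmod z" using \<tau> by auto
          have "s \<le> \<tau>"
            using mult_right_mono[of 1 "sqrt \<nu>" s] nu s by (simp add: \<tau>_def)
          then have "s\<^sup>2 \<le> \<tau>\<^sup>2" using s by (intro power_mono) auto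
          then have norm_le: "norm \<theta> \<le> cmod z" using \<tau> by (simp add: \<theta> norm_Pair cmod_def)
          have S: "stieltjes R z = \<i> * of_real (\<kappa> / \<tau>)"
            using eq R.score_eq_iff_stieltjes[OF s] by (simp add: z_def \<kappa>_def \<tau>_def)
          let ?f = "\<lambda>x. of_real \<tau> * cauchy_kernel z x + of_real \<tau> / z"
          have f_le: "cmod (?f x) \<le> L / cmod z + 2 * (1 - indicator {- L..L} x)" for x
          proof -
            have nz: "of_real x - z \<noteq> 0" using \<tau> by (auto simp: complex_eq_iff)
            have kb: "\<tau> * cmod (cauchy_kernel z x) \<le> 1"
              using norm_cauchy_kernel_le[of z x] \<tau> by (simp add: field_simps)
            have \<tau>z: "\<tau> \<le> cmod z" using abs_Im_le_cmod[of z] \<tau> by simp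
            show ?thesis
            proof (cases "x \<in> {- L..L}")
              case True
              have "?f x = of_real \<tau> * cauchy_kernel z x * (of_real x / z)"
                using nz z0 by (simp add: cauchy_kernel_def field_simps)
              then have "cmod (?f x) = (\<tau> * cmod (cauchy_kernel z x)) * (\<bar>x\<bar> / cmod z)"
                using \<tau> by (simp add: norm_mult norm_divide)
              also have "\<dots> \<le> 1 * (L / cmod z)"
                using kb True z0 \<tau> by (intro mult_mono divide_right_mono) auto
              finally show ?thesis using True by simp
            next
              case False
              have "cmod (?f x) \<le> cmod (of_real \<tau> * cauchy_kernel z x) + cmod (of_real \<tau> / z)"
                by (rule norm_triangle_ineq)
              also have "\<dots> \<le> 1 + 1"
                using kb \<tau>z z0 \<tau> by (intro add_mono) (auto simp: norm_mult norm_divide)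
              finally show ?thesis using False z0 K0 by (simp add: L_def add_increasing)
            qed
          qed
          have ik: "integrable R (cauchy_kernel z)" using R.integrable_cauchy_kernel \<tau> by simp
          have if': "integrable R ?f" using ik by simp
          have "(\<integral>x. ?f x \<partial>R) = of_real \<tau> * stieltjes R z + of_real \<tau> / z"
            using ik R.prob_space \<tau> by (simp add: R.stieltjes_eq_integral)
          also have "\<dots> = \<i> * of_real \<kappa> + of_real \<tau> / z" using \<tau> S by simp
          finally have If: "(\<integral>x. ?f x \<partial>R) = \<i> * of_real \<kappa> + of_real \<tau> / z" .
          have "cmod (\<integral>x. ?f x \<partial>R) \<le> (\<integral>x. L / cmod z + 2 * (1 - indicator {- L..L} x) \<partial>R)"
            by (rule Bochner_Integration.integral_norm_bound_integral[OF if']) (use iind f_le in auto)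
          also have "\<dots> = L / cmod z + 2 * (1 - R.prob {- L..L})" using iind R.prob_space by simp
          finally have up: "cmod (\<i> * of_real \<kappa> + of_real \<tau> / z) \<le> L / cmod z + 2 * \<eta>"
            using PR If by simp
          have "of_real \<tau> / z + \<i> / 2 = (2 * of_real \<tau> + \<i> * z) / (2 * z)"
            using z0 by (simp add: field_simps)
          moreover have "cmod (2 * of_real \<tau> + \<i> * z) = cmod z"
            using \<tau> by (simp add: cmod_def add.commute)
          ultimately have half: "cmod (of_real \<tau> / z + \<i> / 2) = 1 / 2"
            using z0 by (simp add: norm_divide norm_mult)
          have "cmod (of_real \<tau> / z + \<i> / 2) \<le> cmod (\<i> * of_real \<kappa> + of_real \<tau> / z) + cmod (\<i> * of_real (\<kappa> - 1 / 2))"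
            using norm_triangle_ineq4[of "\<i> * of_real \<kappa> + of_real \<tau> / z" "\<i> * of_real (\<kappa> - 1 / 2)"]
            by (simp add: algebra_simps)
          moreover have "cmod (\<i> * of_real (\<kappa> - 1 / 2)) = \<kappa> - 1 / 2"
            using \<kappa> by (simp only: norm_mult norm_ii norm_of_real) simp
          ultimately have "1 - \<kappa> \<le> L / cmod z + 2 * \<eta>" using up half by linarith
          moreover have "2 * \<eta> = (1 - \<kappa>) / 2" by (simp add: \<eta>_def)
          ultimately have "(1 - \<kappa>) / 2 \<le> L / cmod z" by argo
          then have "cmod z \<le> 2 * L / (1 - \<kappa>)" using z0 \<kappa> by (simp add: field_simps)
          then show ?thesis using norm_le by (simp add: A_def)
        qed
      qed
    qed
  qed
qed

text \<open>Off a neighbourhood of the limit, the points that remain possible form a compact set,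
  which finitely many of the solution-free neighbourhoods cover.\<close>

theorem tendsto_ext_M_functional:
  assumes tlaw: "t_law Q \<nu>"
  shows "(ext_M_functional \<nu> \<longlongrightarrow> ext_M_functional \<nu> Q) (law_filter Q)"
proof (rule topological_tendstoI)
  interpret t_law Q \<nu> by (rule tlaw)
  fix U assume U: "open U" "ext_M_functional \<nu> Q \<in> U"
  obtain A where A: "\<forall>\<^sub>F R in law_filter Q. \<forall>\<theta>. solution \<nu> R \<theta> \<longrightarrow> norm \<theta> \<le> A"
    using solutions_bounded[OF tlaw] by blast
  define K where "K = cball 0 A \<inter> (UNIV \<times> {0..}) - U"
  have "compact K"
    unfolding K_def by (rule compact_diff[OF compact_Int_closed[OF compact_cball closed_Times] U(1)]) auto
  have "\<forall>\<theta>\<in>K. \<exists>V. open V \<and> \<theta> \<in> V \<and> (\<forall>\<^sub>F R in law_filter Q. \<forall>\<theta>\<in>V. \<not> solution \<nu> R \<theta>)"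
  proof
    fix \<theta> assume that: "\<theta> \<in> K"
    obtain m s where \<theta>: "\<theta> = (m, s)" by (cases \<theta>)
    then have "0 \<le> s" using that by (simp add: K_def)
    note \<theta> = \<theta> this
    have ns: "\<not> solution \<nu> Q \<theta>" using that U solution_iff[of \<theta>] by (auto simp: K_def)
    show "\<exists>V. open V \<and> \<theta> \<in> V \<and> (\<forall>\<^sub>F R in law_filter Q. \<forall>\<theta>\<in>V. \<not> solution \<nu> R \<theta>)"
    proof (cases "s = 0")
      case True
      show ?thesis using no_solution_near_boundary[OF tlaw ns[unfolded \<theta>(1) True]] unfolding \<theta>(1) True .
    next
      case False
      then have "0 < s" using \<theta>(2) by simp
      from no_solution_near_interior[OF tlaw this ns[unfolded \<theta>(1)]] show ?thesis unfolding \<theta>(1) .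
    qed
  qed
  from bchoice[OF this] obtain V where V': "\<forall>\<theta>\<in>K. open (V \<theta>) \<and> \<theta> \<in> V \<theta> \<and>
      (\<forall>\<^sub>F R in law_filter Q. \<forall>\<theta>'\<in>V \<theta>. \<not> solution \<nu> R \<theta>')" by (elim exE)
  then have V: "\<And>\<theta>. \<theta> \<in> K \<Longrightarrow> open (V \<theta>)" "\<And>\<theta>. \<theta> \<in> K \<Longrightarrow> \<theta> \<in> V \<theta>"
    "\<And>\<theta>. \<theta> \<in> K \<Longrightarrow> \<forall>\<^sub>F R in law_filter Q. \<forall>\<theta>'\<in>V \<theta>. \<not> solution \<nu> R \<theta>'" by simp_all
  obtain C where C: "C \<subseteq> K" "finite C" "K \<subseteq> (\<Union>c\<in>C. V c)"
  proof (rule compactE_image[OF \<open>compact K\<close> V(1)])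
    show "K \<subseteq> (\<Union>c\<in>K. V c)" using V(2) by blast
  qed
  have "\<forall>\<^sub>F R in law_filter Q. \<forall>c\<in>C. \<forall>\<theta>'\<in>V c. \<not> solution \<nu> R \<theta>'"
    by (rule eventually_ball_finite[OF C(2)]) (use C(1) V' in blast)
  then show "\<forall>\<^sub>F R in law_filter Q. ext_M_functional \<nu> R \<in> U"
    using A eventually_law_filter[of Q]
  proof eventually_elim
    case (elim R)
    interpret R: t_law R \<nu> using elim(3) nu by (simp add: t_law_def t_law_axioms_def)
    obtain m s where \<theta>: "ext_M_functional \<nu> R = (m, s)" by (cases "ext_M_functional \<nu> R")
    have sol: "solution \<nu> R (m, s)" using R.solution_iff \<theta> by blast
    then have "0 \<le> s" by (auto simp: solution_def)
    moreover have "norm (m, s) \<le> A" using elim(2) sol by blast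
    ultimately have "(m, s) \<in> U" if "(m, s) \<notin> K" using that by (simp add: K_def)
    moreover have "(m, s) \<notin> K" using elim(1) C(3) sol by blast
    ultimately show ?case using \<theta> by simp
  qed
qed

section \<open>Topologies on laws and empirical measures\<close>

lemma atin_le_law_filter:
  assumes "real_distribution Q"
  shows "atin weak_law_topology Q \<le> law_filter Q"
  unfolding law_filter_def
proof (rule le_infI)
  show "atin weak_law_topology Q \<le> principal {R. real_distribution R}"
    unfolding le_principal eventually_atin
    using openin_topspace[of weak_law_topology] assms unfolding topspace_weak_law_topology
    by (intro disjI2 exI[of _ "{R. real_distribution R}"]) auto
  show "atin weak_law_topology Q \<le> (INF f. filtercomap (\<lambda>R. \<integral>x. apply_blfun f x \<partial>R) (nhds (\<integral>x. apply_blfun f x \<partial>Q)))"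
  proof (rule INF_greatest)
    fix f :: blfun
    have "continuous_on UNIV (apply_blfun f)"
    proof -
      obtain C where "C-lipschitz_on UNIV (apply_blfun f)" using apply_blfun[of f] by auto
      then show ?thesis by (rule lipschitz_on_continuous_on)
    qed
    moreover have "bounded (range (apply_blfun f))" using apply_blfun[of f] by auto
    ultimately have "apply_blfun f \<in> bcontfun" by (simp add: bcontfun_def)
    then have g: "apply_bcontfun (Bcontfun (apply_blfun f)) = apply_blfun f" by (rule Bcontfun_inverse)
    have "((\<lambda>R. \<integral>x. apply_blfun f x \<partial>R) \<longlongrightarrow> (\<integral>x. apply_blfun f x \<partial>Q)) (atin weak_law_topology Q)"
    proof (rule topological_tendstoI)
      fix U :: "real set" assume U: "open U" "(\<integral>x. apply_blfun f x \<partial>Q) \<in> U"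
      let ?B = "{R. real_distribution R \<and> (\<integral>x. apply_bcontfun (Bcontfun (apply_blfun f)) x \<partial>R) \<in> U}"
      have "openin weak_law_topology ?B"
        unfolding weak_law_topology_def by (rule topology_generated_by_Basis) (use U in blast)
      then show "\<forall>\<^sub>F R in atin weak_law_topology Q. (\<integral>x. apply_blfun f x \<partial>R) \<in> U"
        unfolding eventually_atin by (intro disjI2 exI[of _ ?B]) (use U assms in \<open>simp add: g\<close>)
    qed
    then show "atin weak_law_topology Q \<le> filtercomap (\<lambda>R. \<integral>x. apply_blfun f x \<partial>R) (nhds (\<integral>x. apply_blfun f x \<partial>Q))"
      by (simp add: filterlim_iff_le_filtercomap)
  qed
qed

lemma ext_M_functional_mem:
  assumes "t_law Q \<nu>" shows "ext_M_functional \<nu> Q \<in> ext_param_space"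
proof -
  interpret t_law Q \<nu> by (rule assms)
  have "solution \<nu> Q (ext_M_functional \<nu> Q)" using solution_iff by blast
  then show ?thesis by (cases "ext_M_functional \<nu> Q") (auto simp: solution_def)
qed

lemma continuous_map_ext_M_functional:
  assumes nu: "1 < \<nu>"
  shows "continuous_map weak_law_topology (top_of_set ext_param_space) (ext_M_functional \<nu>)"
proof -
  have tl: "t_law Q \<nu>" if "Q \<in> topspace weak_law_topology" for Q
    using that nu by (simp add: topspace_weak_law_topology t_law_def t_law_axioms_def)
  have "limitin euclidean (ext_M_functional \<nu>) (ext_M_functional \<nu> Q) (atin weak_law_topology Q)"
    if Q: "Q \<in> topspace weak_law_topology" for Q
  proof -
    have "atin weak_law_topology Q \<le> law_filter Q"
      using Q by (intro atin_le_law_filter) (simp add: topspace_weak_law_topology)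
    then have "(ext_M_functional \<nu> \<longlongrightarrow> ext_M_functional \<nu> Q) (atin weak_law_topology Q)"
      by (rule filterlim_mono[OF tendsto_ext_M_functional[OF tl[OF Q]] order_refl])
    then show ?thesis by simp
  qed
  then have "continuous_map weak_law_topology euclidean (ext_M_functional \<nu>)"
    unfolding continuous_map_atin by (rule ballI)
  moreover have "ext_M_functional \<nu> \<in> topspace weak_law_topology \<rightarrow> ext_param_space"
    using ext_M_functional_mem[OF tl] by (auto simp: Pi_iff)
  ultimately show ?thesis unfolding continuous_map_in_subtopology by (rule conjI)
qed

text \<open>Evaluation at a bounded Lipschitz function is continuous on the dual space.\<close>

lemma law_filter_dual_nhds:
  assumes Q: "real_distribution Q" and P: "eventually P (law_filter Q)"
  obtains W where "open W" "law_dual Q \<in> W" "\<And>R. real_distribution R \<Longrightarrow> law_dual R \<in> W \<Longrightarrow> P R"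
proof -
  let ?F = "inf (filtercomap law_dual (nhds (law_dual Q))) (principal {R. real_distribution R})"
  have law: "\<forall>\<^sub>F R in ?F. real_distribution R" by (simp add: eventually_inf_principal)
  have lim: "(law_dual \<longlongrightarrow> law_dual Q) ?F"
    unfolding filterlim_iff_le_filtercomap by (rule inf_le1)
  have "?F \<le> law_filter Q"
    unfolding law_filter_def
  proof (rule le_infI[OF _ inf_le2], rule INF_greatest)
    fix f :: blfun
    have "((\<lambda>R. blinfun_apply (law_dual R) f) \<longlongrightarrow> blinfun_apply (law_dual Q) f) ?F"
      by (intro tendsto_intros lim)
    then have "((\<lambda>R. \<integral>x. apply_blfun f x \<partial>R) \<longlongrightarrow> (\<integral>x. apply_blfun f x \<partial>Q)) ?F"
      unfolding law_dual_apply[OF Q]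
      by (rule Lim_transform_eventually) (use law in \<open>auto elim!: eventually_mono simp: law_dual_apply\<close>)
    then show "?F \<le> filtercomap (\<lambda>R. \<integral>x. apply_blfun f x \<partial>R) (nhds (\<integral>x. apply_blfun f x \<partial>Q))"
      by (simp add: filterlim_iff_le_filtercomap)
  qed
  then have "eventually P ?F" using P by (rule filter_leD)
  then have "\<forall>\<^sub>F R in filtercomap law_dual (nhds (law_dual Q)). real_distribution R \<longrightarrow> P R"
    by (simp add: eventually_inf_principal)
  then obtain N where N: "eventually N (nhds (law_dual Q))" "\<forall>R. N (law_dual R) \<longrightarrow> real_distribution R \<longrightarrow> P R"
    unfolding eventually_filtercomap by (elim exE conjE)
  from N(1) obtain W where "open W" "law_dual Q \<in> W" "\<forall>\<phi>\<in>W. N \<phi>"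
    unfolding eventually_nhds by (elim exE conjE)
  then show thesis using N(2) by (intro that[of W]) auto
qed

lemma measurable_uniform_count [measurable]: "x \<in> measurable (uniform_count_measure A) borel"
  by (auto simp: measurable_def space_uniform_count_measure sets_uniform_count_measure)

lemma real_distribution_empirical: "1 \<le> n \<Longrightarrow> real_distribution (empirical_measure n x)"
  unfolding empirical_measure_def
  by (intro prob_space.real_distribution_distr prob_space_uniform_count_measure measurable_uniform_count) auto

lemma integral_empirical:
  fixes f :: "real \<Rightarrow> real"
  assumes "f \<in> borel_measurable borel"
  shows "(\<integral>y. f y \<partial>empirical_measure n x) = (\<Sum>j=1..n. f (x j)) / n"
  unfolding empirical_measure_def using assms
  by (subst integral_distr) (auto simp: integral_uniform_count_measure)

context prob_space
begin

text \<open>For bounded functions the exponential tail of the Hoeffding inequality is summable, and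
  the Borel-Cantelli lemma gives almost sure convergence directly.\<close>

lemma bounded_strong_law:
  fixes X :: "nat \<Rightarrow> 'a \<Rightarrow> real" and f :: "real \<Rightarrow> real"
  assumes indep: "indep_vars (\<lambda>_. borel) X {1..}" and dist: "\<And>j. 1 \<le> j \<Longrightarrow> distr M borel (X j) = Q"
    and f [measurable]: "f \<in> borel_measurable borel" and B: "\<And>x. \<bar>f x\<bar> \<le> B"
  shows "AE \<omega> in M. (\<lambda>n. \<integral>x. f x \<partial>empirical_measure n (\<lambda>j. X j \<omega>)) \<longlonglongrightarrow> (\<integral>x. f x \<partial>Q)"
proof -
  define \<mu> where "\<mu> = (\<integral>x. f x \<partial>Q)"
  \<comment> \<open>Adding \<open>1\<close> makes the interval of values nondegenerate.\<close>
  define C where "C = B + 1"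
  have C: "0 < C" using B[of 0] by (simp add: C_def)
  have X [measurable]: "1 \<le> j \<Longrightarrow> X j \<in> borel_measurable M" for j
    using indep by (auto simp: indep_vars_def)
  have indep_f: "indep_vars (\<lambda>_. borel) (\<lambda>j \<omega>. f (X j \<omega>)) {1..n}" for n
    by (rule indep_vars_compose2[OF indep_vars_subset[OF indep]]) auto
  have exp_f: "expectation (\<lambda>\<omega>. f (X j \<omega>)) = \<mu>" if "1 \<le> j" for j
    using integral_distr[OF X[OF that] f] dist[OF that] by (simp add: \<mu>_def)
  let ?S = "\<lambda>n \<omega>. (\<Sum>j=1..n. f (X j \<omega>))"
  have meas_S [measurable]: "?S n \<in> borel_measurable M" for n
    by (intro borel_measurable_sum measurable_compose[OF X f]) auto
  have conc: "AE \<omega> in M. \<forall>\<^sub>F n in sequentially. \<bar>?S n \<omega> / n - \<mu>\<bar> < \<epsilon>" if \<epsilon>: "0 < \<epsilon>" for \<epsilon> :: real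
  proof -
    define a where "a = \<epsilon>\<^sup>2 / (2 * C\<^sup>2)"
    have a: "0 < a" using \<epsilon> C by (simp add: a_def)
    define A where "A n = {\<omega> \<in> space M. real n * \<epsilon> \<le> \<bar>?S n \<omega> - real n * \<mu>\<bar>}" for n
    have A_meas: "A n \<in> sets M" for n unfolding A_def by measurable
    have A_le: "measure M (A n) \<le> 2 * exp (- a) ^ n" for n
    proof (cases "n = 0")
      case True
      then show ?thesis using order_trans[OF prob_le_1[of "A n"], of 2] by simp
    next
      case False
      interpret H: Hoeffding_ineq M "{1..n}" "\<lambda>j \<omega>. f (X j \<omega>)" "\<lambda>_. - C" "\<lambda>_. C" "\<Sum>j=1..n. expectation (\<lambda>\<omega>. f (X j \<omega>))"
      proof unfold_locales
        show "indep_vars (\<lambda>_. borel) (\<lambda>j \<omega>. f (X j \<omega>)) {1..n}" by (rule indep_f)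
        show "AE x in M. f (X i x) \<in> {- C..C}" for i
        proof (rule AE_I2)
          fix x show "f (X i x) \<in> {- C..C}" using B[of "X i x"] by (auto simp: C_def abs_le_iff)
        qed
      qed simp_all
      have sq: "(\<Sum>i=1..n. (C - - C)\<^sup>2) = real n * (4 * C\<^sup>2)" by (simp add: power2_eq_square)
      have "prob {x \<in> space M. real n * \<epsilon> \<le> \<bar>(\<Sum>i=1..n. f (X i x)) - (\<Sum>j=1..n. expectation (\<lambda>\<omega>. f (X j \<omega>)))\<bar>}
        \<le> 2 * exp (- 2 * (real n * \<epsilon>)\<^sup>2 / (\<Sum>i=1..n. (C - - C)\<^sup>2))"
        by (rule H.Hoeffding_ineq_abs_ge) (use \<epsilon> False C in \<open>simp_all add: sq\<close>)
      also have "(\<Sum>j=1..n. expectation (\<lambda>\<omega>. f (X j \<omega>))) = real n * \<mu>" by (simp add: exp_f)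
      also have "- 2 * (real n * \<epsilon>)\<^sup>2 / (\<Sum>i=1..n. (C - - C)\<^sup>2) = real n * (- a)"
        unfolding sq a_def using False C by (simp add: power2_eq_square field_simps)
      also have "exp (real n * (- a)) = exp (- a) ^ n" by (rule exp_of_nat_mult)
      finally show ?thesis by (simp add: A_def)
    qed
    have "summable (\<lambda>n. measure M (A n))"
    proof (rule summable_comparison_test')
      show "summable (\<lambda>n. 2 * exp (- a) ^ n)" using a by (intro summable_mult summable_geometric) simp
      show "norm (measure M (A n)) \<le> 2 * exp (- a) ^ n" if "0 \<le> n" for n using A_le[of n] by simp
    qed
    then have "AE \<omega> in M. \<forall>\<^sub>F n in sequentially. \<omega> \<in> space M - A n"
      by (intro borel_cantelli_AE1 A_meas) (simp_all add: emeasure_eq_measure)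
    then show ?thesis
    proof (rule AE_mp, intro AE_I2 impI)
      fix \<omega> assume "\<forall>\<^sub>F n in sequentially. \<omega> \<in> space M - A n"
      then show "\<forall>\<^sub>F n in sequentially. \<bar>?S n \<omega> / n - \<mu>\<bar> < \<epsilon>"
        using eventually_gt_at_top[of 0]
      proof eventually_elim
        case (elim n)
        then have "\<bar>?S n \<omega> - real n * \<mu>\<bar> < real n * \<epsilon>" by (auto simp: A_def not_le)
        moreover have "?S n \<omega> / n - \<mu> = (?S n \<omega> - real n * \<mu>) / n" using elim by (simp add: field_simps)
        ultimately show ?case using elim by (simp add: divide_less_eq mult.commute)
      qed
    qed
  qed
  have "AE \<omega> in M. \<forall>k. \<forall>\<^sub>F n in sequentially. \<bar>?S n \<omega> / n - \<mu>\<bar> < inverse (real (Suc k))"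
    by (subst AE_all_countable) (intro allI conc, simp)
  then show ?thesis
  proof (rule AE_mp, intro AE_I2 impI)
    fix \<omega> assume *: "\<forall>k. \<forall>\<^sub>F n in sequentially. \<bar>?S n \<omega> / n - \<mu>\<bar> < inverse (real (Suc k))"
    have "(\<lambda>n. ?S n \<omega> / n) \<longlonglongrightarrow> \<mu>"
    proof (rule tendstoI)
      fix e :: real assume "0 < e"
      then obtain k where k: "inverse (real (Suc k)) < e" using reals_Archimedean by blast
      show "\<forall>\<^sub>F n in sequentially. dist (?S n \<omega> / n) \<mu> < e"
        using *[rule_format, of k] by eventually_elim (use k in \<open>simp add: dist_real_def\<close>)
    qed
    then show "(\<lambda>n. \<integral>x. f x \<partial>empirical_measure n (\<lambda>j. X j \<omega>)) \<longlonglongrightarrow> (\<integral>x. f x \<partial>Q)"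
      by (simp add: integral_empirical \<mu>_def)
  qed
qed

text \<open>There are uncountably many test functions, with no common null set at hand, but a single
  event of the filter involves only finitely many of them.\<close>

lemma AE_eventually_empirical:
  fixes X :: "nat \<Rightarrow> 'a \<Rightarrow> real"
  assumes indep: "indep_vars (\<lambda>_. borel) X {1..}" and dist: "\<And>j. 1 \<le> j \<Longrightarrow> distr M borel (X j) = Q"
    and P: "eventually P (law_filter Q)"
  shows "AE \<omega> in M. \<forall>\<^sub>F n in sequentially. P (empirical_measure n (\<lambda>j. X j \<omega>))"
proof -
  let ?G = "\<lambda>f. filtercomap (\<lambda>R. \<integral>x. apply_blfun f x \<partial>R) (nhds (\<integral>x. apply_blfun f x \<partial>Q))"
  obtain F where F: "finite F" "\<forall>\<^sub>F R in (INF f\<in>F. ?G f). real_distribution R \<longrightarrow> P R"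
  proof -
    have "\<forall>\<^sub>F R in (INF f\<in>UNIV. ?G f). real_distribution R \<longrightarrow> P R"
      using P by (simp add: law_filter_def eventually_inf_principal)
    from eventually_INF[THEN iffD1, OF this] show thesis by (elim exE conjE) (rule that)
  qed
  have "AE \<omega> in M. \<forall>f\<in>F. (\<lambda>n. \<integral>x. apply_blfun f x \<partial>empirical_measure n (\<lambda>j. X j \<omega>)) \<longlonglongrightarrow> (\<integral>x. apply_blfun f x \<partial>Q)"
    by (rule AE_finite_allI[OF F(1)])
      (rule bounded_strong_law[OF indep dist apply_blfun_measurable abs_apply_blfun_le])
  then show ?thesis
  proof (rule AE_mp, intro AE_I2 impI)
    fix \<omega> assume *: "\<forall>f\<in>F. (\<lambda>n. \<integral>x. apply_blfun f x \<partial>empirical_measure n (\<lambda>j. X j \<omega>)) \<longlonglongrightarrow> (\<integral>x. apply_blfun f x \<partial>Q)"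
    have "filterlim (\<lambda>n. empirical_measure n (\<lambda>j. X j \<omega>)) (INF f\<in>F. ?G f) sequentially"
      unfolding filterlim_INF filterlim_filtercomap_iff comp_def using * .
    from eventually_compose_filterlim[OF F(2) this] eventually_ge_at_top[of 1]
    show "\<forall>\<^sub>F n in sequentially. P (empirical_measure n (\<lambda>j. X j \<omega>))"
      by eventually_elim (simp add: real_distribution_empirical)
  qed
qed

lemma AE_tendsto_empirical:
  fixes X :: "nat \<Rightarrow> 'a \<Rightarrow> real" and T :: "real measure \<Rightarrow> 'b::metric_space"
  assumes indep: "indep_vars (\<lambda>_. borel) X {1..}" and dist: "\<And>j. 1 \<le> j \<Longrightarrow> distr M borel (X j) = Q"
    and T: "(T \<longlongrightarrow> l) (law_filter Q)"
  shows "AE \<omega> in M. (\<lambda>n. T (empirical_measure n (\<lambda>j. X j \<omega>))) \<longlonglongrightarrow> l"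
proof -
  have "AE \<omega> in M. \<forall>k. \<forall>\<^sub>F n in sequentially. dist (T (empirical_measure n (\<lambda>j. X j \<omega>))) l < inverse (real (Suc k))"
    by (subst AE_all_countable) (intro allI AE_eventually_empirical[OF indep dist] tendstoD[OF T], simp_all)
  then show ?thesis
  proof (rule AE_mp, intro AE_I2 impI tendstoI)
    fix \<omega> and e :: real
    assume *: "\<forall>k. \<forall>\<^sub>F n in sequentially. dist (T (empirical_measure n (\<lambda>j. X j \<omega>))) l < inverse (real (Suc k))" and "0 < e"
    then obtain k where k: "inverse (real (Suc k)) < e" using reals_Archimedean by blast
    show "\<forall>\<^sub>F n in sequentially. dist (T (empirical_measure n (\<lambda>j. X j \<omega>))) l < e"
      using *[rule_format, of k] by eventually_elim (use k in simp)
  qed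
qed

end

section \<open>Analytic dependence on the law\<close>

type_synonym bldual = "blfun \<Rightarrow>\<^sub>L real"

definition BL_bounded :: "real \<Rightarrow> real \<Rightarrow> (real \<Rightarrow> complex) \<Rightarrow> bool" where
  "BL_bounded B L g \<longleftrightarrow> (\<forall>x. cmod (g x) \<le> B) \<and> (\<forall>x y. cmod (g x - g y) \<le> L * \<bar>x - y\<bar>)"

lemma BL_bounded_nonneg: assumes "BL_bounded B L g" shows "0 \<le> B" "0 \<le> L"
proof -
  have "cmod (g 0) \<le> B" "cmod (g 1 - g 0) \<le> L * \<bar>1 - 0\<bar>" using assms unfolding BL_bounded_def by blast+
  then show "0 \<le> B" "0 \<le> L" by (auto intro: order_trans[OF norm_ge_zero])
qed

lemma BL_bounded_mult:
  assumes "BL_bounded B L g" "BL_bounded B' L' h"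
  shows "BL_bounded (B * B') (B * L' + L * B') (\<lambda>x. g x * h x)"
  unfolding BL_bounded_def
proof (intro conjI allI)
  note nn = BL_bounded_nonneg[OF assms(1)] BL_bounded_nonneg[OF assms(2)]
  have g: "cmod (g x) \<le> B" "cmod (g x - g y) \<le> L * \<bar>x - y\<bar>"
    and h: "cmod (h x) \<le> B'" "cmod (h x - h y) \<le> L' * \<bar>x - y\<bar>" for x y
    using assms by (auto simp: BL_bounded_def)
  fix x y
  show "cmod (g x * h x) \<le> B * B'" unfolding norm_mult by (intro mult_mono g h nn norm_ge_zero)
  have "g x * h x - g y * h y = g x * (h x - h y) + (g x - g y) * h y" by (simp add: algebra_simps)
  also have "cmod \<dots> \<le> cmod (g x) * cmod (h x - h y) + cmod (g x - g y) * cmod (h y)"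
    by (rule order_trans[OF norm_triangle_ineq]) (simp add: norm_mult)
  also have "\<dots> \<le> B * (L' * \<bar>x - y\<bar>) + (L * \<bar>x - y\<bar>) * B'"
    by (intro add_mono mult_mono g h nn norm_ge_zero mult_nonneg_nonneg abs_ge_zero)
  finally show "cmod (g x * h x - g y * h y) \<le> (B * L' + L * B') * \<bar>x - y\<bar>" by (simp add: algebra_simps)
qed

lemma Re_Im_blfun:
  assumes "BL_bounded B L g"
  shows "apply_blfun (Abs_blfun (\<lambda>x. Re (g x))) = (\<lambda>x. Re (g x))" "norm (Abs_blfun (\<lambda>x. Re (g x))) \<le> B + L"
    and "apply_blfun (Abs_blfun (\<lambda>x. Im (g x))) = (\<lambda>x. Im (g x))" "norm (Abs_blfun (\<lambda>x. Im (g x))) \<le> B + L"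
proof -
  note nn = BL_bounded_nonneg[OF assms]
  have *: "apply_blfun (Abs_blfun f) = f \<and> norm (Abs_blfun f) \<le> B + L"
    if "\<And>x. \<bar>f x\<bar> \<le> B" "\<And>x y. \<bar>f x - f y\<bar> \<le> L * \<bar>x - y\<bar>" for f
  proof -
    have "bounded (range f)" using that(1) by (intro boundedI[of _ B]) auto
    moreover have "L-lipschitz_on UNIV f" using that(2) nn by (auto simp: lipschitz_on_def dist_real_def)
    ultimately have e: "apply_blfun (Abs_blfun f) = f" by (intro Abs_blfun_inverse) blast
    have "sup_seminorm f + lip_seminorm f \<le> B + L"
      by (intro add_mono sup_seminorm_least lip_seminorm_least that)
    then show ?thesis by (simp add: norm_blfun.rep_eq e)
  qed
  have g: "cmod (g x) \<le> B" "cmod (g x - g y) \<le> L * \<bar>x - y\<bar>" for x y using assms by (auto simp: BL_bounded_def)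
  have "apply_blfun (Abs_blfun (\<lambda>x. Re (g x))) = (\<lambda>x. Re (g x)) \<and> norm (Abs_blfun (\<lambda>x. Re (g x))) \<le> B + L"
    by (rule *[OF order_trans[OF abs_Re_le_cmod g(1)] order_trans[OF re_im_diff_le(1) g(2)]])
  then show "apply_blfun (Abs_blfun (\<lambda>x. Re (g x))) = (\<lambda>x. Re (g x))" "norm (Abs_blfun (\<lambda>x. Re (g x))) \<le> B + L" by auto
  have "apply_blfun (Abs_blfun (\<lambda>x. Im (g x))) = (\<lambda>x. Im (g x)) \<and> norm (Abs_blfun (\<lambda>x. Im (g x))) \<le> B + L"
    by (rule *[OF order_trans[OF abs_Im_le_cmod g(1)] order_trans[OF re_im_diff_le(2) g(2)]])
  then show "apply_blfun (Abs_blfun (\<lambda>x. Im (g x))) = (\<lambda>x. Im (g x))" "norm (Abs_blfun (\<lambda>x. Im (g x))) \<le> B + L" by auto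
qed

text \<open>The complex-linear extension of a functional to complex-valued functions.\<close>

definition cpair :: "bldual \<Rightarrow> (real \<Rightarrow> complex) \<Rightarrow> complex" where
  "cpair \<phi> g = Complex (blinfun_apply \<phi> (Abs_blfun (\<lambda>x. Re (g x)))) (blinfun_apply \<phi> (Abs_blfun (\<lambda>x. Im (g x))))"

text \<open>The pairing extended to the complexified dual space, where \<open>(\<phi>, \<psi>)\<close> stands
  for \<open>\<phi> + \<i> \<psi>\<close>.\<close>

definition cxpair :: "bldual \<times> bldual \<Rightarrow> (real \<Rightarrow> complex) \<Rightarrow> complex" where
  "cxpair p g = cpair (fst p) g + \<i> * cpair (snd p) g"

lemma cpair_lin:
  assumes g: "BL_bounded B L g" and h: "BL_bounded B' L' h" and gh: "BL_bounded B'' L'' (\<lambda>x. c * g x + h x)"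
  shows "cpair \<phi> (\<lambda>x. c * g x + h x) = c * cpair \<phi> g + cpair \<phi> h"
proof -
  have "Abs_blfun (\<lambda>x. Re (c * g x + h x)) = Re c *\<^sub>R Abs_blfun (\<lambda>x. Re (g x)) - Im c *\<^sub>R Abs_blfun (\<lambda>x. Im (g x)) + Abs_blfun (\<lambda>x. Re (h x))"
    unfolding apply_blfun_inject[symmetric] Re_Im_blfun[OF gh] plus_blfun.rep_eq minus_blfun.rep_eq scaleR_blfun.rep_eq
      Re_Im_blfun[OF g] Re_Im_blfun[OF h] by (simp add: fun_eq_iff)
  moreover have "Abs_blfun (\<lambda>x. Im (c * g x + h x)) = Re c *\<^sub>R Abs_blfun (\<lambda>x. Im (g x)) + Im c *\<^sub>R Abs_blfun (\<lambda>x. Re (g x)) + Abs_blfun (\<lambda>x. Im (h x))"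
    unfolding apply_blfun_inject[symmetric] Re_Im_blfun[OF gh] plus_blfun.rep_eq minus_blfun.rep_eq scaleR_blfun.rep_eq
      Re_Im_blfun[OF g] Re_Im_blfun[OF h] by (simp add: fun_eq_iff)
  ultimately show ?thesis
    by (simp add: cpair_def complex_eq_iff blinfun.add_right blinfun.diff_right blinfun.scaleR_right)
qed

lemma cxpair_lin:
  assumes "BL_bounded B L g" "BL_bounded B' L' h" "BL_bounded B'' L'' (\<lambda>x. c * g x + h x)"
  shows "cxpair p (\<lambda>x. c * g x + h x) = c * cxpair p g + cxpair p h"
  unfolding cxpair_def cpair_lin[OF assms] by (simp add: algebra_simps)

lemma cxpair_cline: "cxpair (cline p v t) g = cxpair p g + t * cxpair (v, 0) g"
  by (simp add: cxpair_def cpair_def cline_def complex_eq_iff blinfun.add_left blinfun.scaleR_left algebra_simps)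

lemma cxpair_diff: "cxpair (p - p') g = cxpair p g - cxpair p' g"
  by (simp add: cxpair_def cpair_def complex_eq_iff blinfun.diff_left)

lemma norm_cxpair_le:
  assumes "BL_bounded B L g"
  shows "cmod (cxpair p g) \<le> 4 * (B + L) * norm p"
proof -
  note nn = BL_bounded_nonneg[OF assms]
  have c: "cmod (cpair \<phi> g) \<le> 2 * (B + L) * norm \<phi>" for \<phi>
  proof -
    have "\<bar>blinfun_apply \<phi> f\<bar> \<le> norm \<phi> * (B + L)" if "norm f \<le> B + L" for f
      using norm_blinfun[of \<phi> f] mult_left_mono[OF that norm_ge_zero[of \<phi>]] by simp
    then have "\<bar>Re (cpair \<phi> g)\<bar> + \<bar>Im (cpair \<phi> g)\<bar> \<le> norm \<phi> * (B + L) + norm \<phi> * (B + L)"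
      unfolding cpair_def complex.sel by (intro add_mono) (auto simp: Re_Im_blfun[OF assms])
    then show ?thesis using cmod_le[of "cpair \<phi> g"] by (simp add: algebra_simps)
  qed
  have "cmod (cxpair p g) \<le> cmod (cpair (fst p) g) + cmod (cpair (snd p) g)"
    unfolding cxpair_def by (rule order_trans[OF norm_triangle_ineq]) (simp add: norm_mult)
  also have "\<dots> \<le> 2 * (B + L) * norm p + 2 * (B + L) * norm p"
    using nn norm_fst_le[of p] norm_snd_le[of p]
    by (intro add_mono order_trans[OF c] mult_left_mono) (auto simp: norm_prod_def)
  finally show ?thesis by (simp add: algebra_simps)
qed

lemma cxpair_law:
  assumes R: "real_distribution R" and g: "BL_bounded B L g"
  shows "cxpair (law_dual R, 0) g = Complex (\<integral>x. Re (g x) \<partial>R) (\<integral>x. Im (g x) \<partial>R)"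
  by (simp add: cxpair_def cpair_def law_dual_apply[OF R] Re_Im_blfun[OF g] complex_eq_iff)

lemma BL_bounded_kernel:
  assumes "0 < \<delta>" "\<delta> \<le> \<bar>Im z\<bar>"
  shows "BL_bounded (1 / \<delta>) (1 / \<delta>\<^sup>2) (cauchy_kernel z)"
  unfolding BL_bounded_def
proof (intro conjI allI)
  have nz: "Im z \<noteq> 0" using assms by auto
  fix x y
  have "1 / \<bar>Im z\<bar> \<le> 1 / \<delta>" using assms by (intro divide_left_mono) auto
  then show "cmod (cauchy_kernel z x) \<le> 1 / \<delta>" using norm_cauchy_kernel_le[OF nz, of x] by linarith
  have "1 / (\<bar>Im z\<bar> * \<bar>Im z\<bar>) \<le> 1 / \<delta>\<^sup>2"
    unfolding power2_eq_square using assms by (intro divide_left_mono mult_mono mult_pos_pos) auto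
  then have "\<bar>x - y\<bar> * (1 / (\<bar>Im z\<bar> * \<bar>Im z\<bar>)) \<le> \<bar>x - y\<bar> * (1 / \<delta>\<^sup>2)" by (intro mult_left_mono) auto
  then show "cmod (cauchy_kernel z x - cauchy_kernel z y) \<le> 1 / \<delta>\<^sup>2 * \<bar>x - y\<bar>"
    using cauchy_kernel_diff[OF nz nz, of x y] by (simp add: mult.commute)
qed

definition kernel_sq :: "complex \<Rightarrow> real \<Rightarrow> complex" where
  "kernel_sq z x = cauchy_kernel z x * cauchy_kernel z x"

lemma BL_bounded_kernel_sq:
  assumes "0 < \<delta>" "\<delta> \<le> \<bar>Im z\<bar>"
  shows "BL_bounded (1 / \<delta> * (1 / \<delta>)) (1 / \<delta> * (1 / \<delta>\<^sup>2) + 1 / \<delta>\<^sup>2 * (1 / \<delta>)) (kernel_sq z)"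
  unfolding kernel_sq_def by (intro BL_bounded_mult BL_bounded_kernel assms)

text \<open>The resolvent identity applied twice: the second-order expansion of the Cauchy kernel in
  its parameter, with a remainder whose bounded Lipschitz norm is controlled.\<close>

lemma kernel_expansion:
  assumes "Im z \<noteq> 0" "Im w \<noteq> 0"
  shows "cauchy_kernel z x = (z - w) * (kernel_sq w x + (z - w) * (cauchy_kernel z x * kernel_sq w x)) + cauchy_kernel w x"
proof -
  have nz: "of_real x - z \<noteq> 0" "of_real x - w \<noteq> 0" using assms by (auto simp: complex_eq_iff)
  have d: "cauchy_kernel z x = (z - w) * (cauchy_kernel z x * cauchy_kernel w x) + cauchy_kernel w x"
  proof -
    have "1 / u = e * (1 / u * (1 / v)) + 1 / v" if "u \<noteq> 0" "v \<noteq> 0" "e = v - u" for u v e :: complex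
      using that by (simp add: field_simps)
    moreover have "z - w = (of_real x - w) - (of_real x - z)" by simp
    ultimately show ?thesis unfolding cauchy_kernel_def using nz by blast
  qed
  have "(z - w) * (cauchy_kernel z x * cauchy_kernel w x)
      = (z - w) * (((z - w) * (cauchy_kernel z x * cauchy_kernel w x) + cauchy_kernel w x) * cauchy_kernel w x)"
    by (subst d) (rule refl)
  also have "\<dots> = (z - w) * (kernel_sq w x + (z - w) * (cauchy_kernel z x * kernel_sq w x))"
    unfolding kernel_sq_def by (simp add: algebra_simps)
  finally show ?thesis by (rule trans[OF d arg_cong[of _ _ "\<lambda>t. t + cauchy_kernel w x"]])
qed

lemma BL_bounded_lin:
  assumes "BL_bounded B L g" "BL_bounded B' L' h"
  shows "BL_bounded (cmod c * B + B') (cmod c * L + L') (\<lambda>x. c * g x + h x)"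
  unfolding BL_bounded_def
proof (intro conjI allI)
  have g: "cmod (g x) \<le> B" "cmod (g x - g y) \<le> L * \<bar>x - y\<bar>"
    and h: "cmod (h x) \<le> B'" "cmod (h x - h y) \<le> L' * \<bar>x - y\<bar>" for x y
    using assms by (auto simp: BL_bounded_def)
  fix x y
  show "cmod (c * g x + h x) \<le> cmod c * B + B'"
    by (rule order_trans[OF norm_triangle_ineq]) (simp add: norm_mult add_mono mult_left_mono g h)
  have "c * g x + h x - (c * g y + h y) = c * (g x - g y) + (h x - h y)" by (simp add: algebra_simps)
  also have "cmod \<dots> \<le> cmod c * (L * \<bar>x - y\<bar>) + L' * \<bar>x - y\<bar>"
    by (rule order_trans[OF norm_triangle_ineq]) (unfold norm_mult, intro add_mono mult_left_mono g h norm_ge_zero)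
  finally show "cmod (c * g x + h x - (c * g y + h y)) \<le> (cmod c * L + L') * \<bar>x - y\<bar>" by (simp add: algebra_simps)
qed

text \<open>The kernel is differentiable in its parameter as a curve in the space of bounded
  Lipschitz functions, so every functional can be differentiated under the pairing, whether or
  not it comes from a measure.\<close>

lemma cxpair_kernel_deriv:
  assumes w: "Im w \<noteq> 0"
  shows "((\<lambda>z. cxpair p (cauchy_kernel z)) has_field_derivative cxpair p (kernel_sq w)) (at w)"
proof -
  define \<delta> where "\<delta> = \<bar>Im w\<bar> / 2"
  have \<delta>: "0 < \<delta>" "\<delta> \<le> \<bar>Im w\<bar>" using w by (auto simp: \<delta>_def)
  note bw = BL_bounded_kernel[OF \<delta>] and bs = BL_bounded_kernel_sq[OF \<delta>]
  define B2 L2 where "B2 = 1 / \<delta> * (1 / \<delta>)" and "L2 = 1 / \<delta> * (1 / \<delta>\<^sup>2) + 1 / \<delta>\<^sup>2 * (1 / \<delta>)"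
  define C where "C = 4 * (1 / \<delta> * B2 + (1 / \<delta> * L2 + 1 / \<delta>\<^sup>2 * B2)) * norm p"
  have est: "cmod ((cxpair p (cauchy_kernel z) - cxpair p (cauchy_kernel w)) / (z - w) - cxpair p (kernel_sq w)) \<le> C * cmod (z - w)"
    if z: "\<delta> \<le> \<bar>Im z\<bar>" "z \<noteq> w" for z
  proof -
    note bz = BL_bounded_kernel[OF \<delta>(1) z(1)]
    have bzs: "BL_bounded (1 / \<delta> * B2) (1 / \<delta> * L2 + 1 / \<delta>\<^sup>2 * B2) (\<lambda>x. cauchy_kernel z x * kernel_sq w x)"
      unfolding B2_def L2_def by (rule BL_bounded_mult[OF bz bs])
    let ?r = "\<lambda>x. cauchy_kernel z x * kernel_sq w x"
    have Imz: "Im z \<noteq> 0" using z \<delta> by auto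
    have inner: "cxpair p (\<lambda>x. (z - w) * ?r x + kernel_sq w x) = (z - w) * cxpair p ?r + cxpair p (kernel_sq w)"
      by (rule cxpair_lin[OF bzs bs BL_bounded_lin[OF bzs bs]])
    note bi = BL_bounded_lin[OF bzs bs, of "z - w"]
    have "cxpair p (\<lambda>x. (z - w) * ((z - w) * ?r x + kernel_sq w x) + cauchy_kernel w x)
        = (z - w) * cxpair p (\<lambda>x. (z - w) * ?r x + kernel_sq w x) + cxpair p (cauchy_kernel w)"
      by (rule cxpair_lin[OF bi bw BL_bounded_lin[OF bi bw]])
    moreover have "(\<lambda>x. (z - w) * ((z - w) * ?r x + kernel_sq w x) + cauchy_kernel w x) = cauchy_kernel z"
      using kernel_expansion[OF Imz w] by (simp add: fun_eq_iff add.commute)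
    ultimately have "cxpair p (cauchy_kernel z) - cxpair p (cauchy_kernel w)
        = (z - w) * ((z - w) * cxpair p ?r + cxpair p (kernel_sq w))" unfolding inner by simp
    then have "(cxpair p (cauchy_kernel z) - cxpair p (cauchy_kernel w)) / (z - w) - cxpair p (kernel_sq w)
        = (z - w) * cxpair p ?r" using z by simp
    then show ?thesis
      using mult_left_mono[OF norm_cxpair_le[OF bzs, of p] norm_ge_zero[of "z - w"]]
      by (simp add: norm_mult C_def mult.commute)
  qed
  have "((\<lambda>z. (cxpair p (cauchy_kernel z) - cxpair p (cauchy_kernel w)) / (z - w) - cxpair p (kernel_sq w)) \<longlongrightarrow> 0) (at w)"
  proof (rule Lim_null_comparison)
    have "((\<lambda>z. \<bar>Im z\<bar>) \<longlongrightarrow> \<bar>Im w\<bar>) (at w)" by (intro tendsto_intros)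
    from order_tendstoD(1)[OF this, of \<delta>] w
    have "\<forall>\<^sub>F z in at w. \<delta> < \<bar>Im z\<bar>" by (simp add: \<delta>_def)
    moreover have "\<forall>\<^sub>F z in at w. z \<noteq> w" by (simp add: eventually_at_filter)
    ultimately show "\<forall>\<^sub>F z in at w. norm ((cxpair p (cauchy_kernel z) - cxpair p (cauchy_kernel w)) / (z - w) - cxpair p (kernel_sq w)) \<le> C * cmod (z - w)"
      by eventually_elim (rule est, auto)
    have "((\<lambda>z. C * cmod (z - w)) \<longlongrightarrow> C * cmod (w - w)) (at w)" by (intro tendsto_intros)
    then show "((\<lambda>z. C * cmod (z - w)) \<longlongrightarrow> 0) (at w)" by simp
  qed
  then show ?thesis unfolding has_field_derivative_iff by (simp add: LIM_zero_iff)
qed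

lemma open_Im_nonzero: "open {z. Im z \<noteq> 0}"
  by (rule open_Collect_neq) (auto intro!: continuous_intros)

lemma cxpair_kernel_holomorphic: "(\<lambda>z. cxpair p (cauchy_kernel z)) holomorphic_on {z. Im z \<noteq> 0}"
  unfolding holomorphic_on_open[OF open_Im_nonzero] using cxpair_kernel_deriv by blast

lemma cxpair_kernel_isCont: "Im z \<noteq> 0 \<Longrightarrow> isCont (\<lambda>z. cxpair p (cauchy_kernel z)) z"
  using cxpair_kernel_deriv by (rule DERIV_isCont)

lemma cxpair_kernel_sq_isCont:
  assumes "Im z \<noteq> 0" shows "isCont (\<lambda>z. cxpair p (kernel_sq z)) z"
proof -
  have "deriv (\<lambda>z. cxpair p (cauchy_kernel z)) holomorphic_on {z. Im z \<noteq> 0}"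
    by (rule holomorphic_deriv[OF cxpair_kernel_holomorphic open_Im_nonzero])
  then have "(\<lambda>z. cxpair p (kernel_sq z)) holomorphic_on {z. Im z \<noteq> 0}"
    by (rule holomorphic_transform) (use DERIV_imp_deriv[OF cxpair_kernel_deriv] in auto)
  then have "continuous_on {z. Im z \<noteq> 0} (\<lambda>z. cxpair p (kernel_sq z))" by (rule holomorphic_on_imp_continuous_on)
  then show ?thesis using assms open_Im_nonzero by (simp add: continuous_on_eq_continuous_at)
qed

text \<open>Continuity in the parameter at a fixed functional, together with the bound of the
  pairing by the norm of the functional, gives joint continuity.\<close>

lemma isCont_joint:
  fixes G :: "complex \<Rightarrow> real \<Rightarrow> complex"
  assumes z0: "Im z0 \<noteq> 0" and bd: "\<And>z. \<bar>Im z0\<bar> / 2 \<le> \<bar>Im z\<bar> \<Longrightarrow> BL_bounded B L (G z)"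
    and c: "isCont (\<lambda>z. cxpair p0 (G z)) z0"
  shows "isCont (\<lambda>x. cxpair (fst x) (G (snd x))) (p0, z0)"
proof -
  have "((\<lambda>x. cxpair p0 (G (snd x))) \<longlongrightarrow> cxpair p0 (G z0)) (at (p0, z0))"
    using isCont_o2[OF isCont_snd[OF continuous_ident], of "(p0, z0)" "\<lambda>z. cxpair p0 (G z)"] c
    by (simp add: isCont_def)
  moreover have "((\<lambda>x. cxpair (fst x - p0) (G (snd x))) \<longlongrightarrow> 0) (at (p0, z0))"
  proof (rule Lim_null_comparison)
    have "((\<lambda>x::(bldual \<times> bldual) \<times> complex. \<bar>Im (snd x)\<bar>) \<longlongrightarrow> \<bar>Im (snd (p0, z0))\<bar>) (at (p0, z0))"
      by (intro tendsto_intros)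
    from order_tendstoD(1)[OF this, of "\<bar>Im z0\<bar> / 2"] z0
    have "\<forall>\<^sub>F x in at (p0, z0). \<bar>Im z0\<bar> / 2 < \<bar>Im (snd x)\<bar>" by simp
    then show "\<forall>\<^sub>F x in at (p0, z0). norm (cxpair (fst x - p0) (G (snd x))) \<le> 4 * (B + L) * norm (fst x - p0)"
      by eventually_elim (rule norm_cxpair_le[OF bd], simp)
    have "((\<lambda>x. 4 * (B + L) * norm (fst x - p0)) \<longlongrightarrow> 4 * (B + L) * norm (fst (p0, z0) - p0)) (at (p0, z0))"
      by (intro tendsto_intros)
    then show "((\<lambda>x. 4 * (B + L) * norm (fst x - p0)) \<longlongrightarrow> 0) (at (p0, z0))" by simp
  qed
  ultimately have "((\<lambda>x. cxpair p0 (G (snd x)) + cxpair (fst x - p0) (G (snd x))) \<longlongrightarrow> cxpair p0 (G z0) + 0) (at (p0, z0))"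
    by (rule tendsto_add)
  then show ?thesis by (simp add: isCont_def cxpair_diff)
qed

lemma isCont_joint_kernel:
  assumes "Im z0 \<noteq> 0"
  shows "isCont (\<lambda>x. cxpair (fst x) (cauchy_kernel (snd x))) (p0, z0)"
    and "isCont (\<lambda>x. cxpair (fst x) (kernel_sq (snd x))) (p0, z0)"
proof -
  have p: "0 < \<bar>Im z0\<bar> / 2" using assms by simp
  show "isCont (\<lambda>x. cxpair (fst x) (cauchy_kernel (snd x))) (p0, z0)"
    by (rule isCont_joint[OF assms BL_bounded_kernel[OF p] cxpair_kernel_isCont[OF assms]])
  show "isCont (\<lambda>x. cxpair (fst x) (kernel_sq (snd x))) (p0, z0)"
    by (rule isCont_joint[OF assms BL_bounded_kernel_sq[OF p] cxpair_kernel_sq_isCont[OF assms]])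
qed

text \<open>At a solution of the score equations for a law, this is the complex conjugate of \<open>z\<close>.
  The formula is holomorphic, unlike conjugation.\<close>

definition mate :: "real \<Rightarrow> bldual \<times> bldual \<Rightarrow> complex \<Rightarrow> complex" where
  "mate \<kappa> p z = z + 2 * of_real \<kappa> / cxpair p (cauchy_kernel z)"

text \<open>The relation \<open>S(cnj z) = - S(z)\<close>, which solutions satisfy, with the conjugate replaced
  by \<open>mate\<close>.\<close>

definition mate_eq :: "real \<Rightarrow> bldual \<times> bldual \<Rightarrow> complex \<Rightarrow> complex" where
  "mate_eq \<kappa> p z = cxpair p (cauchy_kernel z) + cxpair p (cauchy_kernel (mate \<kappa> p z))"

definition mate_eq_deriv :: "real \<Rightarrow> bldual \<times> bldual \<Rightarrow> complex \<Rightarrow> complex" where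
  "mate_eq_deriv \<kappa> p z = cxpair p (kernel_sq z) + cxpair p (kernel_sq (mate \<kappa> p z))
     * (1 - 2 * of_real \<kappa> * cxpair p (kernel_sq z) / (cxpair p (cauchy_kernel z))\<^sup>2)"

lemma mate_eq_has_deriv:
  assumes "Im z \<noteq> 0" "cxpair p (cauchy_kernel z) \<noteq> 0" "Im (mate \<kappa> p z) \<noteq> 0"
  shows "(mate_eq \<kappa> p has_field_derivative mate_eq_deriv \<kappa> p z) (at z)"
proof -
  note d = cxpair_kernel_deriv[OF assms(1), of p]
  have "(mate \<kappa> p has_field_derivative 1 - 2 * of_real \<kappa> * cxpair p (kernel_sq z) / (cxpair p (cauchy_kernel z))\<^sup>2) (at z)"
    unfolding mate_def[abs_def]
    by (rule derivative_eq_intros refl d assms(2))+ (simp add: power2_eq_square)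
  from DERIV_chain2[OF cxpair_kernel_deriv[OF assms(3)] this]
  show ?thesis unfolding mate_eq_def[abs_def] mate_eq_deriv_def by (rule DERIV_add[OF d])
qed

lemma isCont_joint_mate:
  assumes "Im z0 \<noteq> 0" "cxpair p0 (cauchy_kernel z0) \<noteq> 0"
  shows "isCont (\<lambda>x. mate \<kappa> (fst x) (snd x)) (p0, z0)"
  unfolding mate_def using assms by (intro continuous_intros isCont_joint_kernel) auto

lemma isCont_joint_mate_eq:
  assumes "Im z0 \<noteq> 0" "cxpair p0 (cauchy_kernel z0) \<noteq> 0" "Im (mate \<kappa> p0 z0) \<noteq> 0"
  shows "isCont (\<lambda>x. mate_eq \<kappa> (fst x) (snd x)) (p0, z0)"
    and "isCont (\<lambda>x. mate_eq_deriv \<kappa> (fst x) (snd x)) (p0, z0)"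
proof -
  have pm: "isCont (\<lambda>x. (fst x, mate \<kappa> (fst x) (snd x))) (p0, z0)"
    by (intro continuous_intros isCont_joint_mate assms)
  note k = isCont_joint_kernel[OF assms(1), of p0] isCont_joint_kernel[OF assms(3), of p0]
  have m: "isCont (\<lambda>x. cxpair (fst x) (cauchy_kernel (mate \<kappa> (fst x) (snd x)))) (p0, z0)"
    "isCont (\<lambda>x. cxpair (fst x) (kernel_sq (mate \<kappa> (fst x) (snd x)))) (p0, z0)"
    using isCont_o2[OF pm, of "\<lambda>x. cxpair (fst x) (cauchy_kernel (snd x))"]
      isCont_o2[OF pm, of "\<lambda>x. cxpair (fst x) (kernel_sq (snd x))"] k by simp_all
  show "isCont (\<lambda>x. mate_eq \<kappa> (fst x) (snd x)) (p0, z0)"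
    unfolding mate_eq_def by (intro continuous_intros k m)
  show "isCont (\<lambda>x. mate_eq_deriv \<kappa> (fst x) (snd x)) (p0, z0)"
    unfolding mate_eq_deriv_def using assms(2) by (intro continuous_intros k m) auto
qed

lemma isCont_eventually:
  assumes "isCont f a" "open S" "f a \<in> S"
  shows "\<forall>\<^sub>F x in nhds a. f x \<in> S"
proof -
  have "(f \<longlongrightarrow> f a) (nhds a)"
    using assms(1) by (simp add: isCont_def tendsto_at_iff_tendsto_nhds)
  then show ?thesis by (rule topological_tendstoD[OF _ assms(2,3)])
qed

lemma cxpair_line_holomorphic:
  assumes "f holomorphic_on S" "\<And>t. t \<in> S \<Longrightarrow> Im (f t) \<noteq> 0"
  shows "(\<lambda>t. cxpair (cline p v t) (cauchy_kernel (f t))) holomorphic_on S"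
proof -
  have "(\<lambda>t. cxpair p' (cauchy_kernel (f t))) holomorphic_on S" for p'
    using holomorphic_on_compose_gen[OF assms(1) cxpair_kernel_holomorphic[of p']] assms(2)
    by (auto simp: comp_def)
  then show ?thesis unfolding cxpair_cline by (intro holomorphic_intros)
qed

text \<open>The simplified Newton map \<open>z \<mapsto> z - H(z) / c\<close>, with the derivative \<open>c\<close> frozen
  at the known root, is a contraction with factor \<open>1/2\<close> on a small disc, for all \<open>p\<close> near
  \<open>p\<^sub>0\<close>. Its iterates, started at \<open>z\<^sub>0\<close>, are holomorphic along lines, and they
  converge uniformly to the root.\<close>

lemma analytic_root:
  assumes z0: "Im z0 \<noteq> 0" "cxpair p0 (cauchy_kernel z0) \<noteq> 0" "Im (mate \<kappa> p0 z0) \<noteq> 0"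
    and eq: "mate_eq \<kappa> p0 z0 = 0" and nd: "mate_eq_deriv \<kappa> p0 z0 \<noteq> 0"
  shows "\<exists>r>0. \<exists>\<Omega> root. open \<Omega> \<and> p0 \<in> \<Omega> \<and> line_holomorphic \<Omega> root \<and> (\<forall>p\<in>\<Omega>. root p \<in> cball z0 r) \<and>
    (\<forall>p\<in>\<Omega>. \<forall>z\<in>cball z0 r. mate_eq \<kappa> p z = 0 \<longrightarrow> z = root p)"
proof -
  define c where "c = mate_eq_deriv \<kappa> p0 z0"
  have c: "c \<noteq> 0" using nd by (simp add: c_def)
  have "isCont (\<lambda>x. 1 - mate_eq_deriv \<kappa> (fst x) (snd x) / c) (p0, z0)"
    using c by (intro continuous_intros isCont_joint_mate_eq z0) auto
  from isCont_eventually[OF this open_ball[of 0 "1 / 2"]]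
  have e1: "\<forall>\<^sub>F x in nhds (p0, z0). 1 - mate_eq_deriv \<kappa> (fst x) (snd x) / c \<in> ball 0 (1 / 2)"
    using c by (simp add: c_def)
  have "isCont (\<lambda>x. snd x) (p0, z0)" by (intro continuous_intros)
  from isCont_eventually[OF this open_Im_nonzero]
  have e2: "\<forall>\<^sub>F x in nhds (p0, z0). snd x \<in> {z. Im z \<noteq> 0}" using z0(1) by simp
  from isCont_eventually[OF isCont_joint_kernel(1)[OF z0(1), of p0], of "- {0}"]
  have e3: "\<forall>\<^sub>F x in nhds (p0, z0). cxpair (fst x) (cauchy_kernel (snd x)) \<in> - {0}" using z0(2) by (simp add: open_Compl)
  from isCont_eventually[OF isCont_joint_mate[OF z0(1,2)] open_Im_nonzero]
  have e4: "\<forall>\<^sub>F x in nhds (p0, z0). mate \<kappa> (fst x) (snd x) \<in> {z. Im z \<noteq> 0}" using z0(3) by simp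
  have "\<forall>\<^sub>F x in nhds (p0, z0). cmod (1 - mate_eq_deriv \<kappa> (fst x) (snd x) / c) \<le> 1 / 2 \<and> Im (snd x) \<noteq> 0 \<and>
     cxpair (fst x) (cauchy_kernel (snd x)) \<noteq> 0 \<and> Im (mate \<kappa> (fst x) (snd x)) \<noteq> 0"
    using e1 e2 e3 e4 by eventually_elim auto
  then obtain O' where O': "open O'" "(p0, z0) \<in> O'"
    and good: "\<forall>x\<in>O'. cmod (1 - mate_eq_deriv \<kappa> (fst x) (snd x) / c) \<le> 1 / 2 \<and> Im (snd x) \<noteq> 0 \<and>
     cxpair (fst x) (cauchy_kernel (snd x)) \<noteq> 0 \<and> Im (mate \<kappa> (fst x) (snd x)) \<noteq> 0"
    unfolding eventually_nhds by (elim exE conjE)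
  obtain A B where AB: "open A" "open B" "(p0, z0) \<in> A \<times> B" "A \<times> B \<subseteq> O'"
    by (rule open_prod_elim[OF O'])
  then obtain r where r: "0 < r" "cball z0 r \<subseteq> B" using open_contains_cball[of B] by auto
  have "isCont (\<lambda>p. mate_eq \<kappa> p z0) p0"
    using isCont_o2[where f = "\<lambda>p. (p, z0)" and a = p0 and g = "\<lambda>x. mate_eq \<kappa> (fst x) (snd x)"] isCont_joint_mate_eq(1)[OF z0] by simp
  from isCont_eventually[OF this open_ball[of 0 "cmod c * r / 2"]]
  have "\<forall>\<^sub>F p in nhds p0. mate_eq \<kappa> p z0 \<in> ball 0 (cmod c * r / 2)" using eq c r by simp
  then obtain A2 where A2: "open A2" "p0 \<in> A2" "\<forall>p\<in>A2. mate_eq \<kappa> p z0 \<in> ball 0 (cmod c * r / 2)"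
    unfolding eventually_nhds by (elim exE conjE)
  define \<Omega> where "\<Omega> = A \<inter> A2"
  have \<Omega>: "open \<Omega>" "p0 \<in> \<Omega>" using AB A2 by (auto simp: \<Omega>_def)
  have reg: "cmod (1 - mate_eq_deriv \<kappa> p z / c) \<le> 1 / 2" "Im z \<noteq> 0" "cxpair p (cauchy_kernel z) \<noteq> 0" "Im (mate \<kappa> p z) \<noteq> 0"
    if "p \<in> \<Omega>" "z \<in> cball z0 r" for p z
  proof -
    have "(p, z) \<in> O'" using that AB(4) r(2) by (auto simp: \<Omega>_def)
    from bspec[OF good this] show "cmod (1 - mate_eq_deriv \<kappa> p z / c) \<le> 1 / 2" "Im z \<noteq> 0"
      "cxpair p (cauchy_kernel z) \<noteq> 0" "Im (mate \<kappa> p z) \<noteq> 0" by simp_all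
  qed
  define T where "T p z = z - mate_eq \<kappa> p z / c" for p z
  have contr: "dist (T p z) (T p w) \<le> 1 / 2 * dist z w" if p: "p \<in> \<Omega>" and zw: "z \<in> cball z0 r" "w \<in> cball z0 r" for p z w
  proof -
    have "cmod (T p z - T p w) \<le> 1 / 2 * cmod (z - w)"
    proof (rule field_differentiable_bound[OF convex_cball _ _ zw])
      fix u assume u: "u \<in> cball z0 r"
      have "(T p has_field_derivative 1 - mate_eq_deriv \<kappa> p u / c) (at u)"
        unfolding T_def[abs_def] by (intro DERIV_diff DERIV_ident DERIV_cdivide mate_eq_has_deriv reg[OF p u])
      then show "(T p has_field_derivative 1 - mate_eq_deriv \<kappa> p u / c) (at u within cball z0 r)"
        by (rule has_field_derivative_at_within)
      show "cmod (1 - mate_eq_deriv \<kappa> p u / c) \<le> 1 / 2" by (rule reg(1)[OF p u])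
    qed
    then show ?thesis by (simp add: dist_norm)
  qed
  have self: "T p z \<in> cball z0 r" if p: "p \<in> \<Omega>" and z: "z \<in> cball z0 r" for p z
  proof -
    have "dist (T p z) (T p z0) \<le> 1 / 2 * dist z z0" by (rule contr[OF p z]) (use r in simp)
    moreover have "dist z z0 \<le> r" using z by (simp add: dist_commute)
    moreover have "dist (T p z0) z0 \<le> r / 2"
    proof -
      have "cmod (mate_eq \<kappa> p z0) < cmod c * r / 2" using A2(3) p by (simp add: \<Omega>_def)
      then show ?thesis using c by (simp add: T_def dist_norm norm_divide divide_le_eq mult.commute)
    qed
    ultimately have "dist (T p z) z0 \<le> r" using dist_triangle[of "T p z" z0 "T p z0"] by linarith
    then show ?thesis by (simp add: dist_commute)
  qed
  have fixpt: "\<exists>!z. z \<in> cball z0 r \<and> T p z = z" if p: "p \<in> \<Omega>" for p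
  proof (rule Banach_fix[OF compact_imp_complete[OF compact_cball]])
    show "cball z0 r \<noteq> {}" using r by simp
    show "T p ` cball z0 r \<subseteq> cball z0 r" using self[OF p] by blast
    show "dist (T p x) (T p y) \<le> 1 / 2 * dist x y" if "x \<in> cball z0 r" "y \<in> cball z0 r" for x y
      using contr[OF p that] .
  qed auto
  define root where "root p = (THE z. z \<in> cball z0 r \<and> T p z = z)" for p
  have root: "root p \<in> cball z0 r" "T p (root p) = root p" if "p \<in> \<Omega>" for p
    using theI'[OF fixpt[OF that]] by (simp_all add: root_def)
  have root_unique: "z = root p" if "p \<in> \<Omega>" "z \<in> cball z0 r" "mate_eq \<kappa> p z = 0" for p z
  proof -
    have "T p z = z" using that by (simp add: T_def)
    then show ?thesis using fixpt[OF that(1)] that(2) root[OF that(1)] by blast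
  qed
  define Z where "Z n p = (T p ^^ n) z0" for n p
  have Z_Suc: "Z (Suc n) p = T p (Z n p)" and Z_0: "Z 0 p = z0" for n p by (simp_all add: Z_def)
  have Z_in: "Z n p \<in> cball z0 r" if "p \<in> \<Omega>" for n p
  proof (induction n)
    case 0
    then show ?case using r by (simp add: Z_0)
  next
    case (Suc n)
    then show ?case unfolding Z_Suc by (rule self[OF that])
  qed
  have Z_conv: "dist (Z n p) (root p) \<le> (1 / 2) ^ n * r" if p: "p \<in> \<Omega>" for n p
  proof (induction n)
    case 0
    then show ?case using root(1)[OF p] by (simp add: Z_0)
  next
    case (Suc n)
    have "dist (Z (Suc n) p) (root p) = dist (T p (Z n p)) (T p (root p))" by (simp add: Z_Suc root(2)[OF p])
    also have "\<dots> \<le> 1 / 2 * dist (Z n p) (root p)" by (rule contr[OF p Z_in[OF p] root(1)[OF p]])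
    also have "\<dots> \<le> 1 / 2 * ((1 / 2) ^ n * r)" using Suc by simp
    finally show ?case by simp
  qed
  have "line_holomorphic \<Omega> root"
    unfolding line_holomorphic_def
  proof (intro allI)
    fix p v
    let ?S = "{t. cline p v t \<in> \<Omega>}"
    have opS: "open ?S" by (rule open_cline_vimage[OF \<Omega>(1)])
    have Zh: "(\<lambda>t. Z n (cline p v t)) holomorphic_on ?S" for n
    proof (induction n)
      case 0
      then show ?case by (simp add: Z_0)
    next
      case (Suc n)
      have ok: "Im (Z n (cline p v t)) \<noteq> 0" "cxpair (cline p v t) (cauchy_kernel (Z n (cline p v t))) \<noteq> 0"
        "Im (mate \<kappa> (cline p v t) (Z n (cline p v t))) \<noteq> 0" if "t \<in> ?S" for t
        using reg(2-4)[of "cline p v t" "Z n (cline p v t)"] Z_in that by blast+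
      have h1: "(\<lambda>t. cxpair (cline p v t) (cauchy_kernel (Z n (cline p v t)))) holomorphic_on ?S"
        by (rule cxpair_line_holomorphic[OF Suc ok(1)])
      have "(\<lambda>t. mate \<kappa> (cline p v t) (Z n (cline p v t))) holomorphic_on ?S"
        unfolding mate_def using ok(2) by (intro holomorphic_intros Suc h1) auto
      from cxpair_line_holomorphic[OF this ok(3)]
      show ?case unfolding Z_Suc T_def mate_eq_def using c by (intro holomorphic_intros Suc h1) auto
    qed
    show "(\<lambda>t. root (cline p v t)) holomorphic_on ?S"
    proof (rule holomorphic_uniform_sequence[OF opS Zh])
      fix x assume "x \<in> ?S"
      then obtain d where d: "0 < d" "cball x d \<subseteq> ?S" using opS open_contains_cball by blast
      have "uniform_limit (cball x d) (\<lambda>n t. Z n (cline p v t)) (\<lambda>t. root (cline p v t)) sequentially"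
      proof (rule uniform_limitI)
        fix e :: real assume e: "0 < e"
        have "(\<lambda>n. (1 / 2) ^ n * r) \<longlonglongrightarrow> 0 * r" by (intro tendsto_intros LIMSEQ_power_zero) simp
        then have "\<forall>\<^sub>F n in sequentially. (1 / 2) ^ n * r < e" using e by (intro order_tendstoD(2)) auto
        then show "\<forall>\<^sub>F n in sequentially. \<forall>t\<in>cball x d. dist (Z n (cline p v t)) (root (cline p v t)) < e"
        proof eventually_elim
          case (elim n)
          show ?case
          proof
            fix t assume "t \<in> cball x d"
            then have "cline p v t \<in> \<Omega>" using d(2) by blast
            from le_less_trans[OF Z_conv[OF this] elim]
            show "dist (Z n (cline p v t)) (root (cline p v t)) < e" .
          qed
        qed
      qed
      then show "\<exists>d>0. cball x d \<subseteq> ?S \<and>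
          uniform_limit (cball x d) (\<lambda>n t. Z n (cline p v t)) (\<lambda>t. root (cline p v t)) sequentially"
        using d by (intro exI[of _ d] conjI)
    qed
  qed
  then show ?thesis
    using r \<Omega> root(1) root_unique by (intro exI[of _ r] exI[of _ \<Omega>] exI[of _ root] conjI) blast+
qed

lemma cxpair_law_kernel:
  assumes "real_distribution R" "Im z \<noteq> 0"
  shows "cxpair (law_dual R, 0) (cauchy_kernel z) = stieltjes R z"
  unfolding stieltjes_def
  by (rule cxpair_law[OF assms(1) BL_bounded_kernel[of "\<bar>Im z\<bar>"]]) (use assms(2) in auto)

lemma cauchy_kernel_cnj: "cauchy_kernel (cnj z) x = cnj (cauchy_kernel z x)"
  by (simp add: cauchy_kernel_def)

lemma stieltjes_cnj: "stieltjes R (cnj z) = cnj (stieltjes R z)"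
  by (simp add: stieltjes_def cauchy_kernel_cnj complex_eq_iff)

context t_law
begin

lemma score_eq_imp_mate_eq:
  assumes s: "0 < s" and eq: "score_eq \<nu> Q m s"
  defines "z \<equiv> half_plane_point \<nu> (m, s)" and "\<kappa> \<equiv> \<nu> / (\<nu> + 1)"
  shows "Im z = sqrt \<nu> * s" "0 < Im z" "cxpair (law_dual Q, 0) (cauchy_kernel z) = \<i> * of_real (\<kappa> / Im z)"
    "cxpair (law_dual Q, 0) (cauchy_kernel z) \<noteq> 0"
    "mate \<kappa> (law_dual Q, 0) z = cnj z" "mate_eq \<kappa> (law_dual Q, 0) z = 0"
proof -
  show I: "Im z = sqrt \<nu> * s" "0 < Im z" using nu s by (simp_all add: z_def half_plane_point_def)
  have k: "0 < \<kappa>" using nu by (simp add: \<kappa>_def)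
  show S: "cxpair (law_dual Q, 0) (cauchy_kernel z) = \<i> * of_real (\<kappa> / Im z)"
  proof -
    have "cxpair (law_dual Q, 0) (cauchy_kernel z) = stieltjes Q z" using cxpair_law_kernel[OF law] I(2) by simp
    also have "\<dots> = \<i> * of_real (\<kappa> / (sqrt \<nu> * s))"
      using score_eq_iff_stieltjes[OF s, of m] eq unfolding z_def \<kappa>_def by blast
    finally show ?thesis unfolding I(1) .
  qed
  show "cxpair (law_dual Q, 0) (cauchy_kernel z) \<noteq> 0" unfolding S using I(2) k by simp
  show M: "mate \<kappa> (law_dual Q, 0) z = cnj z"
    unfolding mate_def S using I(2) k by (simp add: complex_eq_iff Re_divide Im_divide power2_eq_square)
  have "cxpair (law_dual Q, 0) (cauchy_kernel (cnj z)) = cnj (cxpair (law_dual Q, 0) (cauchy_kernel z))"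
  proof -
    have nz: "Im z \<noteq> 0" "Im (cnj z) \<noteq> 0" using I(2) by auto
    show ?thesis unfolding cxpair_law_kernel[OF law nz(1)] cxpair_law_kernel[OF law nz(2)] by (rule stieltjes_cnj)
  qed
  then show "mate_eq \<kappa> (law_dual Q, 0) z = 0" unfolding mate_eq_def M by (simp add: S)
qed

text \<open>Write \<open>c\<close> for the even score and \<open>w\<close> for the odd one scaled by \<open>\<tau> = Im z\<close>.
  They satisfy \<open>w\<^sup>2 = c - c\<^sup>2\<close> and have the means \<open>\<kappa>\<close> and \<open>0\<close>, so with
  \<open>A\<close> and \<open>B\<close> the means of \<open>c\<^sup>2\<close> and \<open>w c\<close> the variances are \<open>\<kappa> - A\<close> and
  \<open>A - \<kappa>\<^sup>2\<close> and the covariance is \<open>B\<close>. The derivative is real, with the sign of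
  \<open>2 B\<^sup>2 - (2 A - \<kappa>) (\<kappa> - A)\<close>. The Cauchy-Schwarz inequality bounds
  \<open>B\<^sup>2\<close> by \<open>(\<kappa> - A) (A - \<kappa>\<^sup>2)\<close>, and \<open>2 (A - \<kappa>\<^sup>2) < 2
  A - \<kappa>\<close> because \<open>\<kappa> > 1/2\<close>.\<close>

lemma mate_eq_nondegenerate:
  assumes s: "0 < s" and eq: "score_eq \<nu> Q m s"
  defines "z \<equiv> half_plane_point \<nu> (m, s)" and "\<kappa> \<equiv> \<nu> / (\<nu> + 1)"
  shows "mate_eq_deriv \<kappa> (law_dual Q, 0) z \<noteq> 0"
proof -
  note sm = score_eq_imp_mate_eq[OF s eq, folded z_def \<kappa>_def]
  define \<tau> where "\<tau> = sqrt \<nu> * s"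
  have \<tau>: "0 < \<tau>" "\<tau>\<^sup>2 = \<nu> * s\<^sup>2" "Im z = \<tau>" using nu s sm(1) by (auto simp: \<tau>_def power_mult_distrib)
  have \<kappa>: "1 / 2 < \<kappa>" "\<kappa> < 1" using nu by (auto simp: \<kappa>_def field_simps)
  define c w where "c x = \<tau>\<^sup>2 / q \<nu> m s x" and "w x = \<tau> * ((x - m) / q \<nu> m s x)" for x
  have c_pos: "0 < c x" "c x \<le> 1" for x
    using even_score_bound[OF s, of m x] unfolding c_def \<tau>(2) by auto
  have c_eq: "c = (\<lambda>x. \<nu> * s\<^sup>2 / q \<nu> m s x)" unfolding c_def \<tau>(2) ..
  have ic: "integrable Q c" "(\<integral>x. c x \<partial>Q) = \<kappa>"
    unfolding c_eq using integrable_scores[OF s, of m] eq by (simp_all add: score_eq_def \<kappa>_def)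
  have iw: "integrable Q w" "(\<integral>x. w x \<partial>Q) = 0"
    unfolding w_def using integrable_mult_right[OF integrable_scores(1)[OF s, of m], of \<tau>] eq
    by (simp_all only: integral_mult_right_zero score_eq_def mult_zero_right)
  have circle: "(w x)\<^sup>2 = c x - (c x)\<^sup>2" for x
  proof -
    have qp: "0 < q \<nu> m s x" using q_pos nu s by simp
    have "(w x)\<^sup>2 * (q \<nu> m s x)\<^sup>2 = \<tau>\<^sup>2 * (x - m)\<^sup>2" using qp by (simp add: w_def power_mult_distrib power_divide)
    also have "\<dots> = \<tau>\<^sup>2 * q \<nu> m s x - \<tau>\<^sup>2 * \<tau>\<^sup>2" unfolding \<tau>(2) q_def by (simp add: algebra_simps)
    also have "\<dots> = (c x * q \<nu> m s x) * q \<nu> m s x - (c x * q \<nu> m s x)\<^sup>2" using qp by (simp add: c_def power2_eq_square)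
    also have "\<dots> = (c x - (c x)\<^sup>2) * (q \<nu> m s x)\<^sup>2" by (simp add: power2_eq_square algebra_simps)
    finally show ?thesis using qp by simp
  qed
  have w_le: "\<bar>w x\<bar> \<le> 1" for x
  proof -
    have "(w x)\<^sup>2 \<le> 1" unfolding circle using c_pos[of x] zero_le_power2[of "c x"] by linarith
    then show ?thesis by (simp add: abs_square_le_1)
  qed
  have c_meas: "c \<in> borel_measurable borel" unfolding c_def by measurable
  have w_meas: "w \<in> borel_measurable borel" unfolding w_def by measurable
  define A B where "A = (\<integral>x. (c x)\<^sup>2 \<partial>Q)" and "B = (\<integral>x. w x * c x \<partial>Q)"
  have ic2: "integrable Q (\<lambda>x. (c x)\<^sup>2)"
    by (rule integrable_bounded[where B = 1]) (use c_meas c_pos in \<open>auto simp: power_le_one less_imp_le\<close>)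
  have iwc: "integrable Q (\<lambda>x. w x * c x)"
  proof (rule integrable_bounded[where B = 1])
    show "(\<lambda>x. w x * c x) \<in> borel_measurable borel" using c_meas w_meas by measurable
    show "\<bar>w x * c x\<bar> \<le> 1" for x
      unfolding abs_mult using w_le[of x] c_pos[of x] by (intro mult_le_one) auto
  qed
  have AB: "2 * B\<^sup>2 < (2 * A - \<kappa>) * (\<kappa> - A)"
  proof -
    have gap: "0 < \<kappa> - A"
    proof -
      have n: "0 \<le> c x - (c x)\<^sup>2" for x using circle[of x] zero_le_power2[of "w x"] by linarith
      have e: "(\<integral>x. c x - (c x)\<^sup>2 \<partial>Q) = \<kappa> - A" using ic ic2 by (simp add: A_def)
      then have "0 \<le> \<kappa> - A" using n Bochner_Integration.integral_nonneg[of Q "\<lambda>x. c x - (c x)\<^sup>2"] by simp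
      moreover have "\<kappa> - A \<noteq> 0"
      proof
        assume "\<kappa> - A = 0"
        then have "AE x in Q. c x - (c x)\<^sup>2 = 0"
          using integral_nonneg_eq_0_iff_AE[OF Bochner_Integration.integrable_diff[OF ic(1) ic2]] n e by simp
        then have "AE x in Q. c x = 1"
        proof (rule AE_mp, intro AE_I2 impI)
          fix x assume "c x - (c x)\<^sup>2 = 0"
          then have "c x * (1 - c x) = 0" by (simp add: power2_eq_square algebra_simps)
          then show "c x = 1" using c_pos[of x] by simp
        qed
        then have "(\<integral>x. c x \<partial>Q) = (\<integral>x. 1 \<partial>Q)" using c_meas by (intro integral_cong_AE) auto
        then show False using ic \<kappa> prob_space by simp
      qed
      ultimately show ?thesis by simp
    qed
    \<comment> \<open>The square with these coefficients is the optimal one in the Cauchy-Schwarz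
      inequality for \<open>w\<close> and \<open>c - \<kappa>\<close>.\<close>
    have expand: "(- B * w x + (\<kappa> - A) * (c x - \<kappa>))\<^sup>2 = B\<^sup>2 * (c x - (c x)\<^sup>2) - 2 * B * (\<kappa> - A) * (w x * c x)
        + 2 * B * (\<kappa> - A) * \<kappa> * w x + (\<kappa> - A)\<^sup>2 * (c x)\<^sup>2 - 2 * (\<kappa> - A)\<^sup>2 * \<kappa> * c x + (\<kappa> - A)\<^sup>2 * \<kappa>\<^sup>2" for x
      unfolding circle[symmetric] by (simp add: power2_eq_square algebra_simps)
    have "0 \<le> (\<integral>x. (- B * w x + (\<kappa> - A) * (c x - \<kappa>))\<^sup>2 \<partial>Q)" by (rule Bochner_Integration.integral_nonneg) simp
    also have "\<dots> = B\<^sup>2 * (\<kappa> - A) - 2 * B * (\<kappa> - A) * B + (\<kappa> - A)\<^sup>2 * A - 2 * (\<kappa> - A)\<^sup>2 * \<kappa> * \<kappa> + (\<kappa> - A)\<^sup>2 * \<kappa>\<^sup>2"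
    proof -
      have "(\<integral>x. B\<^sup>2 * (c x - (c x)\<^sup>2) - 2 * B * (\<kappa> - A) * (w x * c x)
        + 2 * B * (\<kappa> - A) * \<kappa> * w x + (\<kappa> - A)\<^sup>2 * (c x)\<^sup>2 - 2 * (\<kappa> - A)\<^sup>2 * \<kappa> * c x + (\<kappa> - A)\<^sup>2 * \<kappa>\<^sup>2 \<partial>Q)
        = B\<^sup>2 * ((\<integral>x. c x \<partial>Q) - (\<integral>x. (c x)\<^sup>2 \<partial>Q)) - 2 * B * (\<kappa> - A) * (\<integral>x. w x * c x \<partial>Q)
        + 2 * B * (\<kappa> - A) * \<kappa> * (\<integral>x. w x \<partial>Q) + (\<kappa> - A)\<^sup>2 * (\<integral>x. (c x)\<^sup>2 \<partial>Q) - 2 * (\<kappa> - A)\<^sup>2 * \<kappa> * (\<integral>x. c x \<partial>Q)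
        + (\<kappa> - A)\<^sup>2 * \<kappa>\<^sup>2"
        using ic(1) ic2 iw(1) iwc prob_space by simp
      then show ?thesis unfolding expand by (simp add: ic iw A_def[symmetric] B_def[symmetric])
    qed
    also have "\<dots> = (\<kappa> - A) * ((\<kappa> - A) * (A - \<kappa>\<^sup>2) - B\<^sup>2)" by (simp add: power2_eq_square algebra_simps)
    finally have "B\<^sup>2 \<le> (\<kappa> - A) * (A - \<kappa>\<^sup>2)" using gap by (simp add: zero_le_mult_iff)
    then have "2 * B\<^sup>2 \<le> 2 * ((\<kappa> - A) * (A - \<kappa>\<^sup>2))" by simp
    also have "\<dots> = (\<kappa> - A) * (2 * (A - \<kappa>\<^sup>2))" by (rule mult.left_commute)
    also have "(\<kappa> - A) * (2 * (A - \<kappa>\<^sup>2)) < (\<kappa> - A) * (2 * A - \<kappa>)"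
    proof (rule mult_strict_left_mono[OF _ gap])
      have "1 / 2 * \<kappa> < \<kappa> * \<kappa>" using \<kappa> by (intro mult_strict_right_mono) auto
      then show "2 * (A - \<kappa>\<^sup>2) < 2 * A - \<kappa>" by (simp add: power2_eq_square)
    qed
    finally show ?thesis by (simp only: mult.commute[of "\<kappa> - A"])
  qed
  define a where "a = cxpair (law_dual Q, 0) (kernel_sq z)"
  have bsq: "BL_bounded (1 / \<tau> * (1 / \<tau>)) (1 / \<tau> * (1 / \<tau>\<^sup>2) + 1 / \<tau>\<^sup>2 * (1 / \<tau>)) (kernel_sq u)" if "\<bar>Im u\<bar> = \<tau>" for u
    using BL_bounded_kernel_sq[OF \<tau>(1), of u] that by simp
  have k: "Re (cauchy_kernel z x) = w x / \<tau>" "Im (cauchy_kernel z x) = c x / \<tau>" for x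
  proof -
    have "(x - m)\<^sup>2 + \<tau>\<^sup>2 = q \<nu> m s x" unfolding \<tau>(2) q_def by simp
    moreover have "z = Complex m \<tau>" by (simp add: z_def half_plane_point_def \<tau>_def)
    ultimately show "Re (cauchy_kernel z x) = w x / \<tau>" "Im (cauchy_kernel z x) = c x / \<tau>"
      using \<tau>(1) by (simp_all add: cauchy_kernel_def Re_divide Im_divide w_def c_def power2_eq_square[of \<tau>])
  qed
  have "a = Complex (\<integral>x. (c x - 2 * (c x)\<^sup>2) / \<tau>\<^sup>2 \<partial>Q) (\<integral>x. 2 * (w x * c x) / \<tau>\<^sup>2 \<partial>Q)"
  proof -
    have "Re (kernel_sq z x) = (c x - 2 * (c x)\<^sup>2) / \<tau>\<^sup>2" "Im (kernel_sq z x) = 2 * (w x * c x) / \<tau>\<^sup>2" for x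
    proof -
      have "Re (kernel_sq z x) = ((w x)\<^sup>2 - (c x)\<^sup>2) / \<tau>\<^sup>2"
        by (simp add: kernel_sq_def k power2_eq_square diff_divide_distrib)
      then show "Re (kernel_sq z x) = (c x - 2 * (c x)\<^sup>2) / \<tau>\<^sup>2" unfolding circle by simp
      show "Im (kernel_sq z x) = 2 * (w x * c x) / \<tau>\<^sup>2"
        by (simp add: kernel_sq_def k power2_eq_square)
    qed
    then show ?thesis unfolding a_def using \<tau>(1,3) by (subst cxpair_law[OF law bsq]) auto
  qed
  then have a: "Re a = (\<kappa> - 2 * A) / \<tau>\<^sup>2" "Im a = 2 * B / \<tau>\<^sup>2"
    using ic ic2 iwc by (simp_all add: A_def B_def)
  have "cxpair (law_dual Q, 0) (kernel_sq (cnj z)) = cnj a"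
  proof -
    have "kernel_sq (cnj z) x = cnj (kernel_sq z x)" for x by (simp add: kernel_sq_def cauchy_kernel_cnj)
    then show ?thesis unfolding a_def using \<tau>(1,3)
      by (subst (1 2) cxpair_law[OF law bsq]) (auto simp: complex_eq_iff)
  qed
  then have D: "mate_eq_deriv \<kappa> (law_dual Q, 0) z
      = a + cnj a * (1 - 2 * of_real \<kappa> * a / (\<i> * of_real (\<kappa> / \<tau>))\<^sup>2)"
    unfolding mate_eq_deriv_def sm(5) by (simp only: sm(3) \<tau>(3) a_def)
  also have "\<dots> = of_real (2 * Re a + 2 * \<tau>\<^sup>2 / \<kappa> * ((Re a)\<^sup>2 + (Im a)\<^sup>2))"
  proof -
    have "2 * of_real \<kappa> * a / (\<i> * of_real (\<kappa> / \<tau>))\<^sup>2 = - of_real (2 * \<tau>\<^sup>2 / \<kappa>) * a"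
      using \<kappa> \<tau>(1) by (simp add: power_mult_distrib power_divide field_simps power2_eq_square)
    then show ?thesis by (simp add: complex_eq_iff power2_eq_square algebra_simps)
  qed
  finally have D: "mate_eq_deriv \<kappa> (law_dual Q, 0) z = of_real (2 * Re a + 2 * \<tau>\<^sup>2 / \<kappa> * ((Re a)\<^sup>2 + (Im a)\<^sup>2))" .
  have "(2 * Re a + 2 * \<tau>\<^sup>2 / \<kappa> * ((Re a)\<^sup>2 + (Im a)\<^sup>2)) * (\<kappa> * \<tau>\<^sup>2) = 2 * \<kappa> * (Re a * \<tau>\<^sup>2) + 2 * ((Re a * \<tau>\<^sup>2)\<^sup>2 + (Im a * \<tau>\<^sup>2)\<^sup>2)"
    using \<kappa> \<tau>(1) by (simp add: power2_eq_square field_simps)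
  also have "\<dots> = 2 * \<kappa> * (\<kappa> - 2 * A) + 2 * ((\<kappa> - 2 * A)\<^sup>2 + (2 * B)\<^sup>2)" using \<tau>(1) by (simp add: a)
  also have "\<dots> = 4 * (2 * B\<^sup>2 - (2 * A - \<kappa>) * (\<kappa> - A))" by (simp add: power2_eq_square algebra_simps)
  also have "\<dots> < 0"
  proof (rule mult_pos_neg)
    show "2 * B\<^sup>2 - (2 * A - \<kappa>) * (\<kappa> - A) < 0" unfolding diff_less_0_iff_less by (rule AB)
  qed simp
  finally show ?thesis unfolding D of_real_eq_0_iff by auto
qed

end

text \<open>The functional of a nearby law is a root of \<open>mate_eq\<close>, and by weak continuity it lies
  in the disc in which the root is unique, so it is the value of the analytic root.\<close>

theorem BL_analytic_M_functional:
  assumes nu: "1 < \<nu>"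
  shows "BL_analytic_on (spread_laws \<nu>) (M_functional \<nu>)"
  unfolding BL_analytic_on_def
proof
  fix Q assume Q: "Q \<in> spread_laws \<nu>"
  have tl: "t_law R \<nu>" if "R \<in> spread_laws \<nu>" for R
    using that nu by (simp add: spread_laws_def t_law_def t_law_axioms_def)
  interpret t_law Q \<nu> by (rule tl[OF Q])
  define \<kappa> where "\<kappa> = \<nu> / (\<nu> + 1)"
  have sol: "half_plane_point \<nu> (M_functional \<nu> R) = Complex (fst (M_functional \<nu> R)) (sqrt \<nu> * snd (M_functional \<nu> R))"
    "0 < snd (M_functional \<nu> R)" "score_eq \<nu> R (fst (M_functional \<nu> R)) (snd (M_functional \<nu> R))"
    "ext_M_functional \<nu> R = M_functional \<nu> R" if "R \<in> spread_laws \<nu>" for R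
    using t_law.spread_M_functional[OF tl[OF that] that] by (simp_all add: half_plane_point_def case_prod_beta)
  let ?z0 = "half_plane_point \<nu> (M_functional \<nu> Q)" and ?p0 = "(law_dual Q, 0 :: bldual)"
  note sQ = sol[OF Q]
  note sm = score_eq_imp_mate_eq[OF sQ(2,3), unfolded prod.collapse, folded \<kappa>_def]
  have "mate_eq_deriv \<kappa> ?p0 ?z0 \<noteq> 0"
    using mate_eq_nondegenerate[OF sQ(2,3), unfolded prod.collapse, folded \<kappa>_def] .
  note nd = this
  have "Im ?z0 \<noteq> 0" "Im (mate \<kappa> ?p0 ?z0) \<noteq> 0" using sm(2) unfolding sm(5) by auto
  from analytic_root[OF this(1) sm(4) this(2) sm(6) nd]
  obtain r \<Omega> root where r: "0 < r" and \<Omega>: "open \<Omega>" "?p0 \<in> \<Omega>" and hol: "line_holomorphic \<Omega> root"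
    and root: "\<forall>p\<in>\<Omega>. root p \<in> cball ?z0 r" "\<forall>p\<in>\<Omega>. \<forall>z\<in>cball ?z0 r. mate_eq \<kappa> p z = 0 \<longrightarrow> z = root p"
    by (elim exE conjE)
  have "isCont (half_plane_point \<nu>) (ext_M_functional \<nu> Q)"
    unfolding half_plane_point_def case_prod_beta Complex_eq by (intro continuous_intros)
  from isCont_tendsto_compose[OF this tendsto_ext_M_functional[OF t_law_axioms]]
  have "\<forall>\<^sub>F R in law_filter Q. dist (half_plane_point \<nu> (ext_M_functional \<nu> R)) (half_plane_point \<nu> (ext_M_functional \<nu> Q)) < r"
    using r by (rule tendstoD)
  from law_filter_dual_nhds[OF law this] obtain W where W: "open W" "law_dual Q \<in> W"
    and near: "\<And>R. real_distribution R \<Longrightarrow> law_dual R \<in> W \<Longrightarrow>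
      dist (half_plane_point \<nu> (ext_M_functional \<nu> R)) (half_plane_point \<nu> (ext_M_functional \<nu> Q)) < r" by blast
  define \<Omega>' where "\<Omega>' = \<Omega> \<inter> (W \<times> UNIV)"
  have \<Omega>': "open \<Omega>'" "?p0 \<in> \<Omega>'" "\<Omega>' \<subseteq> \<Omega>" using \<Omega> W by (auto simp: \<Omega>'_def intro!: open_Int open_Times)
  have hol': "line_holomorphic \<Omega>' root"
    unfolding line_holomorphic_def
  proof (intro allI)
    fix p v show "(\<lambda>t. root (cline p v t)) holomorphic_on {t. cline p v t \<in> \<Omega>'}"
      by (rule holomorphic_on_subset[OF line_holomorphicD[OF hol]]) (use \<Omega>' in blast)
  qed
  have lb: "locally_bounded \<Omega>' root"
    unfolding locally_bounded_def
  proof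
    fix p assume "p \<in> \<Omega>'"
    then obtain e where e: "0 < e" "ball p e \<subseteq> \<Omega>'" using \<Omega>'(1) open_contains_ball by blast
    have "cmod (root p') \<le> cmod ?z0 + r" if "p' \<in> ball p e" for p'
    proof -
      have "p' \<in> \<Omega>" using that e \<Omega>' by blast
      then have "dist ?z0 (root p') \<le> r" using root(1) by simp
      then show ?thesis using norm_triangle_sub[of "root p'" ?z0] by (simp add: dist_norm norm_minus_commute)
    qed
    then show "\<exists>r>0. \<exists>M. ball p r \<subseteq> \<Omega>' \<and> (\<forall>q\<in>ball p r. cmod (root q) \<le> M)" using e by blast
  qed
  define L where "L z = (Re z, Im z / sqrt \<nu>)" for z
  have L: "bounded_linear L"
    unfolding L_def by (intro bounded_linear_Pair bounded_linear_Re bounded_linear_compose[OF bounded_linear_divide bounded_linear_Im])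
  have "analytic_map_on {x. (x, 0) \<in> \<Omega>'} (\<lambda>x. L (root (x, 0)))"
    by (rule analytic_real_slice[OF hol' \<Omega>'(1) lb L])
  moreover have "law_dual Q \<in> {x. (x, 0) \<in> \<Omega>'}" using \<Omega>' by simp
  moreover have "L (root (law_dual R, 0)) = M_functional \<nu> R"
    if R: "R \<in> spread_laws \<nu>" and RW: "law_dual R \<in> {x. (x, 0) \<in> \<Omega>'}" for R
  proof -
    let ?zR = "half_plane_point \<nu> (M_functional \<nu> R)"
    have p: "(law_dual R, 0) \<in> \<Omega>" "law_dual R \<in> W" using RW by (auto simp: \<Omega>'_def)
    have "dist ?zR ?z0 < r"
      using near[OF _ p(2)] R sol(4)[OF R] sol(4)[OF Q] by (simp add: spread_laws_def)
    then have "?zR \<in> cball ?z0 r" by (simp add: dist_commute)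
    moreover have "mate_eq \<kappa> (law_dual R, 0) ?zR = 0"
      using t_law.score_eq_imp_mate_eq(6)[OF tl[OF R] sol(2,3)[OF R]] by (simp add: \<kappa>_def)
    ultimately have "root (law_dual R, 0) = ?zR" using root(2) p(1) by simp
    then show ?thesis using nu by (simp add: L_def sol(1)[OF R])
  qed
  ultimately show "\<exists>W G. law_dual Q \<in> W \<and> analytic_map_on W G \<and> (\<forall>R\<in>spread_laws \<nu>. law_dual R \<in> W \<longrightarrow> G (law_dual R) = M_functional \<nu> R)"
    by (intro exI[of _ "{x. (x, 0) \<in> \<Omega>'}"] exI[of _ "\<lambda>x. L (root (x, 0))"] conjI ballI impI)
qed

theorem theorem25:
  fixes \<nu> :: real
  assumes "1 < \<nu>"
  shows
    "(\<forall>Q\<in>spread_laws \<nu>.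
        is_M_functional \<nu> Q (M_functional \<nu> Q) \<and>
        0 < snd (M_functional \<nu> Q) \<and>
        (\<forall>\<theta>\<in>param_space. critical_point \<nu> Q \<theta> \<longleftrightarrow> \<theta> = M_functional \<nu> Q)) \<and>
     BL_analytic_on (spread_laws \<nu>) (M_functional \<nu>) \<and>
     continuous_map (subtopology weak_law_topology (spread_laws \<nu>))
       (top_of_set ext_param_space) (M_functional \<nu>) \<and>
     (\<forall>Q. real_distribution Q \<longrightarrow> (\<exists>!\<theta>. is_ext_M_functional \<nu> Q \<theta>)) \<and>
     (\<forall>Q\<in>spread_laws \<nu>. ext_M_functional \<nu> Q = M_functional \<nu> Q) \<and>
     (\<forall>Q s. real_distribution Q \<and> \<nu> / (\<nu> + 1) \<le> measure Q {s} \<longrightarrow>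
        (\<forall>t. \<nu> / (\<nu> + 1) \<le> measure Q {t} \<longrightarrow> t = s) \<and>
        ext_M_functional \<nu> Q = (s, 0)) \<and>
     continuous_map weak_law_topology (top_of_set ext_param_space) (ext_M_functional \<nu>) \<and>
     (\<forall>Q (M :: 'w measure) (X :: nat \<Rightarrow> 'w \<Rightarrow> real).
        real_distribution Q \<and> prob_space M \<and>
        prob_space.indep_vars M (\<lambda>_. borel) X {1..} \<and>
        (\<forall>j\<ge>1. distr M borel (X j) = Q) \<longrightarrow>
          (\<forall>n\<ge>1. \<forall>\<omega>\<in>space M.
             \<exists>!\<theta>. is_ext_M_functional \<nu> (empirical_measure n (\<lambda>j. X j \<omega>)) \<theta>) \<and>
          (AE \<omega> in M. (\<lambda>n. ext_M_functional \<nu> (empirical_measure n (\<lambda>j. X j \<omega>)))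
             \<longlonglongrightarrow> ext_M_functional \<nu> Q))"
proof -
  have tl: "t_law Q \<nu>" if "real_distribution Q" for Q
    using that assms by (simp add: t_law_def t_law_axioms_def)
  have spread_tl: "t_law Q \<nu>" if "Q \<in> spread_laws \<nu>" for Q
    using that by (intro tl) (simp add: spread_laws_def)
  have ext_eq: "ext_M_functional \<nu> Q = M_functional \<nu> Q" if "Q \<in> spread_laws \<nu>" for Q
    by (rule t_law.spread_M_functional(4)[OF spread_tl[OF that] that])
  have a: "\<forall>Q\<in>spread_laws \<nu>. is_M_functional \<nu> Q (M_functional \<nu> Q) \<and> 0 < snd (M_functional \<nu> Q) \<and>
      (\<forall>\<theta>\<in>param_space. critical_point \<nu> Q \<theta> \<longleftrightarrow> \<theta> = M_functional \<nu> Q)"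
    by (intro ballI conjI t_law.spread_M_functional(1-3)[OF spread_tl])
  have a_analytic: "BL_analytic_on (spread_laws \<nu>) (M_functional \<nu>)"
    by (rule BL_analytic_M_functional[OF assms])
  have d_cont: "continuous_map weak_law_topology (top_of_set ext_param_space) (ext_M_functional \<nu>)"
    by (rule continuous_map_ext_M_functional[OF assms])
  have a_cont: "continuous_map (subtopology weak_law_topology (spread_laws \<nu>))
      (top_of_set ext_param_space) (M_functional \<nu>)"
    by (rule continuous_map_eq[OF continuous_map_from_subtopology[OF d_cont]])
      (simp add: ext_eq)
  have b: "\<forall>Q. real_distribution Q \<longrightarrow> (\<exists>!\<theta>. is_ext_M_functional \<nu> Q \<theta>)"
    by (intro allI impI t_law.ex1_ext_M_functional[OF tl])
  have c: "\<forall>Q s. real_distribution Q \<and> \<nu> / (\<nu> + 1) \<le> measure Q {s} \<longrightarrow>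
      (\<forall>t. \<nu> / (\<nu> + 1) \<le> measure Q {t} \<longrightarrow> t = s) \<and> ext_M_functional \<nu> Q = (s, 0)"
  proof (intro allI impI, elim conjE, intro conjI allI impI)
    fix Q s assume Q: "real_distribution Q" and s: "\<nu> / (\<nu> + 1) \<le> measure Q {s}"
    interpret t_law Q \<nu> by (rule tl[OF Q])
    show "t = s" if "\<nu> / (\<nu> + 1) \<le> measure Q {t}" for t
      by (rule unique_big_atom[OF s that])
    show "ext_M_functional \<nu> Q = (s, 0)"
      using s by (simp add: solution_def flip: solution_iff)
  qed
  have d: "\<forall>Q (M :: 'w measure) (X :: nat \<Rightarrow> 'w \<Rightarrow> real).
      real_distribution Q \<and> prob_space M \<and> prob_space.indep_vars M (\<lambda>_. borel) X {1..} \<and>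
      (\<forall>j\<ge>1. distr M borel (X j) = Q) \<longrightarrow>
        (\<forall>n\<ge>1. \<forall>\<omega>\<in>space M. \<exists>!\<theta>. is_ext_M_functional \<nu> (empirical_measure n (\<lambda>j. X j \<omega>)) \<theta>) \<and>
        (AE \<omega> in M. (\<lambda>n. ext_M_functional \<nu> (empirical_measure n (\<lambda>j. X j \<omega>)))
           \<longlonglongrightarrow> ext_M_functional \<nu> Q)"
  proof (intro allI impI, elim conjE, intro conjI allI ballI impI)
    fix Q :: "real measure" and M :: "'w measure" and X :: "nat \<Rightarrow> 'w \<Rightarrow> real"
    assume Q: "real_distribution Q" and M: "prob_space M"
      and X: "prob_space.indep_vars M (\<lambda>_. borel) X {1..}" "\<forall>j\<ge>1. distr M borel (X j) = Q"
    show "\<exists>!\<theta>. is_ext_M_functional \<nu> (empirical_measure n (\<lambda>j. X j \<omega>)) \<theta>" if "1 \<le> n" for n \<omega>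
      by (intro t_law.ex1_ext_M_functional[OF tl] real_distribution_empirical that)
    show "AE \<omega> in M. (\<lambda>n. ext_M_functional \<nu> (empirical_measure n (\<lambda>j. X j \<omega>))) \<longlonglongrightarrow> ext_M_functional \<nu> Q"
      by (rule prob_space.AE_tendsto_empirical[OF M X(1) _ tendsto_ext_M_functional[OF tl[OF Q]]])
        (use X(2) in blast)
  qed
  show ?thesis
    by (intro conjI a a_analytic a_cont b c d d_cont) (use ext_eq in blast)
qed

end
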